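(* For any integer $m\equiv1\pmod{24}$ (positive or negative) and for any prime $\ell\ge5$ we have $$h_m\big|T_{\frac52}(\ell^2)=\ell^3\,h_{\ell^2m}+\left(\frac{3m}{\ell}\right)\ell\,h_m,$$ where $\left(\frac{\cdot}{\ell}\right)$ is the Legendre symbol.
   Context: Write $z=x+iy\in\mathbb{H}$, $q=e^{2\pi i z}$, $q^{r}=e^{2\pi i r z}$ for $r\in\mathbb{Q}$, $e(\alpha)=e^{2\pi i\alpha}$; powers use the principal branch. The eta function $\eta(z)=q^{1/24}\prod_{n\ge1}(1-q^n)$ satisfies $\eta(\gamma z)=\varepsilon(\gamma)(cz+d)^{1/2}\eta(z)$ for $\gamma=\begin{pmatrix}a&b\\c&d\end{pmatrix}\in \mathrm{SL}_2(\mathbb{Z})$, which defines the multiplier system $\varepsilon$. For $k=5/2$, $H_k^!(\varepsilon)$ is the complex vector space of real analytic $f:\mathbb{H}\to\mathbb{C}$ such that $f(\gamma z)=\varepsilon(\gamma)(cz+d)^kf(z)$ for all $\gamma\in\mathrm{SL}_2(\mathbb{Z})$, $\Delta_kf=0$ where $\Delta_k=-y^2\left(\frac{\partial^2}{\partial x^2}+\frac{\partial^2}{\partial y^2}\right)+iky\left(\frac{\partial}{\partial x}+i\frac{\partial}{\partial y}\right)$, and such that in the Fourier expansion $$f(z)=\sum_{n\equiv1\,(24)}a^+(n)q^{n/24}+\sum_{n\equiv-1\,(24)}a^-(n)\,\Gamma\!\left(1-k,\tfrac{\pi ny}{6}\right)q^{-n/24}$$ only finitely many $a^{\pm}(n)$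 with $n\le0$ are nonzero. $\beta(y)=\Gamma\!\left(-\tfrac32,\tfrac{\pi y}{6}\right)$, where $\Gamma(s,y)=\int_y^\infty e^{-t}t^{s-1}dt$; for negative real $y$ the principal branch is used ($\arg y=\pi$, path of integration through the upper half plane). For each $m\equiv1\pmod{24}$, $h_m$ is the unique element of $H^!_{5/2}(\varepsilon)$ with Fourier expansion of the form $h_m(z)=q^{m/24}+\sum_{0<n\equiv1\,(24)}p_m^+(n)q^{n/24}$ if $m<0$, and $$h_m(z)=\sum_{0<n\equiv1\,(24)}p_m^+(n)q^{n/24}+i\beta(-my)q^{m/24}+\sum_{0<n\equiv-1\,(24)}p_m^-(n)\beta(ny)q^{-n/24}$$ if $m>0$ (existence and uniqueness of the $h_m$ hold). Hecke operator: for a prime $\ell\ge5$, $T_{5/2}(\ell^2)$ on $H^!_{5/2}(\varepsilon)$ is the usual weight $\frac52$ Hecke operator of index $\ell^2$ on $H^!_{5/2}\left(\Gamma_0(576),\left(\frac{12}{\bullet}\right)\right)$ conjugated by $\begin{pmatrix}24&0\\0&1\end{pmatrix}$. Explicitly, writing $f(z)=\sum_{n\equiv1\,(24)}b(n,y)\,e\!\left(\frac{nx}{24}\right)$, $$f\big|T_{5/2}(\ell^2)(z)=\sum_{n\equiv1\,(24)}\left(b\!\left(\ell^2n,\tfrac{y}{\ell^2}\right)+\ell\left(\tfrac{3n}{\ell}\right)b(n,y)+\ell^3\,b\!\left(\tfrac{n}{\ell^2},\ell^2y\right)\right)e\!\left(\tfrac{nx}{24}\right),$$ where $b(n/\ell^2,\cdot)=0$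 if $\ell^2\nmid n$. On the holomorphic part $\sum b(n)q^{n/24}$ this is $\sum\left(b(\ell^2n)+\ell\left(\frac{3n}{\ell}\right)b(n)+\ell^3b(n/\ell^2)\right)q^{n/24}$.
   Formalization: The printed identity fails when ℓ² divides m (e.g. m = −575, ℓ = 5: compare coefficients of q^{−23/24}); it is proved as printed when ℓ² does not divide m, and with the additional term h_{m/ℓ²} on the right-hand side when ℓ² divides m. *)

theory Defs
  imports
    "HOL-Complex_Analysis.Complex_Analysis"
    "HOL-Number_Theory.Number_Theory"
begin

definition upper_half_plane :: "complex set" where
  "upper_half_plane = {z. Im z > 0}"

definition qpow :: "real \<Rightarrow> complex \<Rightarrow> complex" where
  "qpow r z = exp (2 * of_real pi * \<i> * of_real r * z)"

definition dedekind_eta :: "complex \<Rightarrow> complex" where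
  "dedekind_eta z = qpow (1/24) z * prodinf (\<lambda>n. 1 - qpow 1 z ^ Suc n)"

definition moebius :: "int \<Rightarrow> int \<Rightarrow> int \<Rightarrow> int \<Rightarrow> complex \<Rightarrow> complex" where
  "moebius a b c d z = (of_int a * z + of_int b) / (of_int c * z + of_int d)"

definition eta_multiplier :: "int \<Rightarrow> int \<Rightarrow> int \<Rightarrow> int \<Rightarrow> complex" where
  "eta_multiplier a b c d =
     (THE e. \<forall>z\<in>upper_half_plane.
        dedekind_eta (moebius a b c d z) =
          e * (of_int c * z + of_int d) powr (1/2) * dedekind_eta z)"

text \<open>
  The function \<open>\<Gamma>(s, y)\<close> for real \<open>y \<noteq> 0\<close>. For \<open>y < 0\<close> the path of integration runs from \<open>y\<close>
  along the upper half circle of radius \<open>\<bar>y\<bar>\<close> to \<open>\<bar>y\<bar>\<close> and then along the real axis to infinity.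
  On the whole path \<^const>\<open>powr\<close> is the principal branch, with argument \<open>\<pi>\<close> at the starting point.
\<close>
definition incomplete_Gamma :: "complex \<Rightarrow> real \<Rightarrow> complex" where
  "incomplete_Gamma s y =
     (if y < 0 then contour_integral (part_circlepath 0 \<bar>y\<bar> pi 0) (\<lambda>t. exp (-t) * t powr (s - 1))
      else 0)
     + integral {\<bar>y\<bar>..} (\<lambda>t::real. exp (- of_real t) * of_real t powr (s - 1))"

definition beta_fun :: "real \<Rightarrow> complex" where
  "beta_fun y = incomplete_Gamma (-3/2) (pi * y / 6)"

definition real_analytic_on :: "(complex \<Rightarrow> complex) \<Rightarrow> complex set \<Rightarrow> bool" where
  "real_analytic_on f S \<longleftrightarrow>
     (\<forall>w\<in>S. \<exists>r>0. \<exists>c :: nat \<times> nat \<Rightarrow> complex.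
        \<forall>x y :: real. \<bar>x\<bar> < r \<and> \<bar>y\<bar> < r \<longrightarrow>
          ((\<lambda>(i, j). c (i, j) * of_real x ^ i * of_real y ^ j) has_sum f (w + Complex x y)) UNIV)"

definition partial_x :: "(complex \<Rightarrow> complex) \<Rightarrow> complex \<Rightarrow> complex" where
  "partial_x f z = vector_derivative (\<lambda>t::real. f (z + of_real t)) (at 0)"

definition partial_y :: "(complex \<Rightarrow> complex) \<Rightarrow> complex \<Rightarrow> complex" where
  "partial_y f z = vector_derivative (\<lambda>t::real. f (z + \<i> * of_real t)) (at 0)"

definition hyp_laplacian :: "real \<Rightarrow> (complex \<Rightarrow> complex) \<Rightarrow> complex \<Rightarrow> complex" where
  "hyp_laplacian k f z =
     - (of_real (Im z))\<^sup>2 * (partial_x (partial_x f) z + partial_y (partial_y f) z)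
     + \<i> * of_real k * of_real (Im z) * (partial_x f z + \<i> * partial_y f z)"

definition maass_expansion ::
  "real \<Rightarrow> (int \<Rightarrow> complex) \<Rightarrow> (int \<Rightarrow> complex) \<Rightarrow> (complex \<Rightarrow> complex) \<Rightarrow> bool" where
  "maass_expansion k ap am f \<longleftrightarrow>
     (\<forall>z\<in>upper_half_plane. \<exists>u v.
        ((\<lambda>n. ap n * qpow (of_int n / 24) z) has_sum u) {n. [n = 1] (mod 24)} \<and>
        ((\<lambda>n. am n * incomplete_Gamma (1 - of_real k) (pi * of_int n * Im z / 6)
               * qpow (- of_int n / 24) z) has_sum v) {n. [n = -1] (mod 24)} \<and>
        f z = u + v)"

text \<open>
  Functions on the upper half-plane are represented by total functions on the complex plane that
  vanish outside of it, so that equality on the upper half-plane is equality of functions.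
\<close>
definition weak_harmonic_maass :: "real \<Rightarrow> (complex \<Rightarrow> complex) set" where
  "weak_harmonic_maass k = {f.
     (\<forall>z. z \<notin> upper_half_plane \<longrightarrow> f z = 0) \<and>
     real_analytic_on f upper_half_plane \<and>
     (\<forall>a b c d. a * d - b * c = 1 \<longrightarrow> (\<forall>z\<in>upper_half_plane.
        f (moebius a b c d z) =
          eta_multiplier a b c d * (of_int c * z + of_int d) powr (of_real k) * f z)) \<and>
     (\<forall>z\<in>upper_half_plane. hyp_laplacian k f z = 0) \<and>
     (\<exists>ap am. maass_expansion k ap am f \<and>
        finite {n. [n = 1] (mod 24) \<and> n \<le> 0 \<and> ap n \<noteq> 0} \<and>
        finite {n. [n = -1] (mod 24) \<and> n \<le> 0 \<and> am n \<noteq> 0})}"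

definition is_maass_h :: "int \<Rightarrow> (complex \<Rightarrow> complex) \<Rightarrow> bool" where
  "is_maass_h m f \<longleftrightarrow> f \<in> weak_harmonic_maass (5/2) \<and>
     (if m < 0 then
        (\<exists>pp :: int \<Rightarrow> complex. \<forall>z\<in>upper_half_plane. \<exists>u.
           ((\<lambda>n. pp n * qpow (of_int n / 24) z) has_sum u) {n. 0 < n \<and> [n = 1] (mod 24)} \<and>
           f z = qpow (of_int m / 24) z + u)
      else
        (\<exists>pp pm :: int \<Rightarrow> complex. \<forall>z\<in>upper_half_plane. \<exists>u v.
           ((\<lambda>n. pp n * qpow (of_int n / 24) z) has_sum u) {n. 0 < n \<and> [n = 1] (mod 24)} \<and>
           ((\<lambda>n. pm n * beta_fun (of_int n * Im z) * qpow (- of_int n / 24) z) has_sum v)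
             {n. 0 < n \<and> [n = -1] (mod 24)} \<and>
           f z = u + \<i> * beta_fun (- of_int m * Im z) * qpow (of_int m / 24) z + v))"

definition maass_h :: "int \<Rightarrow> complex \<Rightarrow> complex" where
  "maass_h m = (THE f. is_maass_h m f)"

text \<open>
  The coefficient \<open>b(n, y)\<close> in \<open>f(x + iy) = \<Sum>\<^sub>n b(n, y) e(nx/24)\<close>, for \<open>f\<close> of period 24 in \<open>x\<close>.
\<close>
definition fourier_coeff :: "(complex \<Rightarrow> complex) \<Rightarrow> int \<Rightarrow> real \<Rightarrow> complex" where
  "fourier_coeff f n y =
     integral {0..24} (\<lambda>x. f (Complex x y) * exp (- 2 * of_real pi * \<i> * of_int n * of_real x / 24)) / 24"

definition hecke :: "nat \<Rightarrow> (complex \<Rightarrow> complex) \<Rightarrow> complex \<Rightarrow> complex" where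
  "hecke l f z = (\<Sum>\<^sub>\<infinity>n\<in>{n::int. [n = 1] (mod 24)}.
     (fourier_coeff f ((int l)\<^sup>2 * n) (Im z / (real l)\<^sup>2)
      + of_nat l * of_int (Legendre (3 * n) (int l)) * fourier_coeff f n (Im z)
      + of_nat l ^ 3 * (if (int l)\<^sup>2 dvd n
                       then fourier_coeff f (n div (int l)\<^sup>2) ((real l)\<^sup>2 * Im z) else 0))
     * exp (2 * of_real pi * \<i> * of_int n * of_real (Re z) / 24))"

end

theory Submission
  imports Defs "HOL-Probability.Characteristic_Functions"
begin

text \<open>
  By uniqueness of \<open>h\<^bsub>\<ell>\<^sup>2m\<^esub>\<close> it suffices to show that
  \<open>\<ell>\<^sup>-\<^sup>3(h\<^sub>m | T - (3m/\<ell>) \<ell> h\<^sub>m - h\<^bsub>m/\<ell>\<^sup>2\<^esub>)\<close> is an element of \<open>H\<^sup>!\<close> with the principal part of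
  \<open>h\<^bsub>\<ell>\<^sup>2m\<^esub>\<close> (the last term is absent if \<open>\<ell>\<^sup>2\<close> does not divide \<open>m\<close>). The principal part is read off the
  Fourier coefficients. The operator \<open>T\<close> is a finite combination of substitutions \<open>z \<mapsto> sz + t\<close> with real
  \<open>s > 0\<close> and \<open>t\<close>, which preserves harmonicity, and modularity has to be checked only for the two generators
  of \<open>SL\<^sub>2(\<int>)\<close>. The translation is immediate; for the inversion the substitutions are permuted, up to values of
  the multiplier on matrices with rows \<open>(24u, b)\<close>, \<open>(c, -24w)\<close>.

  The transformation law of the eta function is not needed: the existence of the nonzero form \<open>h\<^bsub>-23\<^esub>\<close>
  makes the multiplier a consistent multiplier system of weight 1/2, and the relations between the generators determine
  such a system from its value \<open>e(1/24)\<close> at the translation. Hence it is also the multiplier system of the theta series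
  \<open>\<Sum> (12/n) q\<^bsup>n\<^sup>2/24\<^esup>\<close>, whose values on these matrices are Gauss sums by Poisson summation along vertical
  lines. The sign of the quadratic Gauss sum never enters, since the Hecke operator is normalised by the same sum.
\<close>

section \<open>Fourier uniqueness on the unit interval\<close>

text \<open>The matrices with entries 24u and -24w come from the Hecke operator: a shifted argument
  after inversion has the form (24 v - 1/t)/c, which is the image of (t + 24 w)/c under such a
  matrix of determinant 1 once 576 v w = -1 modulo c; here c is l or l^2. In this way the inversion
  permutes the shifts by units modulo l^2, exchanges the nonzero multiples of l with the twisted
  average modulo l, and exchanges the shift 0 with the dilation by l^2. The powers of l attached to
  the three pieces are those that weight 5/2 produces under these exchanges. Weights 5/2 and 1/2 can
  share a multiplier because they differ by (cz+d)^2, where no branch is chosen; so the consistency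
  seen in weight 5/2 applies to a theta series of weight 1/2. The coefficient taken at index l^2 n
  moves the principal term of index m to m/l^2. When l^2 divides m, this is the source of the third
  term in the final formula.\<close>

definition ee :: "real \<Rightarrow> complex" where
  "ee x = cis (2 * pi * x)"

lemma ee_add: "ee (x + y) = ee x * ee y"
  by (simp add: ee_def cis_mult algebra_simps)

lemma ee_minus: "ee (- x) = inverse (ee x)"
  by (simp add: ee_def)

lemma cnj_ee: "cnj (ee x) = ee (- x)"
  by (simp add: ee_def cis_cnj)

lemma ee_diff: "ee (x - y) = ee x / ee y"
  by (simp add: ee_def cis_divide algebra_simps)

lemma norm_ee [simp]: "norm (ee x) = 1"
  by (simp add: ee_def)

lemma ee_nonzero [simp]: "ee x \<noteq> 0"
  by (simp add: ee_def)

lemma ee_0 [simp]: "ee 0 = 1"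
  by (simp add: ee_def)

lemma ee_of_int [simp]: "ee (of_int n) = 1"
  unfolding ee_def by (rule cis_multiple_2pi) simp

lemma ee_eq_exp: "ee x = exp (2 * of_real pi * \<i> * of_real x)"
  by (simp add: ee_def cis_conv_exp mult_ac)

lemma ee_eq_1_iff: "ee x = 1 \<longleftrightarrow> x \<in> \<int>"
proof
  assume "ee x = 1"
  then obtain n where "2 * pi * x = of_int (2 * n) * pi"
    unfolding ee_eq_exp exp_eq_1 by auto
  then have "x = of_int n" by simp
  then show "x \<in> \<int>" by simp
qed (auto elim!: Ints_cases)

lemma ee_cong: "x - y \<in> \<int> \<Longrightarrow> ee x = ee y"
  using ee_eq_1_iff[of "x - y"] by (simp add: ee_diff)

lemma ee_cong_int:
  assumes "[a = b] (mod c)"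
  shows "ee (of_int a / of_int c) = ee (of_int b / of_int c)"
proof (cases "c = 0")
  case False
  from assms obtain k where "a - b = c * k"
    by (auto simp: cong_iff_dvd_diff)
  then have "real_of_int a - real_of_int b = of_int c * of_int k"
    by (metis of_int_diff of_int_mult)
  then have "of_int a / of_int c - of_int b / of_int c = real_of_int k"
    using False by (simp add: field_simps)
  then show ?thesis
    by (intro ee_cong) simp
qed simp

lemma continuous_on_ee [continuous_intros]:
  "continuous_on A f \<Longrightarrow> continuous_on A (\<lambda>x. ee (f x))"
  unfolding ee_def cis_conv_exp by (intro continuous_intros)

lemma ee_has_vector_derivative:
  "((\<lambda>x. ee (a * x)) has_vector_derivative (2 * pi * a * \<i>) * ee (a * x)) (at x within A)"
proof -
  have "((\<lambda>z. exp (2 * of_real pi * \<i> * of_real a * z)) has_field_derivative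
      (2 * pi * a * \<i>) * exp (2 * of_real pi * \<i> * of_real a * of_real x)) (at (of_real x))"
    by (rule derivative_eq_intros refl | simp add: mult_ac)+
  from has_vector_derivative_real_field[OF this] show ?thesis
    by (simp add: ee_eq_exp mult_ac)
qed

lemma tendsto_real_difference_quotient:
  assumes "(F has_field_derivative F') (at 0)"
  shows "((\<lambda>x::real. (F (of_real x) - F 0) / of_real x) \<longlongrightarrow> (F' :: complex)) (at 0)"
proof -
  have "((\<lambda>z. (F z - F 0) / (z - 0)) \<longlongrightarrow> F') (at 0)"
    using assms by (simp add: has_field_derivative_iff)
  moreover have "filterlim (of_real :: real \<Rightarrow> complex) (at 0) (at 0)"
    unfolding filterlim_at by (auto simp: eventually_at_filter intro!: tendsto_eq_intros)
  ultimately show ?thesis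
    by (auto dest: filterlim_compose)
qed

lemma integral_ee:
  "integral {-1/2..1/2} (\<lambda>x. ee (of_int m * x)) = (if m = 0 then 1 else 0)"
proof (cases "m = 0")
  case False
  define c where "c = 2 * pi * of_int m * \<i>"
  have c: "c \<noteq> 0" using False by (simp add: c_def)
  have "((\<lambda>x. c * ee (of_int m * x)) has_integral (ee (of_int m * (1/2)) - ee (of_int m * (-1/2)))) {-1/2..1/2}"
    unfolding c_def using ee_has_vector_derivative[of "of_int m"]
    by (intro fundamental_theorem_of_calculus) (auto simp: mult_ac)
  moreover have "ee (of_int m * (1/2)) = ee (of_int m * (-1/2))"
    by (rule ee_cong) auto
  ultimately have "((\<lambda>x. c * ee (of_int m * x)) has_integral 0) {-1/2..1/2}" by simp
  from has_integral_mult_right[OF this, of "inverse c"] show ?thesis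
    using c False by (simp add: mult.assoc[symmetric] integral_unique)
qed simp

text \<open>Bessel's inequality for equal coefficients. With h the sum of the characters over S,
  orthonormality on an interval of length 1 shows that the integral of |g - c h|^2 is the right side
  minus the left.\<close>

lemma bessel_constant_coeff:
  fixes g :: "real \<Rightarrow> complex"
  assumes g: "continuous_on {-1/2..1/2} g" and S: "finite S"
    and c: "\<And>m. m \<in> S \<Longrightarrow> integral {-1/2..1/2} (\<lambda>x. g x * ee (- of_int m * x)) = c"
  shows "card S * (norm c)\<^sup>2 \<le> integral {-1/2..1/2} (\<lambda>x. (norm (g x))\<^sup>2)"
proof -
  let ?I = "{-1/2..1/2::real}"
  define h where "h x = (\<Sum>m\<in>S. ee (of_int m * x))" for x
  have ch: "continuous_on ?I h" unfolding h_def by (intro continuous_intros)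
  have gh: "integral ?I (\<lambda>x. g x * cnj (h x)) = card S * c"
  proof -
    have "integral ?I (\<lambda>x. g x * cnj (h x)) = integral ?I (\<lambda>x. \<Sum>m\<in>S. g x * ee (- of_int m * x))"
      by (simp add: h_def cnj_ee sum_distrib_left)
    also have "\<dots> = (\<Sum>m\<in>S. integral ?I (\<lambda>x. g x * ee (- of_int m * x)))"
      by (intro integral_sum S integrable_continuous_real continuous_intros g)
    also have "\<dots> = (\<Sum>m\<in>S. c)"
      by (intro sum.cong refl c)
    finally show ?thesis by simp
  qed
  have hh: "integral ?I (\<lambda>x. h x * cnj (h x)) = card S"
  proof -
    have "integral ?I (\<lambda>x. h x * cnj (h x)) = integral ?I (\<lambda>x. \<Sum>m\<in>S. \<Sum>k\<in>S. ee (of_int (m - k) * x))"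
      by (simp add: h_def cnj_ee sum_product flip: ee_add) (simp add: algebra_simps)
    also have "\<dots> = (\<Sum>m\<in>S. \<Sum>k\<in>S. integral ?I (\<lambda>x. ee (of_int (m - k) * x)))"
      by (subst integral_sum[OF S], (intro integrable_continuous_real continuous_intros)[1],
          intro sum.cong refl integral_sum S integrable_continuous_real continuous_intros)
    also have "\<dots> = (\<Sum>m\<in>S. \<Sum>k\<in>S. if m = k then 1 else 0)"
      by (intro sum.cong refl) (subst integral_ee, auto)
    finally show ?thesis using S by simp
  qed
  have hg: "integral ?I (\<lambda>x. h x * cnj (g x)) = card S * cnj c"
    using arg_cong[OF gh, of cnj] by (simp add: integral_cnj mult.commute)
  define G where "G x = g x * cnj (g x) - cnj c * (g x * cnj (h x)) - c * (h x * cnj (g x)) + c * cnj c * (h x * cnj (h x))" for x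
  have GG: "complex_of_real ((norm (g x - c * h x))\<^sup>2) = G x" for x
    unfolding complex_norm_square G_def by (simp add: algebra_simps)
  have "integral ?I G = integral ?I (\<lambda>x. g x * cnj (g x)) - card S * (c * cnj c)"
  proof -
    have "((\<lambda>x. g x * cnj (h x)) has_integral card S * c) ?I"
      unfolding gh[symmetric] by (intro integrable_integral integrable_continuous_real continuous_intros g ch)
    moreover have "((\<lambda>x. h x * cnj (g x)) has_integral card S * cnj c) ?I"
      unfolding hg[symmetric] by (intro integrable_integral integrable_continuous_real continuous_intros g ch)
    moreover have "((\<lambda>x. h x * cnj (h x)) has_integral card S) ?I"
      unfolding hh[symmetric] by (intro integrable_integral integrable_continuous_real continuous_intros g ch)
    moreover have "((\<lambda>x. g x * cnj (g x)) has_integral integral ?I (\<lambda>x. g x * cnj (g x))) ?I"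
      by (intro integrable_integral integrable_continuous_real continuous_intros g)
    ultimately have "(G has_integral (integral ?I (\<lambda>x. g x * cnj (g x)) - cnj c * (card S * c) - c * (card S * cnj c) + c * cnj c * card S)) ?I"
      unfolding G_def by (intro has_integral_add has_integral_diff has_integral_mult_right)
    then show ?thesis by (simp add: integral_unique algebra_simps)
  qed
  then have "integral ?I (\<lambda>x. complex_of_real ((norm (g x - c * h x))\<^sup>2)) =
     integral ?I (\<lambda>x. complex_of_real ((norm (g x))\<^sup>2)) - complex_of_real (card S * (norm c)\<^sup>2)"
    unfolding GG unfolding of_real_mult complex_norm_square by simp
  moreover have of_real: "integral ?I (\<lambda>x. complex_of_real (f x)) = of_real (integral ?I f)" if "continuous_on ?I f" for f
    using integral_linear[OF integrable_continuous_real[OF that] bounded_linear_of_real] by (simp add: o_def)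
  moreover have "continuous_on ?I (\<lambda>x. (norm (g x - c * h x))\<^sup>2)" "continuous_on ?I (\<lambda>x. (norm (g x))\<^sup>2)"
    by (intro continuous_intros g ch)+
  ultimately have "complex_of_real (integral ?I (\<lambda>x. (norm (g x - c * h x))\<^sup>2)) =
     of_real (integral ?I (\<lambda>x. (norm (g x))\<^sup>2) - card S * (norm c)\<^sup>2)"
    by (simp only: of_real_diff)
  then have "integral ?I (\<lambda>x. (norm (g x - c * h x))\<^sup>2) = integral ?I (\<lambda>x. (norm (g x))\<^sup>2) - card S * (norm c)\<^sup>2"
    using of_real_eq_iff by blast
  moreover have "integral ?I (\<lambda>x. (norm (g x - c * h x))\<^sup>2) \<ge> 0"
    by (intro integral_nonneg integrable_continuous_real continuous_intros g ch) auto
  ultimately show ?thesis by simp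
qed

text \<open>Arbitrarily large finite subsets of S would push the left side of Bessel's inequality
  above the fixed integral of |g|^2.\<close>

lemma constant_coeff_eq_0:
  fixes g :: "real \<Rightarrow> complex"
  assumes g: "continuous_on {-1/2..1/2} g" and S: "infinite S"
    and c: "\<And>m. m \<in> S \<Longrightarrow> integral {-1/2..1/2} (\<lambda>x. g x * ee (- of_int m * x)) = c"
  shows "c = 0"
proof (rule ccontr)
  assume "c \<noteq> 0"
  then have pos: "(norm c)\<^sup>2 > 0" by simp
  obtain n where n: "integral {-1/2..1/2} (\<lambda>x. (norm (g x))\<^sup>2) < real n * (norm c)\<^sup>2"
    using ex_less_of_nat_mult[OF pos] by blast
  obtain T where T: "T \<subseteq> S" "finite T" "card T = n"
    using infinite_arbitrarily_large[OF S] by blast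
  from bessel_constant_coeff[OF g T(2), of c] c T n show False by auto
qed

text \<open>
  The coefficients of \<open>g(x) = (D(x) - D(0)) / (e(x) - 1)\<close> telescope to those of \<open>D - D(0)\<close>, so they are constant
  on the nonnegative and on the negative indices, and Bessel's inequality makes both constants vanish.
\<close>
lemma fourier_coeffs_0_imp_0:
  fixes D :: "real \<Rightarrow> complex"
  assumes cont: "continuous_on {-1/2..1/2} D"
    and deriv: "((\<lambda>x. (D x - D 0) / of_real x) \<longlongrightarrow> D') (at 0)"
    and coeff: "\<And>m::int. integral {-1/2..1/2} (\<lambda>x. D x * ee (- of_int m * x)) = 0"
  shows "D 0 = 0"
proof -
  let ?I = "{-1/2..1/2::real}"
  \<comment> \<open>The value at 0 is the limit of the quotient (slope \<open>D'\<close> over slope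
    2 pi i), so g is continuous; \<open>ee x - 1\<close> has no other zero in the interval.\<close>
  define g where "g x = (if x = 0 then D' / (2 * pi * \<i>) else (D x - D 0) / (ee x - 1))" for x
  have ne: "ee x \<noteq> 1" if "x \<in> ?I" "x \<noteq> 0" for x
  proof
    assume "ee x = 1"
    then obtain k where "x = of_int k" unfolding ee_eq_1_iff by (auto elim: Ints_cases)
    with that have "-1 < real_of_int k" "real_of_int k < 1" by auto
    then have "-1 < k" "k < 1" by linarith+
    with \<open>x = of_int k\<close> that show False by auto
  qed
  have lim: "(g \<longlongrightarrow> D' / (2 * pi * \<i>)) (at 0)"
  proof -
    have "((\<lambda>z. exp (2 * of_real pi * \<i> * z)) has_field_derivative (2 * pi * \<i>)) (at 0)"
      by (rule derivative_eq_intros refl | simp)+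
    from tendsto_real_difference_quotient[OF this]
    have "((\<lambda>x. (ee x - 1) / of_real x) \<longlongrightarrow> 2 * pi * \<i>) (at 0)"
      by (simp add: ee_eq_exp)
    with deriv have "((\<lambda>x. ((D x - D 0) / of_real x) / ((ee x - 1) / of_real x)) \<longlongrightarrow> D' / (2 * pi * \<i>)) (at 0)"
      by (intro tendsto_divide) auto
    then show ?thesis
      by (rule Lim_transform_eventually) (auto simp: eventually_at_filter g_def scaleR_conv_of_real divide_simps)
  qed
  have "continuous_on ?I g"
    unfolding continuous_on_eq_continuous_within
  proof
    fix x assume x: "x \<in> ?I"
    show "continuous (at x within ?I) g"
    proof (cases "x = 0")
      case True
      have "g 0 = D' / (2 * pi * \<i>)" by (simp add: g_def)
      with lim show ?thesis unfolding True continuous_within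
        by (metis tendsto_within_subset subset_UNIV)
    next
      case False
      have "continuous (at x within ?I) (\<lambda>x. (D x - D 0) / (ee x - 1))"
        using cont x ne[OF x False]  continuous_on_ee[OF continuous_on_id, of ?I]
        by (auto intro!: continuous_intros simp: continuous_on_eq_continuous_within)
      then show ?thesis
        by (rule continuous_transform_within[where \<delta> = "\<bar>x\<bar>"])
           (use x False in \<open>auto simp: g_def dist_real_def\<close>)
    qed
  qed
  note g = this
  have mul: "g x * (ee x - 1) = D x - D 0" if "x \<in> ?I" for x
    using ne[OF that] by (auto simp: g_def)
  define a where "a m = integral ?I (\<lambda>x. g x * ee (- of_int m * x))" for m :: int
  have tele: "a (m - 1) - a m = (if m = 0 then - D 0 else 0)" for m
  proof -
    have "a (m - 1) - a m = integral ?I (\<lambda>x. g x * ee (- of_int (m - 1) * x) - g x * ee (- of_int m * x))"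
      unfolding a_def by (intro integral_diff[symmetric] integrable_continuous_real continuous_intros g)
    also have "\<dots> = integral ?I (\<lambda>x. D x * ee (- of_int m * x) - D 0 * ee (of_int (- m) * x))"
    proof (rule integral_cong)
      fix x assume x: "x \<in> ?I"
      have "- of_int (m - 1) * x = x + - of_int m * x" by (simp add: algebra_simps)
      then have "ee (- of_int (m - 1) * x) = ee x * ee (- of_int m * x)" by (simp only: ee_add)
      then have "g x * ee (- of_int (m - 1) * x) - g x * ee (- of_int m * x) = (g x * (ee x - 1)) * ee (- of_int m * x)"
        by (simp only: left_diff_distrib right_diff_distrib mult.assoc mult_1_left)
      then show "g x * ee (- of_int (m - 1) * x) - g x * ee (- of_int m * x) = D x * ee (- of_int m * x) - D 0 * ee (of_int (- m) * x)"
        unfolding mul[OF x] by (simp only: left_diff_distrib of_int_minus)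
    qed
    also have "\<dots> = integral ?I (\<lambda>x. D x * ee (- of_int m * x)) - D 0 * integral ?I (\<lambda>x. ee (of_int (- m) * x))"
      by (subst integral_diff) (intro integrable_continuous_real continuous_intros cont integral_mult_right | simp)+
    finally show ?thesis by (simp only: coeff integral_ee) simp
  qed
  have nonneg: "a m = a 0" if "m \<ge> 0" for m
    using that
  proof (induction m rule: int_ge_induct)
    case (step i)
    with tele[of "i + 1"] show ?case by simp
  qed simp
  have neg: "a m = a (-1)" if "m \<le> -1" for m
    using that
  proof (induction m rule: int_le_induct)
    case (step i)
    with tele[of i] show ?case by simp
  qed simp
  have "a 0 = 0"
    by (rule constant_coeff_eq_0[OF g, of "{0..}"]) (use nonneg in \<open>auto simp: a_def infinite_Ici\<close>)
  moreover have "a (-1) = 0"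
    by (rule constant_coeff_eq_0[OF g, of "{..-1}"]) (use neg in \<open>auto simp: a_def infinite_Iic\<close>)
  ultimately show ?thesis using tele[of 0] by simp
qed

section \<open>Sums of Gaussians\<close>

lemma summable_on_int_power:
  assumes "0 \<le> r" "r < (1::real)"
  shows "(\<lambda>n::int. r ^ nat \<bar>n\<bar>) summable_on UNIV"
proof -
  have geo: "(\<lambda>n::nat. r ^ n) summable_on UNIV"
    using assms by (subst summable_on_UNIV_nonneg_real_iff) (auto intro: summable_geometric)
  have "(\<lambda>n::int. r ^ nat \<bar>n\<bar>) summable_on range int"
    using geo by (subst summable_on_reindex) (auto simp: o_def)
  moreover have "(\<lambda>n::int. r ^ nat \<bar>n\<bar>) summable_on range (\<lambda>n. - int n)"
    using geo by (subst summable_on_reindex) (auto simp: o_def inj_def)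
  moreover have "range int \<union> range (\<lambda>n. - int n) = UNIV"
  proof (rule UNIV_eq_I[symmetric])
    show "n \<in> range int \<union> range (\<lambda>n. - int n)" for n
      by (cases n rule: int_cases2) auto
  qed
  ultimately show ?thesis by (metis summable_on_union)
qed

lemma summable_on_gaussian:
  assumes a: "a > 0"
  shows "(\<lambda>n::int. exp (- a * (of_int n)\<^sup>2 + b * \<bar>of_int n\<bar> :: real)) summable_on UNIV"
proof -
  \<comment> \<open>The maximum of -a t^2 + (b + 1) t over real t, found by completing the square; a
    factor exp (-|n|) is left over.\<close>
  define C where "C = (b + 1)\<^sup>2 / (4 * a)"
  have bound: "exp (- a * (of_int n)\<^sup>2 + b * \<bar>of_int n\<bar>) \<le> exp C * exp (- 1) ^ nat \<bar>n\<bar>" for n :: int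
  proof -
    have "0 \<le> (2 * a * \<bar>of_int n\<bar> - (b + 1))\<^sup>2 / (4 * a)" using a by simp
    also have "\<dots> = a * \<bar>of_int n\<bar>\<^sup>2 - (b + 1) * \<bar>of_int n\<bar> + C"
      using a by (simp add: C_def power2_eq_square field_simps)
    finally have "- a * (of_int n)\<^sup>2 + b * \<bar>of_int n\<bar> \<le> C - \<bar>real_of_int n\<bar>"
      by (simp add: algebra_simps)
    then have "exp (- a * (of_int n)\<^sup>2 + b * \<bar>of_int n\<bar>) \<le> exp (C + real (nat \<bar>n\<bar>) * (- 1))"
      by simp
    then show ?thesis unfolding exp_add exp_of_nat_mult .
  qed
  have sm: "(\<lambda>n::int. exp C * exp (- 1 :: real) ^ nat \<bar>n\<bar>) summable_on UNIV"
    by (intro summable_on_cmult_right summable_on_int_power) auto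
  show ?thesis
    by (rule summable_on_comparison_test[OF sm bound]) (rule exp_ge_zero)
qed

lemma summable_on_norm_bound:
  fixes f :: "'a \<Rightarrow> complex"
  assumes "M summable_on A" "\<And>n. n \<in> A \<Longrightarrow> norm (f n) \<le> M n"
  shows "f summable_on A"
  using Infinite_Sum.abs_summable_on_comparison_test'[of M A f] assms by (rule_tac abs_summable_summable) blast

text \<open>The majorant is asked for only near each point, which is all that a theta series offers
  as Im z tends to 0. The Weierstrass test makes the convergence uniform on a disc, and holomorphy
  passes to uniform limits.\<close>

lemma holomorphic_infsum:
  fixes f :: "'a \<Rightarrow> complex \<Rightarrow> complex"
  assumes U: "open U" and f: "\<And>n. n \<in> A \<Longrightarrow> f n holomorphic_on U"
    and bound: "\<And>z. z \<in> U \<Longrightarrow> \<exists>r>0. \<exists>M. cball z r \<subseteq> U \<and> M summable_on A \<and> (\<forall>n\<in>A. \<forall>w\<in>cball z r. norm (f n w) \<le> M n)"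
  shows "(\<lambda>z. \<Sum>\<^sub>\<infinity>n\<in>A. f n z) holomorphic_on U"
proof -
  have "(\<lambda>z. \<Sum>\<^sub>\<infinity>n\<in>A. f n z) field_differentiable (at z)" if "z \<in> U" for z
  proof -
    from bound[OF that] obtain r M where r: "r > 0" "cball z r \<subseteq> U" "M summable_on A"
      "\<And>n w. n \<in> A \<Longrightarrow> w \<in> cball z r \<Longrightarrow> norm (f n w) \<le> M n" by blast
    have ul: "uniform_limit (cball z r) (\<lambda>X w. \<Sum>n\<in>X. f n w) (\<lambda>w. \<Sum>\<^sub>\<infinity>n\<in>A. f n w) (finite_subsets_at_top A)"
      by (rule Weierstrass_m_test_general[OF _ r(3)]) (rule r(4))
    have ev: "\<forall>\<^sub>F X in finite_subsets_at_top A. continuous_on (cball z r) (\<lambda>w. \<Sum>n\<in>X. f n w) \<and> (\<lambda>w. \<Sum>n\<in>X. f n w) holomorphic_on ball z r"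
    proof (rule eventually_finite_subsets_at_top_weakI)
      fix X assume X: "finite X" "X \<subseteq> A"
      have "(\<lambda>w. \<Sum>n\<in>X. f n w) holomorphic_on cball z r"
        using X by (intro holomorphic_on_sum holomorphic_on_subset[OF f r(2)]) auto
      then show "continuous_on (cball z r) (\<lambda>w. \<Sum>n\<in>X. f n w) \<and> (\<lambda>w. \<Sum>n\<in>X. f n w) holomorphic_on ball z r"
        using holomorphic_on_imp_continuous_on holomorphic_on_subset[OF _ ball_subset_cball] by auto
    qed
    have "(\<lambda>z. \<Sum>\<^sub>\<infinity>n\<in>A. f n z) holomorphic_on ball z r"
      by (rule holomorphic_uniform_limit[OF ev ul finite_subsets_at_top_neq_bot])
    then show ?thesis
      by (rule holomorphic_on_imp_differentiable_at) (use r(1) in auto)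
  qed
  then show ?thesis
    unfolding holomorphic_on_def by (blast intro: field_differentiable_at_within)
qed

lemma has_sum_integral:
  fixes h :: "'a \<Rightarrow> real \<Rightarrow> complex"
  assumes cont: "\<And>k. continuous_on {a..b} (h k)" and M: "M summable_on A"
    and bound: "\<And>k x. k \<in> A \<Longrightarrow> x \<in> {a..b} \<Longrightarrow> norm (h k x) \<le> M k"
  shows "((\<lambda>k. integral {a..b} (h k)) has_sum integral {a..b} (\<lambda>x. \<Sum>\<^sub>\<infinity>k\<in>A. h k x)) A"
proof -
  have ul: "uniform_limit {a..b} (\<lambda>X x. \<Sum>k\<in>X. h k x) (\<lambda>x. \<Sum>\<^sub>\<infinity>k\<in>A. h k x) (finite_subsets_at_top A)"
    by (rule Weierstrass_m_test_general[OF _ M]) (rule bound)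
  obtain I J where I: "\<And>X. ((\<lambda>x. \<Sum>k\<in>X. h k x) has_integral I X) {a..b}"
    and J: "((\<lambda>x. \<Sum>\<^sub>\<infinity>k\<in>A. h k x) has_integral J) {a..b}" "(I \<longlongrightarrow> J) (finite_subsets_at_top A)"
    by (rule uniform_limit_integral[OF ul _ finite_subsets_at_top_neq_bot])
       (auto intro!: continuous_intros cont)
  have "I X = (\<Sum>k\<in>X. integral {a..b} (h k))" if "finite X" for X
  proof -
    have "integral {a..b} (\<lambda>x. \<Sum>k\<in>X. h k x) = (\<Sum>k\<in>X. integral {a..b} (h k))"
      using that by (intro integral_sum integrable_continuous_real cont)
    then show ?thesis using I[of X] by (simp add: integral_unique)
  qed
  then have ev: "\<forall>\<^sub>F X in finite_subsets_at_top A. I X = (\<Sum>k\<in>X. integral {a..b} (h k))"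
    by (intro eventually_finite_subsets_at_top_weakI) auto
  have "((\<lambda>X. \<Sum>k\<in>X. integral {a..b} (h k)) \<longlongrightarrow> J) (finite_subsets_at_top A)"
    by (rule Lim_transform_eventually[OF J(2) ev])
  then show ?thesis
    unfolding has_sum_def integral_unique[OF J(1)] .
qed

text \<open>Integrability on the whole line gives countable additivity over unit intervals, and the
  assumed sum identifies the value.\<close>

lemma has_sum_tiling_integral:
  fixes f :: "real \<Rightarrow> complex"
  assumes int: "integrable lborel f" and cont: "continuous_on UNIV f"
    and sum: "((\<lambda>k::int. integral {-1/2..1/2} (\<lambda>x. f (x + of_int k))) has_sum S) UNIV"
  shows "(LINT x|lborel. f x) = S"
proof -
  \<comment> \<open>Half-open intervals are disjoint and differ from the closed ones by a null set;
    \<open>int_decode\<close> turns the integer index into the natural number that countable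
    additivity runs over.\<close>
  define A where "A i = {of_int (int_decode i) - 1/2 <.. of_int (int_decode i) + (1/2 :: real)}" for i
  have un: "(\<Union>i. A i) = UNIV"
  proof (rule UNIV_eq_I[symmetric])
    fix x :: real
    have "x \<in> A (int_encode \<lceil>x - 1/2\<rceil>)"
      unfolding A_def int_encode_inverse by (simp, linarith)
    then show "x \<in> (\<Union>i. A i)" by blast
  qed
  have "A i \<inter> A j = {}" if "i \<noteq> j" for i j
  proof (rule ccontr)
    assume "A i \<inter> A j \<noteq> {}"
    then obtain x where "x \<in> A i" "x \<in> A j" by blast
    then have "\<bar>real_of_int (int_decode i) - of_int (int_decode j)\<bar> < 1"
      unfolding A_def by (auto simp: abs_less_iff)
    then have "int_decode i = int_decode j" by linarith
    then have "i = j" by (metis int_decode_inverse)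
    with that show False by simp
  qed
  then have "(LINT x:(\<Union>i. A i)|lborel. f x) = (\<Sum>i. LINT x:A i|lborel. f x)"
    by (intro lebesgue_integral_countable_add) (simp_all add: un set_integrable_def int, simp add: A_def)
  moreover have "(LINT x:A i|lborel. f x) = integral {-1/2..1/2} (\<lambda>x. f (x + of_int (int_decode i)))" for i
  proof -
    let ?k = "of_int (int_decode i) :: real"
    have si: "set_integrable lborel {?k - 1/2..?k + 1/2} f"
      using integrable_mult_indicator[OF _ int] by (auto simp: set_integrable_def)
    have "(LINT x:A i|lborel. f x) = (LINT x:{?k - 1/2..?k + 1/2}|lborel. f x)"
      unfolding set_lebesgue_integral_def
    proof (rule integral_cong_AE)
      show "AE x in lborel. indicat_real (A i) x *\<^sub>R f x = indicat_real {?k - 1/2..?k + 1/2} x *\<^sub>R f x"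
        using AE_lborel_singleton[of "?k - 1/2"] by eventually_elim (auto simp: A_def indicator_def)
    qed (use int in \<open>auto simp: A_def\<close>)
    also have "\<dots> = integral {?k - 1/2..?k + 1/2} f"
      using set_borel_integral_eq_integral(2)[OF si] .
    also have "\<dots> = integral {-1/2..1/2} (\<lambda>x. f (x + ?k))"
      using integral_shift[of "-1/2" "?k" "1/2" f] cont
      by (simp add: continuous_on_subset o_def add.commute)
    finally show ?thesis .
  qed
  moreover have "((\<lambda>i. integral {-1/2..1/2} (\<lambda>x. f (x + of_int (int_decode i)))) has_sum S) UNIV"
    using sum has_sum_reindex_bij_betw[OF bij_int_decode, of "\<lambda>k. integral {-1/2..1/2} (\<lambda>x. f (x + of_int k))" S] by simp
  then have "(\<Sum>i. integral {-1/2..1/2} (\<lambda>x. f (x + of_int (int_decode i)))) = S"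
    by (intro sums_unique[symmetric] has_sum_imp_sums)
  ultimately show ?thesis
    by (simp add: un set_lebesgue_integral_def)
qed

text \<open>The characteristic function of the normal distribution in disguise: u = c (x + s) with
  c^2 = 2 pi t turns the Gaussian into exp (-u^2/2) and the character, up to the constant phase e(-m
  x), into exp (i v u).\<close>

lemma fourier_gaussian:
  fixes t x :: real and m :: int
  assumes t: "t > 0"
  defines "f \<equiv> (\<lambda>s. of_real (exp (- pi * t * (x + s)\<^sup>2)) * ee (- of_int m * s))"
  shows "integrable lborel f"
    and "(LINT s|lborel. f s) = ee (of_int m * x) * of_real (exp (- pi * (of_int m)\<^sup>2 / t) / sqrt t)"
proof -
  define c where "c = sqrt (2 * pi * t)"
  define v where "v = - 2 * pi * of_int m / c"
  have c: "c > 0" and c2: "c\<^sup>2 = 2 * pi * t" using t by (auto simp: c_def)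
  define g where "g u = std_normal_density u *\<^sub>R iexp (v * u)" for u
  interpret real_distribution std_normal_distribution by (rule real_dist_normal_dist)
  have "integrable std_normal_distribution (\<lambda>u. iexp (v * u))"
    by (rule integrable_iexp) auto
  then have ig: "integrable lborel g"
    unfolding g_def using integrable_density[of "\<lambda>u. iexp (v * u)" lborel std_normal_density]
    by (simp add: normal_density_nonneg)
  have "(LINT u|lborel. g u) = char std_normal_distribution v"
    unfolding char_def g_def using integral_density[of "\<lambda>u. iexp (v * u)" lborel std_normal_density]
    by (simp add: normal_density_nonneg)
  then have intg: "(LINT u|lborel. g u) = of_real (exp (- v\<^sup>2 / 2))"
    by (simp add: char_std_normal_distribution)
  have gf: "g (c * x + c * s) = (ee (- of_int m * x) / of_real (sqrt (2 * pi))) * f s" for s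
  proof -
    have "std_normal_density (c * x + c * s) = exp (- pi * t * (x + s)\<^sup>2) / sqrt (2 * pi)"
    proof -
      have "(c * x + c * s)\<^sup>2 = c\<^sup>2 * (x + s)\<^sup>2"
        by (simp only: power_mult_distrib distrib_left[symmetric])
      then have "- (c * x + c * s)\<^sup>2 / 2 = - pi * t * (x + s)\<^sup>2" unfolding c2 by simp
      then show ?thesis unfolding std_normal_density_def by (simp only: times_divide_eq_left mult_1)
    qed
    moreover have "iexp (v * (c * x + c * s)) = ee (- of_int m * x) * ee (- of_int m * s)"
    proof -
      have "v * (c * x + c * s) = 2 * pi * (- of_int m * x + - of_int m * s)"
        using c by (simp add: v_def field_simps)
      then have "iexp (v * (c * x + c * s)) = ee (- of_int m * x + - of_int m * s)"
        by (simp only: ee_def cis_conv_exp)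
      then show ?thesis by (simp only: ee_add)
    qed
    ultimately show ?thesis by (simp only: g_def f_def scaleR_conv_of_real of_real_divide times_divide_eq_left times_divide_eq_right mult_ac)
  qed
  define K where "K = ee (- of_int m * x) / complex_of_real (sqrt (2 * pi))"
  have K: "K \<noteq> 0" by (simp add: K_def)
  have gK: "(\<lambda>s. g (c * x + c * s)) = (\<lambda>s. K * f s)" by (rule ext) (simp only: gf K_def)
  have "integrable lborel (\<lambda>s. g (c * x + c * s))"
    by (rule lborel_integrable_real_affine[where f = g and t = "c * x" and c = c, OF ig]) (use c in simp)
  then have "integrable lborel (\<lambda>s. inverse K * (K * f s))"
    unfolding gK by (rule integrable_mult_right)
  moreover have "(\<lambda>s. inverse K * (K * f s)) = f" using K by (simp add: fun_eq_iff)
  ultimately show "integrable lborel f" by (simp only:)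
  have "(LINT u|lborel. g u) = \<bar>c\<bar> *\<^sub>R (LINT s|lborel. g (c * x + c * s))"
    by (rule lborel_integral_real_affine[where f = g and t = "c * x" and c = c]) (use c in simp)
  also have "\<dots> = of_real c * (K * (LINT s|lborel. f s))"
    unfolding gK using c by (simp add: scaleR_conv_of_real)
  finally have "(LINT u|lborel. g u) = of_real c * (K * (LINT s|lborel. f s))" .
  then have int: "(LINT s|lborel. f s) = of_real (exp (- v\<^sup>2 / 2)) / (of_real c * K)"
    using K c by (simp add: intg nonzero_eq_divide_eq mult_ac)
  have "v\<^sup>2 / 2 = pi * (of_int m)\<^sup>2 / t"
    unfolding v_def power_divide c2 using t by (simp add: power2_eq_square field_simps)
  then have v: "exp (- v\<^sup>2 / 2) = exp (- pi * (of_int m)\<^sup>2 / t)" by simp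
  have "of_real c * K = ee (- of_int m * x) * of_real (sqrt t)"
    by (simp add: K_def c_def real_sqrt_mult)
  then show "(LINT s|lborel. f s) = ee (of_int m * x) * of_real (exp (- pi * (of_int m)\<^sup>2 / t) / sqrt t)"
    unfolding int v by (simp add: ee_minus divide_inverse mult_ac)
qed

section \<open>Poisson summation for Gaussians\<close>

lemma has_sum_finite_sum:
  fixes f :: "'b \<Rightarrow> 'a \<Rightarrow> complex"
  assumes "finite F" "\<And>i. i \<in> F \<Longrightarrow> (f i has_sum s i) A"
  shows "((\<lambda>x. \<Sum>i\<in>F. f i x) has_sum (\<Sum>i\<in>F. s i)) A"
  using assms by (induction F) (auto intro!: has_sum_add)

lemma norm_exp_gaussian_le:
  fixes z :: complex
  assumes "t > 0" "norm z \<le> R"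
  shows "norm (exp (- of_real (pi * t) * (z + of_int k)\<^sup>2)) \<le>
    exp (pi * t * R\<^sup>2) * exp (- (pi * t) * (of_int k)\<^sup>2 + (2 * pi * t * R) * \<bar>of_int k\<bar>)"
proof -
  have R: "\<bar>Re z\<bar> \<le> R" "\<bar>Im z\<bar> \<le> R"
    using assms abs_Re_le_cmod[of z] abs_Im_le_cmod[of z] by linarith+
  have "Re ((z + of_int k)\<^sup>2) = (Re z)\<^sup>2 + 2 * (Re z * of_int k) + (of_int k)\<^sup>2 - (Im z)\<^sup>2"
    by (simp add: power2_eq_square algebra_simps)
  moreover have "- (Re z * of_int k) \<le> R * \<bar>of_int k\<bar>"
  proof -
    have "- (Re z * of_int k) \<le> \<bar>Re z\<bar> * \<bar>of_int k\<bar>" by (simp flip: abs_mult)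
    also have "\<dots> \<le> R * \<bar>of_int k\<bar>" by (intro mult_right_mono R) auto
    finally show ?thesis .
  qed
  moreover have "(Im z)\<^sup>2 \<le> R\<^sup>2" using R(2) by (simp add: abs_le_square_iff[symmetric])
  moreover have "(Re z)\<^sup>2 \<ge> 0" by simp
  ultimately have "- Re ((z + of_int k)\<^sup>2) \<le> R\<^sup>2 + (- (of_int k)\<^sup>2 + 2 * R * \<bar>of_int k\<bar>)" by linarith
  then have "pi * t * (- Re ((z + of_int k)\<^sup>2)) \<le> pi * t * (R\<^sup>2 + (- (of_int k)\<^sup>2 + 2 * R * \<bar>of_int k\<bar>))"
    using assms(1) by (intro mult_left_mono) auto
  then show ?thesis
    unfolding norm_exp_eq_Re exp_add[symmetric] exp_le_cancel_iff
    by (simp add: algebra_simps)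
qed

text \<open>As functions of x both sides extend to entire functions, and they have the same Fourier
  coefficients over the unit interval centred at x. Applying \<open>fourier_coeffs_0_imp_0\<close>
  to the recentred difference gives equality at that point; holomorphy supplies the continuity and
  the derivative it asks for.\<close>

lemma poisson_gaussian:
  fixes t x :: real
  assumes t: "t > 0"
  shows "(\<Sum>\<^sub>\<infinity>k::int. complex_of_real (exp (- pi * t * (x + of_int k)\<^sup>2))) =
    (\<Sum>\<^sub>\<infinity>m::int. of_real (exp (- pi * (of_int m)\<^sup>2 / t) / sqrt t) * ee (of_int m * x))"
proof -
  let ?I = "{-1/2..1/2::real}"
  define a where "a k z = exp (- of_real (pi * t) * (z + of_int k)\<^sup>2)" for k :: int and z :: complex
  define c where "c m = exp (- pi * (of_int m)\<^sup>2 / t) / sqrt t" for m :: int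
  define b where "b m z = complex_of_real (c m) * exp (2 * of_real pi * \<i> * of_int m * z)" for m :: int and z :: complex
  define Ma where "Ma R k = exp (pi * t * R\<^sup>2) * exp (- (pi * t) * (of_int k)\<^sup>2 + (2 * pi * t * R) * \<bar>of_int k\<bar>)" for R :: real and k :: int
  define Mb where "Mb R m = (1 / sqrt t) * exp (- (pi / t) * (of_int m)\<^sup>2 + (2 * pi * R) * \<bar>of_int m\<bar>)" for R :: real and m :: int
  have Ma: "Ma R summable_on UNIV" for R
    unfolding Ma_def using t by (intro summable_on_cmult_right summable_on_gaussian) auto
  have Mb: "Mb R summable_on UNIV" for R
    unfolding Mb_def using t by (intro summable_on_cmult_right summable_on_gaussian) auto
  have na: "norm (a k z) \<le> Ma R k" if "norm z \<le> R" for k z R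
    unfolding a_def Ma_def by (rule norm_exp_gaussian_le[OF t that])
  have nb: "norm (b m z) \<le> Mb R m" if "norm z \<le> R" for m z R
  proof -
    have "- (of_int m * Im z) \<le> R * \<bar>of_int m\<bar>"
    proof -
      have "- (of_int m * Im z) \<le> \<bar>Im z\<bar> * \<bar>of_int m\<bar>" by (simp add: mult.commute flip: abs_mult)
      also have "\<dots> \<le> R * \<bar>of_int m\<bar>"
        using that abs_Im_le_cmod[of z] by (intro mult_right_mono) auto
      finally show ?thesis .
    qed
    then have "2 * pi * (- (of_int m * Im z)) \<le> 2 * pi * (R * \<bar>of_int m\<bar>)" by (intro mult_left_mono) auto
    then have "exp (- (2 * pi * (of_int m * Im z))) \<le> exp (2 * pi * R * \<bar>of_int m\<bar>)" by (simp add: mult_ac)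
    moreover have "norm (b m z) = c m * exp (- (2 * pi * (of_int m * Im z)))"
    proof -
      have "norm (complex_of_real (c m)) = c m" using t unfolding norm_of_real by (simp add: c_def)
      then show ?thesis by (simp add: b_def norm_mult norm_exp_eq_Re mult_ac del: norm_of_real)
    qed
    moreover have "Mb R m = c m * exp (2 * pi * R * \<bar>of_int m\<bar>)"
      unfolding Mb_def c_def exp_add by simp
    moreover have "c m \<ge> 0" using t by (simp add: c_def)
    ultimately show ?thesis by (simp add: mult_left_mono)
  qed
  have cball: "norm w \<le> norm z + 1" if "w \<in> cball z 1" for w z :: complex
    using that norm_triangle_ineq2[of w z] by (simp add: dist_norm norm_minus_commute)
  define F where "F z = (\<Sum>\<^sub>\<infinity>k. a k z)" for z
  define P where "P z = (\<Sum>\<^sub>\<infinity>m. b m z)" for z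
  have holF: "F holomorphic_on UNIV" unfolding F_def
  proof (rule holomorphic_infsum)
    show "a n holomorphic_on UNIV" for n unfolding a_def by (intro holomorphic_intros)
    show "\<exists>r>0. \<exists>M. cball z r \<subseteq> UNIV \<and> M summable_on UNIV \<and> (\<forall>n\<in>UNIV. \<forall>w\<in>cball z r. norm (a n w) \<le> M n)" for z
      by (rule exI[of _ 1], intro conjI, simp, rule exI[of _ "Ma (norm z + 1)"]) (use Ma na cball in blast)
  qed auto
  have holP: "P holomorphic_on UNIV" unfolding P_def
  proof (rule holomorphic_infsum)
    show "b n holomorphic_on UNIV" for n unfolding b_def by (intro holomorphic_intros)
    show "\<exists>r>0. \<exists>M. cball z r \<subseteq> UNIV \<and> M summable_on UNIV \<and> (\<forall>n\<in>UNIV. \<forall>w\<in>cball z r. norm (b n w) \<le> M n)" for z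
      by (rule exI[of _ 1], intro conjI, simp, rule exI[of _ "Mb (norm z + 1)"]) (use Mb nb cball in blast)
  qed auto
  have contF: "continuous_on A (\<lambda>y. F (of_real (x + y)))" for A :: "real set"
    by (intro continuous_on_compose2[OF holomorphic_on_imp_continuous_on[OF holF]] continuous_intros) auto
  have contP: "continuous_on A (\<lambda>y. P (of_real (x + y)))" for A :: "real set"
    by (intro continuous_on_compose2[OF holomorphic_on_imp_continuous_on[OF holP]] continuous_intros) auto
  have ny: "norm (complex_of_real (x + y)) \<le> \<bar>x\<bar> + 1" if "y \<in> ?I" for y
    using that by (simp only: norm_of_real) (auto simp: abs_le_iff)
  \<comment> \<open>Unfolding: since e(-m y) has period 1, the integrals of the translates over one
    unit interval tile a single Gaussian integral over the line.\<close>
  have coeffF: "integral ?I (\<lambda>y. F (of_real (x + y)) * ee (- of_int m * y)) = ee (of_int m * x) * of_real (c m)" for m :: int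
  proof -
    define f where "f s = complex_of_real (exp (- pi * t * (x + s)\<^sup>2)) * ee (- of_int m * s)" for s
    have eq: "a k (of_real (x + y)) * ee (- of_int m * y) = f (y + of_int k)" for k y
    proof -
      have "ee (- of_int m * (y + of_int k)) = ee (- of_int m * y) * ee (of_int (- m * k))"
        by (simp add: algebra_simps flip: ee_add)
      moreover have "a k (of_real (x + y)) = of_real (exp (- pi * t * (x + (y + of_int k))\<^sup>2))"
        by (simp add: a_def add.assoc flip: exp_of_real)
      ultimately show ?thesis by (simp only: f_def ee_of_int mult_1_right)
    qed
    have fc: "continuous_on UNIV f" unfolding f_def by (intro continuous_intros)
    have "((\<lambda>k. integral ?I (\<lambda>y. a k (of_real (x + y)) * ee (- of_int m * y))) has_sum
      integral ?I (\<lambda>y. \<Sum>\<^sub>\<infinity>k. a k (of_real (x + y)) * ee (- of_int m * y))) UNIV"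
    proof (rule has_sum_integral)
      show "continuous_on ?I (\<lambda>y. a k (of_real (x + y)) * ee (- of_int m * y))" for k
        unfolding a_def by (intro continuous_intros)
      show "Ma (\<bar>x\<bar> + 1) summable_on UNIV" by (rule Ma)
      show "norm (a k (of_real (x + y)) * ee (- of_int m * y)) \<le> Ma (\<bar>x\<bar> + 1) k" if "y \<in> ?I" for k y
        using na[OF ny[OF that]] by (simp add: norm_mult)
    qed
    then have "((\<lambda>k. integral ?I (\<lambda>y. a k (of_real (x + y)) * ee (- of_int m * y))) has_sum
      integral ?I (\<lambda>y. F (of_real (x + y)) * ee (- of_int m * y))) UNIV"
      unfolding F_def infsum_cmult_left' .
    then have "((\<lambda>k. integral ?I (\<lambda>y. f (y + of_int k))) has_sum
      integral ?I (\<lambda>y. F (of_real (x + y)) * ee (- of_int m * y))) UNIV"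
      unfolding eq .
    from has_sum_tiling_integral[OF _ fc this] fourier_gaussian[OF t, where x = x and m = m]
    show ?thesis unfolding f_def c_def by metis
  qed
  have coeffP: "integral ?I (\<lambda>y. P (of_real (x + y)) * ee (- of_int m * y)) = ee (of_int m * x) * of_real (c m)" for m :: int
  proof -
    have eq: "b k (of_real (x + y)) * ee (- of_int m * y) = of_real (c k) * ee (of_int k * x) * ee (of_int (k - m) * y)" for k y
    proof -
      have "of_int k * (x + y) + - of_int m * y = of_int k * x + of_int (k - m) * y" by (simp add: algebra_simps)
      then have "ee (of_int k * (x + y)) * ee (- of_int m * y) = ee (of_int k * x) * ee (of_int (k - m) * y)"
        unfolding ee_add[symmetric] by (simp only:)
      moreover have "exp (2 * of_real pi * \<i> * of_int k * of_real (x + y)) = ee (of_int k * (x + y))"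
        by (simp add: ee_eq_exp mult.assoc)
      ultimately show ?thesis unfolding b_def by (simp only: mult.assoc)
    qed
    have int: "integral ?I (\<lambda>y. b k (of_real (x + y)) * ee (- of_int m * y)) = (if k = m then of_real (c k) * ee (of_int k * x) else 0)" for k
      unfolding eq integral_mult_right integral_ee by auto
    have "((\<lambda>k. integral ?I (\<lambda>y. b k (of_real (x + y)) * ee (- of_int m * y))) has_sum
      integral ?I (\<lambda>y. \<Sum>\<^sub>\<infinity>k. b k (of_real (x + y)) * ee (- of_int m * y))) UNIV"
    proof (rule has_sum_integral)
      show "continuous_on ?I (\<lambda>y. b k (of_real (x + y)) * ee (- of_int m * y))" for k
        unfolding b_def by (intro continuous_intros)
      show "Mb (\<bar>x\<bar> + 1) summable_on UNIV" by (rule Mb)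
      show "norm (b k (of_real (x + y)) * ee (- of_int m * y)) \<le> Mb (\<bar>x\<bar> + 1) k" if "y \<in> ?I" for k y
        using nb[OF ny[OF that]] by (simp add: norm_mult)
    qed
    then have "((\<lambda>k. integral ?I (\<lambda>y. b k (of_real (x + y)) * ee (- of_int m * y))) has_sum
      integral ?I (\<lambda>y. P (of_real (x + y)) * ee (- of_int m * y))) UNIV"
      unfolding P_def infsum_cmult_left' .
    then have 1: "((\<lambda>k. if k = m then of_real (c k) * ee (of_int k * x) else 0) has_sum
      integral ?I (\<lambda>y. P (of_real (x + y)) * ee (- of_int m * y))) UNIV"
      unfolding int .
    have "((\<lambda>k. if k = m then of_real (c k) * ee (of_int k * x) else 0) has_sum of_real (c m) * ee (of_int m * x)) UNIV"
      by (rule has_sum_finite_neutralI[of "{m}"]) auto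
    from has_sum_unique[OF 1 this] show ?thesis by (simp only: mult.commute)
  qed
  define D where "D y = F (of_real (x + y)) - P (of_real (x + y))" for y
  have "D 0 = 0"
  proof (rule fourier_coeffs_0_imp_0)
    show "continuous_on ?I D" unfolding D_def by (intro continuous_intros contF contP)
    define H where "H z = F (of_real x + z) - P (of_real x + z)" for z
    have holH: "H holomorphic_on UNIV"
      unfolding H_def
      by (intro holomorphic_intros holomorphic_on_compose_gen[OF _ holF, unfolded o_def] holomorphic_on_compose_gen[OF _ holP, unfolded o_def]) auto
    have "(H has_field_derivative deriv H 0) (at 0)"
      by (rule holomorphic_derivI[OF holH]) auto
    from tendsto_real_difference_quotient[OF this]
    show "((\<lambda>y. (D y - D 0) / of_real y) \<longlongrightarrow> deriv H 0) (at 0)"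
      by (simp add: D_def H_def)
    show "integral ?I (\<lambda>y. D y * ee (- of_int m * y)) = 0" for m :: int
    proof -
      have "integral ?I (\<lambda>y. D y * ee (- of_int m * y)) =
        integral ?I (\<lambda>y. F (of_real (x + y)) * ee (- of_int m * y)) - integral ?I (\<lambda>y. P (of_real (x + y)) * ee (- of_int m * y))"
        unfolding D_def left_diff_distrib
        by (intro integral_diff integrable_continuous_real continuous_intros contF contP)
      then show ?thesis by (simp only: coeffF coeffP diff_self)
    qed
  qed
  then have "F (of_real x) = P (of_real x)" by (simp add: D_def)
  moreover have "F (of_real x) = (\<Sum>\<^sub>\<infinity>k::int. complex_of_real (exp (- pi * t * (x + of_int k)\<^sup>2)))"
    unfolding F_def a_def by (intro infsum_cong) (simp flip: exp_of_real)
  moreover have "P (of_real x) = (\<Sum>\<^sub>\<infinity>m::int. of_real (c m) * ee (of_int m * x))"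
    unfolding P_def b_def by (intro infsum_cong) (simp add: ee_eq_exp mult.assoc)
  ultimately show ?thesis by (simp only: c_def)
qed

lemma summable_gaussian_bounded:
  fixes a :: "int \<Rightarrow> complex"
  assumes t: "t > 0" and B: "\<And>n. norm (a n) \<le> B"
  shows "(\<lambda>n. a n * of_real (exp (- pi * t * (of_int n)\<^sup>2))) summable_on UNIV"
proof (rule summable_on_norm_bound)
  show "(\<lambda>n::int. B * exp (- (pi * t) * (of_int n)\<^sup>2 + 0 * \<bar>of_int n\<bar>)) summable_on UNIV"
    using t by (intro summable_on_cmult_right summable_on_gaussian) auto
  show "norm (a n * of_real (exp (- pi * t * (of_int n)\<^sup>2))) \<le> B * exp (- (pi * t) * (of_int n)\<^sup>2 + 0 * \<bar>of_int n\<bar>)" for n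
    using mult_right_mono[OF B, of "exp (- (pi * t) * (of_int n)\<^sup>2)"] by (simp add: norm_mult)
qed

text \<open>The class of r modulo N is N (Z + r/N), so Poisson summation applies to it with T = N^2
  t and x = r/N. Summing over r with weights a(r) collects the phases e(r m/N) into the discrete
  Fourier transform of a.\<close>

lemma poisson_gaussian_periodic:
  fixes a :: "int \<Rightarrow> complex"
  assumes N: "N > 0" and per: "\<And>x y. [x = y] (mod N) \<Longrightarrow> a x = a y" and t: "t > 0"
  shows "(\<Sum>\<^sub>\<infinity>n. a n * of_real (exp (- pi * t * (of_int n)\<^sup>2))) =
    of_real (1 / (of_int N * sqrt t)) *
    (\<Sum>\<^sub>\<infinity>m. (\<Sum>r\<in>{0..<N}. a r * ee (of_int (r * m) / of_int N)) * of_real (exp (- pi * (of_int m)\<^sup>2 / ((of_int N)\<^sup>2 * t))))"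
proof -
  define T where "T = (of_int N)\<^sup>2 * t"
  have T: "T > 0" using N t by (simp add: T_def)
  have sqT: "sqrt T = of_int N * sqrt t" using N by (simp add: T_def real_sqrt_mult)
  define g where "g n = complex_of_real (exp (- pi * t * (of_int n)\<^sup>2))" for n :: int
  define e where "e m = complex_of_real (exp (- pi * (of_int m)\<^sup>2 / T))" for m :: int
  have se: "(\<lambda>m. c m * e m) summable_on UNIV" if "\<And>m. norm (c m) \<le> B" for c :: "int \<Rightarrow> complex" and B
    using summable_gaussian_bounded[of "1 / T" c B] T that by (simp add: e_def)
  define S where "S r = (\<Sum>\<^sub>\<infinity>m. ee (of_int (r * m) / of_int N) * e m)" for r :: int
  have S: "((\<lambda>m. ee (of_int (r * m) / of_int N) * e m) has_sum S r) UNIV" for r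
    unfolding S_def by (intro has_sum_infsum se[of _ 1]) simp
  have res: "((\<lambda>n. if n mod N = r then g n else 0) has_sum (of_real (1 / sqrt T) * S r)) UNIV" if r: "r \<in> {0..<N}" for r
  proof -
    have gk: "g (r + N * k) = of_real (exp (- pi * T * (of_int r / of_int N + of_int k)\<^sup>2))" for k
    proof -
      have "T * (of_int r / of_int N + of_int k)\<^sup>2 = t * (of_int N * (of_int r / of_int N + of_int k))\<^sup>2"
        by (simp add: T_def power_mult_distrib)
      also have "of_int N * (of_int r / of_int N + of_int k) = (of_int (r + N * k) :: real)"
        using N by (simp add: distrib_left)
      finally show ?thesis by (simp add: g_def mult.assoc)
    qed
    have "g summable_on UNIV"
      using summable_gaussian_bounded[OF t, of "\<lambda>_. 1" 1] by (simp add: g_def[abs_def])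
    then have "g summable_on range (\<lambda>k. r + N * k)" by (rule summable_on_subset_banach) simp
    moreover have inj: "inj (\<lambda>k. r + N * k)" using N by (auto simp: inj_def)
    ultimately have "(\<lambda>k. g (r + N * k)) summable_on UNIV" by (simp add: summable_on_reindex o_def)
    then have "((\<lambda>k. g (r + N * k)) has_sum (\<Sum>\<^sub>\<infinity>k. g (r + N * k))) UNIV" by simp
    moreover have "(\<Sum>\<^sub>\<infinity>k. g (r + N * k)) = (\<Sum>\<^sub>\<infinity>m::int. of_real (exp (- pi * (of_int m)\<^sup>2 / T) / sqrt T) * ee (of_int m * (of_int r / of_int N)))"
      unfolding gk by (rule poisson_gaussian[OF T])
    moreover have "\<dots> = (\<Sum>\<^sub>\<infinity>m. of_real (1 / sqrt T) * (ee (of_int (r * m) / of_int N) * e m))"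
      by (intro infsum_cong) (simp add: e_def mult_ac)
    moreover have "\<dots> = of_real (1 / sqrt T) * S r" by (simp only: infsum_cmult_right' S_def)
    ultimately have "(g has_sum (of_real (1 / sqrt T) * S r)) (range (\<lambda>k. r + N * k))"
      using inj by (simp add: has_sum_reindex o_def)
    moreover have "range (\<lambda>k. r + N * k) = {n. n mod N = r}"
    proof (intro Set.set_eqI iffI)
      fix n assume "n \<in> {n. n mod N = r}"
      then have "n = r + N * (n div N)" by (metis (mono_tags) mem_Collect_eq mod_mult_div_eq)
      then show "n \<in> range (\<lambda>k. r + N * k)" by blast
    qed (use r in auto)
    ultimately have "(g has_sum (of_real (1 / sqrt T) * S r)) {n. n mod N = r}" by simp
    also have "?this \<longleftrightarrow> ?thesis" by (rule has_sum_cong_neutral) auto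
    finally show ?thesis .
  qed
  have "((\<lambda>n. \<Sum>r\<in>{0..<N}. a r * (if n mod N = r then g n else 0)) has_sum (\<Sum>r\<in>{0..<N}. a r * (of_real (1 / sqrt T) * S r))) UNIV"
    by (intro has_sum_finite_sum has_sum_cmult_right res) auto
  moreover have "(\<Sum>r\<in>{0..<N}. a r * (if n mod N = r then g n else 0)) = a n * g n" for n
  proof -
    have "(\<Sum>r\<in>{0..<N}. a r * (if n mod N = r then g n else 0)) = (\<Sum>r\<in>{0..<N}. if n mod N = r then a r * g n else 0)"
      by (intro sum.cong) auto
    also have "\<dots> = a (n mod N) * g n" using N by simp
    also have "a (n mod N) = a n" by (rule per) simp
    finally show ?thesis .
  qed
  ultimately have 1: "((\<lambda>n. a n * g n) has_sum (of_real (1 / sqrt T) * (\<Sum>r\<in>{0..<N}. a r * S r))) UNIV"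
    by (simp add: sum_distrib_left mult_ac)
  have "((\<lambda>m. \<Sum>r\<in>{0..<N}. a r * (ee (of_int (r * m) / of_int N) * e m)) has_sum (\<Sum>r\<in>{0..<N}. a r * S r)) UNIV"
    by (intro has_sum_finite_sum has_sum_cmult_right S) auto
  then have 2: "((\<lambda>m. (\<Sum>r\<in>{0..<N}. a r * ee (of_int (r * m) / of_int N)) * e m) has_sum (\<Sum>r\<in>{0..<N}. a r * S r)) UNIV"
    by (simp add: sum_distrib_right mult.assoc)
  show ?thesis
    using infsumI[OF 1] infsumI[OF 2] unfolding g_def e_def T_def[symmetric] sqT by simp
qed

section \<open>Quadratic characters and Gauss sums\<close>

lemma sum_affine_periodic:
  fixes f :: "int \<Rightarrow> 'a::comm_monoid_add"
  assumes c: "c > 0" and per: "\<And>x y. [x = y] (mod c) \<Longrightarrow> f x = f y" and cop: "coprime p c"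
  shows "(\<Sum>k\<in>{0..<c}. f (p * k + s)) = (\<Sum>k\<in>{0..<c}. f k)"
proof -
  have "inj_on (\<lambda>k. (p * k + s) mod c) {0..<c}"
  proof (rule inj_onI)
    fix x y assume xy: "x \<in> {0..<c}" "y \<in> {0..<c}" "(p * x + s) mod c = (p * y + s) mod c"
    then have "[p * x = p * y] (mod c)" by (simp add: cong_def[symmetric] cong_add_rcancel)
    then have "[x = y] (mod c)" using cop by (simp add: cong_mult_lcancel)
    with xy show "x = y" by (auto simp: cong_def)
  qed
  moreover have "(\<lambda>k. (p * k + s) mod c) ` {0..<c} \<subseteq> {0..<c}" using c by auto
  ultimately have bij: "bij_betw (\<lambda>k. (p * k + s) mod c) {0..<c} {0..<c}"
    by (simp add: bij_betw_def endo_inj_surj)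
  have "(\<Sum>k\<in>{0..<c}. f (p * k + s)) = (\<Sum>k\<in>{0..<c}. f ((p * k + s) mod c))"
    by (intro sum.cong refl per) simp
  also have "\<dots> = (\<Sum>k\<in>{0..<c}. f k)" by (rule sum.reindex_bij_betw[OF bij])
  finally show ?thesis .
qed

lemma sum_crt_periodic:
  fixes f :: "int \<Rightarrow> 'a::comm_monoid_add"
  assumes pq: "p > 0" "q > 0" "coprime p q" and per: "\<And>x y. [x = y] (mod p * q) \<Longrightarrow> f x = f y"
  shows "(\<Sum>r\<in>{0..<p * q}. f r) = (\<Sum>x\<in>{0..<p}. \<Sum>k\<in>{0..<q}. f (q * x + p * k))"
proof -
  let ?h = "\<lambda>(x, k). (q * x + p * k) mod (p * q)"
  have inj: "inj_on ?h ({0..<p} \<times> {0..<q})"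
  proof (rule inj_onI, clarsimp)
    fix x k y j assume b: "0 \<le> x" "x < p" "0 \<le> k" "k < q" "0 \<le> y" "y < p" "0 \<le> j" "j < q"
      and "(q * x + p * k) mod (p * q) = (q * y + p * j) mod (p * q)"
    then have *: "[q * x + p * k = q * y + p * j] (mod p * q)" by (simp add: cong_def)
    have "[q * x = q * y] (mod p)"
      using cong_modulus_mult[OF *] by (simp add: cong_def)
    then have "[x = y] (mod p)" using pq by (simp add: cong_mult_lcancel coprime_commute)
    moreover have "[p * k = p * j] (mod q)"
      using cong_modulus_mult[of "q * x + p * k" _ q p] * by (simp add: cong_def mult.commute)
    then have "[k = j] (mod q)" using pq by (simp add: cong_mult_lcancel)
    ultimately show "x = y \<and> k = j" using b by (auto simp: cong_def)
  qed
  have "?h ` ({0..<p} \<times> {0..<q}) = {0..<p * q}"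
  proof (rule card_subset_eq)
    show "card (?h ` ({0..<p} \<times> {0..<q})) = card {0..<p * q}"
      using pq by (simp add: card_image[OF inj] card_cartesian_product nat_mult_distrib)
  qed (use pq in auto)
  with inj have bij: "bij_betw ?h ({0..<p} \<times> {0..<q}) {0..<p * q}" by (simp add: bij_betw_def)
  have "(\<Sum>r\<in>{0..<p * q}. f r) = (\<Sum>z\<in>{0..<p} \<times> {0..<q}. f (?h z))"
    by (rule sum.reindex_bij_betw[OF bij, symmetric])
  also have "\<dots> = (\<Sum>z\<in>{0..<p} \<times> {0..<q}. f (q * fst z + p * snd z))"
    by (intro sum.cong refl per) (auto simp: cong_def)
  finally show ?thesis by (simp add: sum.cartesian_product case_prod_unfold)
qed

lemma sum_digits:
  fixes f :: "int \<Rightarrow> 'a::comm_monoid_add"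
  assumes pq: "p > 0" "q > 0"
  shows "(\<Sum>r\<in>{0..<p * q}. f r) = (\<Sum>x\<in>{0..<p}. \<Sum>k\<in>{0..<q}. f (x + p * k))"
proof -
  have "bij_betw (\<lambda>(x, k). x + p * k) ({0..<p} \<times> {0..<q}) {0..<p * q}"
  proof (rule bij_betw_byWitness[where f' = "\<lambda>r. (r mod p, r div p)"])
    have "x + p * k \<in> {0..<p * q}" if b: "0 \<le> x" "x < p" "0 \<le> k" "k < q" for x k
    proof -
      have "x + p * k < p * (k + 1)" using b by (simp add: algebra_simps)
      also have "\<dots> \<le> p * q" using b pq by (intro mult_left_mono) auto
      finally show ?thesis using b pq by simp
    qed
    then show "(\<lambda>(x, k). x + p * k) ` ({0..<p} \<times> {0..<q}) \<subseteq> {0..<p * q}" by force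
    have "r div p < q" if "r < p * q" for r
    proof -
      have "p * (r div p) \<le> r" using mult_div_mod_eq[of p r] pos_mod_sign[OF pq(1), of r] by linarith
      with that have "p * (r div p) < p * q" by linarith
      then show ?thesis using pq(1) by simp
    qed
    then show "(\<lambda>r. (r mod p, r div p)) ` {0..<p * q} \<subseteq> {0..<p} \<times> {0..<q}"
      using pq by (auto simp: pos_imp_zdiv_nonneg_iff)
  qed (use pq in auto)
  from sum.reindex_bij_betw[OF this, of f] show ?thesis
    by (simp add: sum.cartesian_product case_prod_unfold)
qed

text \<open>Replacing k by k + 1 permutes the residues and multiplies the sum by e(a/c), which
  differs from 1 unless c divides a.\<close>

lemma sum_ee_residues:
  assumes c: "c > 0"
  shows "(\<Sum>k\<in>{0..<c}. ee (of_int (a * k) / of_int c)) = (if c dvd a then of_int c else 0)"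
proof (cases "c dvd a")
  case True
  then obtain d where "a = c * d" by blast
  then have "ee (of_int (a * k) / of_int c) = 1" for k
    using ee_of_int[of "d * k"] c by (simp add: field_simps)
  then show ?thesis using True c by simp
next
  case False
  let ?S = "\<Sum>k\<in>{0..<c}. ee (of_int (a * k) / of_int c)"
  have per: "ee (of_int (a * x) / of_int c) = ee (of_int (a * y) / of_int c)" if "[x = y] (mod c)" for x y
    by (intro ee_cong_int cong_scalar_left that)
  have "?S = (\<Sum>k\<in>{0..<c}. ee (of_int (a * (1 * k + 1)) / of_int c))"
    by (rule sum_affine_periodic[symmetric, where f = "\<lambda>k. ee (of_int (a * k) / of_int c)", OF c per]) auto
  also have "\<dots> = (\<Sum>k\<in>{0..<c}. ee (of_int a / of_int c) * ee (of_int (a * k) / of_int c))"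
    by (intro sum.cong refl) (simp add: distrib_left add_divide_distrib ee_add)
  also have "\<dots> = ee (of_int a / of_int c) * ?S" by (simp add: sum_distrib_left)
  finally have "ee (of_int a / of_int c) = 1 \<or> ?S = 0" by (metis mult_cancel_right1)
  moreover have "ee (of_int a / of_int c) \<noteq> 1"
  proof
    assume "ee (of_int a / of_int c) = 1"
    then obtain k where "real_of_int a / of_int c = of_int k" unfolding ee_eq_1_iff by (auto elim: Ints_cases)
    then have "real_of_int a = of_int (k * c)" using c by (simp add: field_simps)
    then have "a = k * c" by (simp only: of_int_eq_iff)
    with False show False by simp
  qed
  ultimately show ?thesis using False by simp
qed

section \<open>The quadratic character n -> (12/n)\<close>

definition chi12 :: "int \<Rightarrow> int" where
  "chi12 n = (if n mod 12 \<in> {1, 11} then 1 else if n mod 12 \<in> {5, 7} then -1 else 0)"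

lemma chi12_cong: "[x = y] (mod 12) \<Longrightarrow> chi12 x = chi12 y"
  by (simp add: chi12_def cong_def)

lemma residues_12: "{0..<12::int} = {0, 1, 2, 3, 4, 5, 6, 7, 8, 9, 10, 11}"
  by (rule Set.set_eqI) (simp, presburger)

lemma chi12_mult: "chi12 (a * b) = chi12 a * chi12 b"
proof -
  have "chi12 (r * s) = chi12 r * chi12 s" if "r \<in> {0..<12}" "s \<in> {0..<12}" for r s
    using that unfolding residues_12 by (elim insertE emptyE) (simp_all add: chi12_def)
  from this[of "a mod 12" "b mod 12"] have "chi12 ((a mod 12) * (b mod 12)) = chi12 (a mod 12) * chi12 (b mod 12)" by simp
  moreover have "chi12 ((a mod 12) * (b mod 12)) = chi12 (a * b)" by (rule chi12_cong) (simp add: cong_def mod_mult_eq)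
  moreover have "chi12 (a mod 12) = chi12 a" "chi12 (b mod 12) = chi12 b" by (rule chi12_cong, simp)+
  ultimately show ?thesis by simp
qed

text \<open>Nonvanishing means that n is prime to 12, and every unit modulo 24 is its own inverse.
  This places the exponents n^2/24 of the theta series in 1/24 + Z.\<close>

lemma chi12_square:
  assumes "chi12 n \<noteq> 0" shows "[n\<^sup>2 = 1] (mod 24)"
proof -
  define k r where "k = n div 12" and "r = n mod 12"
  have "n = 12 * k + r" by (simp add: k_def r_def)
  then have eq: "n\<^sup>2 = r\<^sup>2 + 24 * (6 * k\<^sup>2 + k * r)" by (simp add: power2_eq_square algebra_simps)
  have "n\<^sup>2 mod 24 = r\<^sup>2 mod 24" unfolding eq by (rule mod_mult_self2)
  also have "r = 1 \<or> r = 5 \<or> r = 7 \<or> r = 11" using assms by (auto simp: chi12_def r_def split: if_splits)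
  then have "r\<^sup>2 mod 24 = 1" by auto
  finally show ?thesis by (simp add: cong_def)
qed

text \<open>Explicit roots of unity for the finite check in \<open>chi12_fourier\<close>.\<close>

lemma ee_twelfths:
  "ee (1/12) = Complex (sqrt 3 / 2) (1/2)" "ee (2/12) = Complex (1/2) (sqrt 3 / 2)"
  "ee (3/12) = Complex 0 1" "ee (4/12) = Complex (-1/2) (sqrt 3 / 2)"
  "ee (5/12) = Complex (- sqrt 3 / 2) (1/2)" "ee (6/12) = Complex (-1) 0"
  "ee (7/12) = Complex (- sqrt 3 / 2) (-1/2)" "ee (8/12) = Complex (-1/2) (- sqrt 3 / 2)"
  "ee (9/12) = Complex 0 (-1)" "ee (10/12) = Complex (1/2) (- sqrt 3 / 2)"
  "ee (11/12) = Complex (sqrt 3 / 2) (-1/2)"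
proof -
  show 1: "ee (1/12) = Complex (sqrt 3 / 2) (1/2)"
    using sin_30 cos_30 by (simp add: ee_def complex_eq_iff)
  have *: "ee ((k + 1)/12) = ee (k/12) * ee (1/12)" for k
    unfolding ee_add[symmetric] by (simp add: add_divide_distrib)
  show 2: "ee (2/12) = Complex (1/2) (sqrt 3 / 2)" using *[of 1] by (simp add: 1 complex_eq_iff field_simps)
  show 3: "ee (3/12) = Complex 0 1" using *[of 2, unfolded 2 1] by (simp add: complex_eq_iff field_simps)
  show 4: "ee (4/12) = Complex (-1/2) (sqrt 3 / 2)" using *[of 3, unfolded 3 1] by (simp add: complex_eq_iff field_simps)
  show 5: "ee (5/12) = Complex (- sqrt 3 / 2) (1/2)" using *[of 4, unfolded 4 1] by (simp add: complex_eq_iff field_simps)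
  show 6: "ee (6/12) = Complex (-1) 0" using *[of 5, unfolded 5 1] by (simp add: complex_eq_iff field_simps)
  show 7: "ee (7/12) = Complex (- sqrt 3 / 2) (-1/2)" using *[of 6, unfolded 6 1] by (simp add: complex_eq_iff field_simps)
  show 8: "ee (8/12) = Complex (-1/2) (- sqrt 3 / 2)" using *[of 7, unfolded 7 1] by (simp add: complex_eq_iff field_simps)
  show 9: "ee (9/12) = Complex 0 (-1)" using *[of 8, unfolded 8 1] by (simp add: complex_eq_iff field_simps)
  show 10: "ee (10/12) = Complex (1/2) (- sqrt 3 / 2)" using *[of 9, unfolded 9 1] by (simp add: complex_eq_iff field_simps)
  show 11: "ee (11/12) = Complex (sqrt 3 / 2) (-1/2)" using *[of 10, unfolded 10 1] by (simp add: complex_eq_iff field_simps)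
qed

text \<open>A real, even, primitive character is its own discrete Fourier transform up to its Gauss
  sum, here sqrt 12. Both sides depend only on m modulo 12, and the twelve cases are
  computed.\<close>

lemma chi12_fourier:
  "(\<Sum>x\<in>{0..<12}. of_int (chi12 x) * ee (of_int (x * m) / 12)) = of_real (sqrt 12) * of_int (chi12 m)"
proof -
  have s12: "sqrt 12 = 2 * sqrt 3" using real_sqrt_mult[of 4 3] by simp
  have *: "ee (of_int (x * m) / 12) = ee (of_int ((x * (m mod 12)) mod 12) / 12)" for x
    using ee_cong_int[of "x * m" "(x * (m mod 12)) mod 12" 12] by (simp add: cong_def mod_mult_right_eq)
  have c: "chi12 (m mod 12) = chi12 m" by (rule chi12_cong) simp
  have "(\<Sum>x\<in>{0..<12}. of_int (chi12 x) * ee (of_int ((x * r) mod 12) / 12)) = of_real (sqrt 12) * of_int (chi12 r)"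
    if "r \<in> {0..<12}" for r
    using that unfolding residues_12
    by (elim insertE emptyE) (simp_all only:, simp_all add: chi12_def ee_twelfths[simplified] s12 complex_eq_iff)
  from this[of "m mod 12"] show ?thesis unfolding * c by simp
qed

section \<open>Legendre symbols\<close>

lemma Legendre_cong:
  assumes "[a = b] (mod p)" shows "Legendre a p = Legendre b p"
proof -
  have "[a = 0] (mod p) \<longleftrightarrow> [b = 0] (mod p)" "QuadRes p a \<longleftrightarrow> QuadRes p b"
    using assms unfolding QuadRes_def by (meson cong_sym cong_trans)+
  then show ?thesis by (simp add: Legendre_def)
qed

text \<open>Euler's criterion makes both sides congruent modulo p; they differ by at most 2, and p >
  2.\<close>

lemma Legendre_mult:
  assumes p: "prime p" "2 < p"
  shows "Legendre (a * b) (int p) = Legendre a (int p) * Legendre b (int p)"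
proof -
  have "[Legendre (a * b) (int p) = (a * b) ^ ((p - 1) div 2)] (mod int p)" by (rule euler_criterion[OF p])
  also have "(a * b) ^ ((p - 1) div 2) = a ^ ((p - 1) div 2) * b ^ ((p - 1) div 2)" by (rule power_mult_distrib)
  also have "[\<dots> = Legendre a (int p) * Legendre b (int p)] (mod int p)"
    by (intro cong_mult cong_sym[OF euler_criterion[OF p]])
  finally have dvd: "int p dvd Legendre (a * b) (int p) - Legendre a (int p) * Legendre b (int p)"
    by (simp only: cong_iff_dvd_diff)
  have L: "\<bar>Legendre n q\<bar> \<le> 1" for n q by (simp add: Legendre_def)
  have "\<bar>Legendre a (int p) * Legendre b (int p)\<bar> \<le> 1"
    unfolding abs_mult by (intro mult_le_one L) simp
  with L[of "a * b" "int p"]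
  have "\<bar>Legendre (a * b) (int p) - Legendre a (int p) * Legendre b (int p)\<bar> \<le> 2"
    by linarith
  with p(2) dvd_imp_le_int[OF _ dvd] show ?thesis by fastforce
qed

lemma Legendre_eq_0_iff: "Legendre a p = 0 \<longleftrightarrow> p dvd a"
  by (auto simp: Legendre_def cong_0_iff)

lemma Legendre_square:
  assumes "\<not> p dvd a" shows "Legendre a p * Legendre a p = 1"
  using assms by (auto simp: Legendre_def cong_0_iff)

text \<open>The bridge between the twist (3n/l) in the Hecke operator and the character of the theta
  series. Quadratic reciprocity reduces it to the four classes of p modulo 12.\<close>

lemma Legendre_3:
  assumes p: "prime p" "5 \<le> p"
  shows "Legendre 3 (int p) = chi12 (int p)"
proof -
  have "Legendre (int 3) (int p) * Legendre (int p) (int 3) = (- 1) ^ ((3 - 1) div 2 * ((p - 1) div 2))"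
    using p by (intro Quadratic_Reciprocity) auto
  then have QR: "Legendre 3 (int p) * Legendre (int p) 3 = (- 1) ^ ((p - 1) div 2)" by simp
  have p3: "p mod 3 \<noteq> 0" "p mod 2 \<noteq> 0"
    using p primes_dvd_imp_eq[of 3 p] primes_dvd_imp_eq[of 2 p] by (auto simp flip: dvd_eq_mod_eq_0)
  have L1: "Legendre 1 3 = 1" unfolding Legendre_def QuadRes_def by (auto simp: cong_def intro: exI[of _ 1])
  have L2: "Legendre 2 3 = -1"
  proof -
    have "y\<^sup>2 mod 3 \<noteq> 2" for y :: int
    proof -
      have "y mod 3 \<in> {0, 1, 2}" by auto
      then have "(y mod 3)\<^sup>2 mod 3 \<noteq> 2" by auto
      then show ?thesis by (simp add: power_mod)
    qed
    then show ?thesis unfolding Legendre_def QuadRes_def by (auto simp: cong_def)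
  qed
  have L3: "Legendre (int p) 3 = Legendre (int (p mod 3)) 3"
    by (rule Legendre_cong) (simp add: cong_def zmod_int)
  from p3 have "p mod 12 = 1 \<or> p mod 12 = 5 \<or> p mod 12 = 7 \<or> p mod 12 = 11" by presburger
  then consider "p mod 12 = 1" | "p mod 12 = 5" | "p mod 12 = 7" | "p mod 12 = 11" by blast
  then show ?thesis
  proof cases
    case 1
    define k where "k = p div 12"
    have k: "p = 12 * k + 1" using mult_div_mod_eq[of 12 p] 1 by (simp add: k_def)
    have "(p - 1) div 2 = 2 * (3 * k)" "p mod 3 = 1" "int p mod 12 = 1" using k by presburger+
    with QR L1 L3 show ?thesis by (simp add: chi12_def)
  next
    case 2
    define k where "k = p div 12"
    have k: "p = 12 * k + 5" using mult_div_mod_eq[of 12 p] 2 by (simp add: k_def)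
    have "(p - 1) div 2 = 2 * (3 * k + 1)" "p mod 3 = 2" "int p mod 12 = 5" using k by presburger+
    with QR L2 L3 show ?thesis by (simp add: chi12_def)
  next
    case 3
    define k where "k = p div 12"
    have k: "p = 12 * k + 7" using mult_div_mod_eq[of 12 p] 3 by (simp add: k_def)
    have "(p - 1) div 2 = Suc (2 * (3 * k + 1))" "p mod 3 = 1" "int p mod 12 = 7" using k by presburger+
    with QR L1 L3 show ?thesis by (simp add: chi12_def)
  next
    case 4
    define k where "k = p div 12"
    have k: "p = 12 * k + 11" using mult_div_mod_eq[of 12 p] 4 by (simp add: k_def)
    have "(p - 1) div 2 = Suc (2 * (3 * k + 2))" "p mod 3 = 2" "int p mod 12 = 11" using k by presburger+
    with QR L2 L3 show ?thesis by (simp add: chi12_def)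
  qed
qed

section \<open>Quadratic Gauss sums\<close>

definition gauss_sum :: "int \<Rightarrow> int \<Rightarrow> complex" where
  "gauss_sum w c = (\<Sum>k\<in>{0..<c}. ee (of_int (w * k\<^sup>2) / of_int c))"

text \<open>With two base-l digits x + l k, the cross term contributes the sum of e(2 w x k / l)
  over k, which vanishes unless x = 0. Hence no Legendre symbol of w remains, unlike for the modulus
  l.\<close>

lemma gauss_sum_prime_square:
  assumes l: "prime l" "2 < l" and w: "\<not> l dvd w"
  shows "gauss_sum w (l\<^sup>2) = of_int l"
proof -
  have l0: "l > 0" using l by simp
  have "gauss_sum w (l\<^sup>2) = (\<Sum>x\<in>{0..<l}. \<Sum>k\<in>{0..<l}. ee (of_int (w * (x + l * k)\<^sup>2) / of_int (l\<^sup>2)))"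
    unfolding gauss_sum_def power2_eq_square[of l] by (rule sum_digits[OF l0 l0])
  also have "\<dots> = (\<Sum>x\<in>{0..<l}. ee (of_int (w * x\<^sup>2) / of_int (l\<^sup>2)) * (\<Sum>k\<in>{0..<l}. ee (of_int ((2 * w * x) * k) / of_int l)))"
  proof (intro sum.cong refl, unfold sum_distrib_left, intro sum.cong refl)
    fix x k
    have "real_of_int (w * (x + l * k)\<^sup>2) / of_int (l\<^sup>2) =
      (of_int (w * x\<^sup>2) / of_int (l\<^sup>2) + of_int (2 * w * x * k) / of_int l) + of_int (w * k\<^sup>2)"
      using l0 by (simp add: field_simps power2_eq_square)
    then show "ee (of_int (w * (x + l * k)\<^sup>2) / of_int (l\<^sup>2)) = ee (of_int (w * x\<^sup>2) / of_int (l\<^sup>2)) * ee (of_int (2 * w * x * k) / of_int l)"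
      by (simp only: ee_add ee_of_int mult_1_right)
  qed
  also have "\<dots> = (\<Sum>x\<in>{0..<l}. if x = 0 then of_int l else 0)"
  proof (intro sum.cong refl)
    fix x assume x: "x \<in> {0..<l}"
    have "l dvd 2 * w * x \<longleftrightarrow> x = 0"
    proof
      assume "l dvd 2 * w * x"
      then have "l dvd 2 \<or> l dvd x" using w l(1) by (simp add: prime_dvd_mult_iff)
      then have "l dvd x" using l(2) by (auto dest: zdvd_imp_le)
      then show "x = 0" using x zdvd_imp_le by fastforce
    qed auto
    then show "ee (of_int (w * x\<^sup>2) / of_int (l\<^sup>2)) * (\<Sum>k\<in>{0..<l}. ee (of_int ((2 * w * x) * k) / of_int l)) = (if x = 0 then of_int l else 0)"
      unfolding sum_ee_residues[OF l0] by auto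
  qed
  finally show ?thesis using l0 by simp
qed

lemma card_square_roots_mod:
  assumes l: "prime l" "2 < (l::int)" and v: "v \<in> {0..<l}"
  shows "of_nat (card {k\<in>{0..<l}. k\<^sup>2 mod l = v}) = 1 + Legendre v l"
proof -
  have dvd0: "x = 0" if "l dvd x" "x \<in> {0..<l}" for x using that zdvd_imp_le by fastforce
  show ?thesis
  proof (cases "v = 0")
    case True
    have "{k\<in>{0..<l}. k\<^sup>2 mod l = v} = {0}"
      using True l dvd0 by (auto simp: dvd_eq_mod_eq_0[symmetric] prime_dvd_power_iff)
    then show ?thesis using True by (simp add: Legendre_def)
  next
    case False
    then have v0: "\<not> [v = 0] (mod l)" using v dvd0 by (auto simp: cong_0_iff)
    show ?thesis
    proof (cases "QuadRes l v")
      case False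
      then have *: "{k\<in>{0..<l}. k\<^sup>2 mod l = v} = {}" using v by (auto simp: QuadRes_def cong_def)
      show ?thesis unfolding * using False v0 by (simp add: Legendre_def)
    next
      case True
      then obtain y where y: "[y\<^sup>2 = v] (mod l)" by (auto simp: QuadRes_def)
      define x where "x = y mod l"
      have x: "x \<in> {0..<l}" "x\<^sup>2 mod l = v"
        using l y v by (auto simp: x_def cong_def power_mod)
      have x0: "x \<noteq> 0" using x \<open>v \<noteq> 0\<close> by auto
      have *: "{k\<in>{0..<l}. k\<^sup>2 mod l = v} = {x, l - x}"
      proof (intro Set.set_eqI iffI)
        fix k assume "k \<in> {k\<in>{0..<l}. k\<^sup>2 mod l = v}"
        then have k: "k \<in> {0..<l}" "k\<^sup>2 mod l = x\<^sup>2 mod l" using x by auto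
        then have "l dvd k\<^sup>2 - x\<^sup>2" by (simp add: mod_eq_dvd_iff)
        then have "l dvd (k - x) * (k + x)" by (simp add: power2_eq_square algebra_simps)
        then consider "l dvd k - x" | "l dvd k + x" using l(1) prime_dvd_multD by blast
        then show "k \<in> {x, l - x}"
        proof cases
          case 1
          then have "k mod l = x mod l" by (simp add: mod_eq_dvd_iff)
          then show ?thesis using k x by simp
        next
          case 2
          then have "l dvd (k + x) - l" by (rule dvd_diff) simp
          also have "(k + x) - l = k - (l - x)" by simp
          finally have "k mod l = (l - x) mod l" by (simp only: mod_eq_dvd_iff)
          moreover have "k mod l = k" using k by (intro mod_pos_pos_trivial) auto
          moreover have "(l - x) mod l = l - x" using x x0 by (intro mod_pos_pos_trivial) auto
          ultimately show ?thesis by simp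
        qed
      next
        fix k assume "k \<in> {x, l - x}"
        moreover have "(l - x)\<^sup>2 - x\<^sup>2 = l * (l - 2 * x)" by (simp add: power2_eq_square algebra_simps)
        then have "(l - x)\<^sup>2 mod l = x\<^sup>2 mod l" unfolding mod_eq_dvd_iff by simp
        ultimately show "k \<in> {k\<in>{0..<l}. k\<^sup>2 mod l = v}" using x x0 by auto
      qed
      have "x \<noteq> l - x"
      proof
        assume "x = l - x"
        then have "l = 2 * x" by simp
        then have "2 dvd l" by simp
        with l show False using primes_dvd_imp_eq[of 2 l] by auto
      qed
      then show ?thesis unfolding * using True v0 by (simp add: Legendre_def)
    qed
  qed
qed

text \<open>Grouping k by its square: v has 1 + (v/l) square roots, and the contribution of the 1 is
  a complete sum of a nontrivial additive character.\<close>

lemma gauss_sum_eq_twisted: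
  assumes l: "prime l" "2 < l" and w: "\<not> l dvd w"
  shows "gauss_sum w l = (\<Sum>v\<in>{0..<l}. of_int (Legendre v l) * ee (of_int (w * v) / of_int l))"
proof -
  have l0: "l > 0" using l by simp
  define e where "e v = ee (of_int (w * v) / of_int l)" for v
  have "gauss_sum w l = (\<Sum>k\<in>{0..<l}. e (k\<^sup>2 mod l))"
    unfolding gauss_sum_def e_def
    by (intro sum.cong refl ee_cong_int cong_scalar_left) (simp add: cong_def)
  also have "\<dots> = (\<Sum>v\<in>{0..<l}. \<Sum>k\<in>{k\<in>{0..<l}. k\<^sup>2 mod l = v}. e (k\<^sup>2 mod l))"
    using l0 by (intro sum.group[symmetric]) auto
  also have "\<dots> = (\<Sum>v\<in>{0..<l}. of_int (1 + Legendre v l) * e v)"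
  proof (intro sum.cong refl)
    fix v assume v: "v \<in> {0..<l}"
    have "(\<Sum>k\<in>{k\<in>{0..<l}. k\<^sup>2 mod l = v}. e (k\<^sup>2 mod l)) = of_nat (card {k\<in>{0..<l}. k\<^sup>2 mod l = v}) * e v" by simp
    also have "complex_of_nat (card {k\<in>{0..<l}. k\<^sup>2 mod l = v}) = of_int (of_nat (card {k\<in>{0..<l}. k\<^sup>2 mod l = v}))" by simp
    finally show "(\<Sum>k\<in>{k\<in>{0..<l}. k\<^sup>2 mod l = v}. e (k\<^sup>2 mod l)) = of_int (1 + Legendre v l) * e v"
      unfolding card_square_roots_mod[OF l v] .
  qed
  also have "\<dots> = (\<Sum>v\<in>{0..<l}. e v) + (\<Sum>v\<in>{0..<l}. of_int (Legendre v l) * e v)"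
    by (simp add: sum.distrib distrib_right)
  also have "(\<Sum>v\<in>{0..<l}. e v) = 0" using w unfolding e_def sum_ee_residues[OF l0] by simp
  finally show ?thesis by (simp add: e_def)
qed

text \<open>If l does not divide n, substituting n v for v extracts (n/l). Otherwise the phases are
  trivial and the Legendre symbols themselves sum to 0.\<close>

lemma twisted_sum_eq:
  fixes l :: nat
  assumes l: "prime l" "2 < l"
  shows "(\<Sum>v\<in>{0..<int l}. of_int (Legendre v (int l)) * ee (of_int (n * v) / of_int (int l))) =
    of_int (Legendre n (int l)) * gauss_sum 1 (int l)"
proof -
  have l0: "int l > 0" and lp: "prime (int l)" "2 < int l" using l by auto
  define f where "f n v = of_int (Legendre v (int l)) * ee (of_int (n * v) / of_int (int l))" for n v
  have per: "f n x = f n y" if "[x = y] (mod int l)" for n x y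
    using Legendre_cong[OF that] ee_cong_int[OF cong_scalar_left[OF that]] by (simp add: f_def)
  have one: "gauss_sum 1 (int l) = (\<Sum>v\<in>{0..<int l}. f 1 v)"
    unfolding f_def by (rule gauss_sum_eq_twisted) (use lp in auto)
  show ?thesis
  proof (cases "int l dvd n")
    case False
    then have cop: "coprime n (int l)" using prime_imp_coprime[OF lp(1) False] by (simp add: coprime_commute)
    have "(\<Sum>v\<in>{0..<int l}. f 1 v) = (\<Sum>v\<in>{0..<int l}. f 1 (n * v + 0))"
      by (rule sum_affine_periodic[symmetric, OF l0 per cop])
    also have "\<dots> = of_int (Legendre n (int l)) * (\<Sum>v\<in>{0..<int l}. f n v)"
      by (simp add: f_def Legendre_mult[OF l] sum_distrib_left mult_ac)
    finally have "of_int (Legendre n (int l)) * gauss_sum 1 (int l) =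
      of_int (Legendre n (int l) * Legendre n (int l)) * (\<Sum>v\<in>{0..<int l}. f n v)"
      by (simp add: one)
    then show ?thesis unfolding Legendre_square[OF False] by (simp add: f_def)
  next
    case True
    then obtain d where d: "n = int l * d" by blast
    have "f n v = of_int (Legendre v (int l))" for v
    proof -
      have "ee (of_int (n * v) / of_int (int l)) = ee (of_int 0 / of_int (int l))"
        by (rule ee_cong_int) (simp add: d cong_0_iff)
      then show ?thesis by (simp add: f_def)
    qed
    \<comment> \<open>The square roots of all v together are all k, each counted once, so 1 + (v/l)
      sums to l.\<close>
    then have "(\<Sum>v\<in>{0..<int l}. f n v) = (\<Sum>v\<in>{0..<int l}. of_int (1 + Legendre v (int l)) - 1)" by simp
    also have "\<dots> = (\<Sum>v\<in>{0..<int l}. of_nat (card {k\<in>{0..<int l}. k\<^sup>2 mod int l = v})) - of_nat l"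
      by (simp add: sum_subtractf card_square_roots_mod[OF lp, symmetric] del: of_int_add)
    also have "(\<Sum>v\<in>{0..<int l}. complex_of_nat (card {k\<in>{0..<int l}. k\<^sup>2 mod int l = v})) =
      (\<Sum>v\<in>{0..<int l}. \<Sum>k\<in>{k\<in>{0..<int l}. k\<^sup>2 mod int l = v}. 1)" by simp
    also have "\<dots> = (\<Sum>k\<in>{0..<int l}. 1)"
      using l0 by (intro sum.group) auto
    finally have "(\<Sum>v\<in>{0..<int l}. f n v) = 0" by simp
    moreover have "Legendre n (int l) = 0" using True by (simp add: Legendre_eq_0_iff)
    ultimately show ?thesis by (simp add: f_def)
  qed
qed

lemma gauss_sum_prime:
  fixes l :: nat
  assumes l: "prime l" "2 < l" and w: "\<not> int l dvd w"
  shows "gauss_sum w (int l) = of_int (Legendre w (int l)) * gauss_sum 1 (int l)"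
  using gauss_sum_eq_twisted[of "int l" w] twisted_sum_eq[OF l, of w] l w by simp

text \<open>The product of the sums for 1 and -1 has phases x^2 - y^2. Shifting x by y makes them
  x^2 + 2 x y, and summation over y leaves only x = 0. The sum for -1 is then rewritten by
  \<open>gauss_sum_prime\<close>.\<close>

lemma gauss_sum_squared:
  fixes l :: nat
  assumes l: "prime l" "2 < l"
  shows "of_int (Legendre (-1) (int l)) * (gauss_sum 1 (int l))\<^sup>2 = of_nat l"
proof -
  have l0: "int l > 0" and lp: "prime (int l)" "2 < int l" using l by auto
  have "gauss_sum 1 (int l) * gauss_sum (-1) (int l) =
    (\<Sum>y\<in>{0..<int l}. (\<Sum>x\<in>{0..<int l}. ee (of_int (x\<^sup>2 - y\<^sup>2) / of_int (int l))))"
    unfolding gauss_sum_def sum_product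
    by (subst sum.swap) (simp add: diff_divide_distrib flip: ee_add)
  also have "\<dots> = (\<Sum>y\<in>{0..<int l}. (\<Sum>x\<in>{0..<int l}. ee (of_int ((1 * x + y)\<^sup>2 - y\<^sup>2) / of_int (int l))))"
    by (intro sum.cong refl sum_affine_periodic[symmetric] l0 ee_cong_int cong_diff cong_pow) auto
  also have "\<dots> = (\<Sum>x\<in>{0..<int l}. ee (of_int (x\<^sup>2) / of_int (int l)) * (\<Sum>y\<in>{0..<int l}. ee (of_int ((2 * x) * y) / of_int (int l))))"
    by (subst sum.swap)
       (simp add: sum_distrib_left power2_eq_square algebra_simps add_divide_distrib flip: ee_add)
  also have "\<dots> = (\<Sum>x\<in>{0..<int l}. if x = 0 then of_nat l else 0)"
  proof (intro sum.cong refl)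
    fix x assume x: "x \<in> {0..<int l}"
    have "int l dvd 2 * x \<longleftrightarrow> x = 0"
    proof
      assume "int l dvd 2 * x"
      then have "int l dvd 2 \<or> int l dvd x" using lp(1) prime_dvd_multD by blast
      then have "int l dvd x" using lp(2) by (auto dest: zdvd_imp_le)
      then show "x = 0" using x zdvd_imp_le by fastforce
    qed auto
    then show "ee (of_int (x\<^sup>2) / of_int (int l)) * (\<Sum>y\<in>{0..<int l}. ee (of_int ((2 * x) * y) / of_int (int l))) = (if x = 0 then of_nat l else 0)"
      unfolding sum_ee_residues[OF l0] by auto
  qed
  also have "\<dots> = of_nat l" using l by simp
  finally show ?thesis
    using gauss_sum_prime[OF l, of "-1"] lp by (simp add: power2_eq_square mult_ac)
qed

section \<open>The theta function of the character modulo 12\<close>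

lemma upper_half_plane_iff: "z \<in> upper_half_plane \<longleftrightarrow> Im z > 0"
  by (simp add: upper_half_plane_def)

lemma open_upper_half_plane: "open upper_half_plane"
  unfolding upper_half_plane_def by (rule open_halfspace_Im_gt)

lemma connected_upper_half_plane: "connected upper_half_plane"
  unfolding upper_half_plane_def by (intro convex_connected convex_halfspace_Im_gt)

lemma qpow_add: "qpow r (z + w) = qpow r z * qpow r w"
  by (simp add: qpow_def distrib_left exp_add)

lemma qpow_of_real: "qpow r (of_real x) = ee (r * x)"
  by (simp add: qpow_def ee_eq_exp mult_ac)

lemma norm_qpow: "norm (qpow r z) = exp (- (2 * pi * r * Im z))"
  by (simp add: qpow_def norm_exp_eq_Re mult_ac)

lemma qpow_Complex: "qpow r (Complex x y) = of_real (exp (- (2 * pi * r * y))) * ee (r * x)"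
proof -
  have "qpow r (Complex x y) = exp (of_real (- (2 * pi * r * y)) + 2 * of_real pi * \<i> * of_real (r * x))"
    unfolding qpow_def by (rule arg_cong[of _ _ exp]) (simp add: complex_eq_iff)
  then show ?thesis by (simp only: exp_add exp_of_real ee_eq_exp)
qed

text \<open>The identity theorem. It confines the study of theta functions to vertical lines, where
  their terms are Gaussians with constant phases.\<close>

lemma zero_on_vertical_line_imp_zero:
  assumes f: "f holomorphic_on upper_half_plane" and zero: "\<And>y. y > 0 \<Longrightarrow> f (Complex x y) = 0"
    and z: "z \<in> upper_half_plane"
  shows "f z = 0"
proof (rule analytic_continuation[OF f open_upper_half_plane connected_upper_half_plane])
  show "{Complex x y |y. y > 0} \<subseteq> upper_half_plane" by (auto simp: upper_half_plane_iff)
  show "Complex x 1 \<in> upper_half_plane" by (simp add: upper_half_plane_iff)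
  show "Complex x 1 islimpt {Complex x y |y. y > 0}"
    unfolding islimpt_approachable
  proof (intro allI impI)
    fix e :: real assume e: "e > 0"
    have "dist (Complex x (1 + e/2)) (Complex x 1) < e"
      using e by (simp add: dist_norm cmod_def)
    then show "\<exists>x'\<in>{Complex x y |y. y > 0}. x' \<noteq> Complex x 1 \<and> dist x' (Complex x 1) < e"
      using e by (intro bexI[of _ "Complex x (1 + e/2)"]) auto
  qed
qed (use zero z in auto)

text \<open>This is \<open>2\<eta>\<close> by the pentagonal number theorem, a fact that is not used.\<close>
definition theta12 :: "complex \<Rightarrow> complex" where
  "theta12 z = (\<Sum>\<^sub>\<infinity>n::int. of_int (chi12 n) * qpow ((of_int n)\<^sup>2 / 24) z)"

lemma norm_chi12: "norm (of_int (chi12 n) :: complex) \<le> 1"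
  by (simp add: chi12_def)

text \<open>The vanishing linear term keeps the bound in the shape of
  \<open>summable_on_gaussian\<close>.\<close>

lemma norm_theta12_term:
  assumes "Im z \<ge> y"
  shows "norm (of_int (chi12 n) * qpow ((of_int n)\<^sup>2 / 24) z) \<le> exp (- (pi * y / 12) * (of_int n)\<^sup>2 + 0 * \<bar>of_int n\<bar>)"
proof -
  have "pi / 12 * (of_int n)\<^sup>2 * y \<le> pi / 12 * (of_int n)\<^sup>2 * Im z"
    using assms by (intro mult_left_mono) auto
  then have "norm (qpow ((of_int n)\<^sup>2 / 24) z) \<le> exp (- (pi * y / 12) * (of_int n)\<^sup>2 + 0 * \<bar>of_int n\<bar>)"
    by (simp add: norm_qpow mult_ac)
  then show ?thesis
    unfolding norm_mult using norm_chi12[of n] mult_mono[OF norm_chi12[of n]] by fastforce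
qed

lemma summable_theta12_bound:
  assumes "y > 0"
  shows "(\<lambda>n::int. exp (- (pi * y / 12) * (of_int n)\<^sup>2 + 0 * \<bar>of_int n\<bar>)) summable_on UNIV"
  using assms by (intro summable_on_gaussian) auto

lemma holomorphic_theta12: "theta12 holomorphic_on upper_half_plane"
  unfolding theta12_def
proof (rule holomorphic_infsum[OF open_upper_half_plane])
  show "(\<lambda>z. of_int (chi12 n) * qpow ((of_int n)\<^sup>2 / 24) z) holomorphic_on upper_half_plane" for n
    unfolding qpow_def by (intro holomorphic_intros)
  fix z assume "z \<in> upper_half_plane"
  then have y: "Im z > 0" by (simp add: upper_half_plane_iff)
  have "Im w \<ge> Im z / 2" if "w \<in> cball z (Im z / 2)" for w
    using that abs_Im_le_cmod[of "z - w"] by (simp add: dist_norm abs_le_iff)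
  note Im = this
  show "\<exists>r>0. \<exists>M. cball z r \<subseteq> upper_half_plane \<and> M summable_on UNIV \<and>
    (\<forall>n\<in>UNIV. \<forall>w\<in>cball z r. norm (of_int (chi12 n) * qpow ((of_int n)\<^sup>2 / 24) w) \<le> M n)"
  proof (rule exI[of _ "Im z / 2"], intro conjI exI[of _ "\<lambda>n::int. exp (- (pi * (Im z / 2) / 12) * (of_int n)\<^sup>2 + 0 * \<bar>of_int n\<bar>)"] ballI)
    show "cball z (Im z / 2) \<subseteq> upper_half_plane"
      using Im y by (force simp: upper_half_plane_iff)
    show "(\<lambda>n::int. exp (- (pi * (Im z / 2) / 12) * (of_int n)\<^sup>2 + 0 * \<bar>of_int n\<bar>)) summable_on UNIV"
      using y by (intro summable_theta12_bound) simp
    show "norm (of_int (chi12 n) * qpow ((of_int n)\<^sup>2 / 24) w) \<le> exp (- (pi * (Im z / 2) / 12) * (of_int n)\<^sup>2 + 0 * \<bar>of_int n\<bar>)"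
      if "w \<in> cball z (Im z / 2)" for n w
      by (rule norm_theta12_term[OF Im[OF that]])
  qed (use y in auto)
qed

lemma theta12_translate: "theta12 (z + of_int k) = ee (of_int k / 24) * theta12 z"
proof -
  have "of_int (chi12 n) * qpow ((of_int n)\<^sup>2 / 24) (z + of_int k) =
    ee (of_int k / 24) * (of_int (chi12 n) * qpow ((of_int n)\<^sup>2 / 24) z)" for n
  proof (cases "chi12 n = 0")
    case False
    have "ee (of_int (n\<^sup>2 * k) / of_int 24) = ee (of_int (1 * k) / of_int 24)"
      by (intro ee_cong_int cong_mult chi12_square False cong_refl)
    then have "qpow ((of_int n)\<^sup>2 / 24) (of_int k) = ee (of_int k / 24)"
      using qpow_of_real[of "(of_int n)\<^sup>2 / 24" "of_int k"] by simp
    then show ?thesis by (simp add: qpow_add)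
  qed simp
  then show ?thesis unfolding theta12_def by (simp only: infsum_cmult_right')
qed

text \<open>By the Chinese remainder theorem, r = c x + 12 k separates the character, seen through
  x, from the quadratic phase, seen through k. The congruence makes -24 u m the shift that completes
  the square, which leaves e(u m^2/c) times a full Gauss sum.\<close>

lemma dft_chi12_quadratic:
  fixes c u w m :: int
  assumes c: "c > 0" "coprime 12 c" and uw: "[576 * u * w = -1] (mod c)"
  shows "(\<Sum>r\<in>{0..<12 * c}. (of_int (chi12 r) * ee (of_int (w * r\<^sup>2) / of_int c)) * ee (of_int (r * m) / of_int (12 * c))) =
    of_real (sqrt 12) * of_int (chi12 c) * gauss_sum w c * (of_int (chi12 m) * ee (of_int (u * m\<^sup>2) / of_int c))"
proof -
  define f where "f r = (of_int (chi12 r) * ee (of_int (w * r\<^sup>2) / of_int c)) * ee (of_int (r * m) / of_int (12 * c))" for r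
  have per: "f x = f y" if "[x = y] (mod 12 * c)" for x y
  proof -
    have m12: "[x = y] (mod 12)" using that by (rule cong_modulus_mult)
    have mc: "[x = y] (mod c)" using that by (simp add: mult.commute[of 12] cong_modulus_mult)
    have "ee (of_int (w * x\<^sup>2) / of_int c) = ee (of_int (w * y\<^sup>2) / of_int c)"
      by (intro ee_cong_int cong_scalar_left cong_pow mc)
    moreover have "ee (of_int (x * m) / of_int (12 * c)) = ee (of_int (y * m) / of_int (12 * c))"
      by (intro ee_cong_int cong_scalar_right that)
    ultimately show ?thesis using chi12_cong[OF m12] by (simp only: f_def)
  qed
  have fx: "f (c * x + 12 * k) = of_int (chi12 c) * (of_int (chi12 x) * ee (of_int (x * m) / 12)) *
    (ee (of_int (u * m\<^sup>2) / of_int c) * ee (of_int (w * (12 * k + - 24 * u * m)\<^sup>2) / of_int c))" for x k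
  proof -
    have "chi12 (c * x + 12 * k) = chi12 (c * x)" by (rule chi12_cong) (simp add: cong_def)
    moreover have "ee (of_int (w * (c * x + 12 * k)\<^sup>2) / of_int c) * ee (of_int ((c * x + 12 * k) * m) / of_int (12 * c)) =
      ee (of_int (x * m) / 12) * (ee (of_int (u * m\<^sup>2) / of_int c) * ee (of_int (w * (12 * k + - 24 * u * m)\<^sup>2) / of_int c))"
    proof -
      have "ee (of_int ((c * x + 12 * k) * m) / of_int (12 * c)) = ee (of_int (x * m) / 12) * ee (of_int (k * m) / of_int c)"
        unfolding ee_add[symmetric] using c by (intro arg_cong[of _ _ ee]) (simp add: field_simps)
      moreover have "ee (of_int (w * (c * x + 12 * k)\<^sup>2) / of_int c) * ee (of_int (k * m) / of_int c) =
        ee (of_int (u * m\<^sup>2) / of_int c) * ee (of_int (w * (12 * k + - 24 * u * m)\<^sup>2) / of_int c)"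
      proof -
        obtain d where d: "576 * u * w + 1 = c * d" using uw by (auto simp: cong_iff_dvd_diff)
        have "(w * (c * x + 12 * k)\<^sup>2 + k * m) - (u * m\<^sup>2 + w * (12 * k + - 24 * u * m)\<^sup>2) =
          c * (w * (c * x\<^sup>2 + 24 * x * k)) + (576 * u * w + 1) * (m * k - u * m\<^sup>2)"
          by (simp add: power2_eq_square algebra_simps)
        also have "\<dots> = c * (w * (c * x\<^sup>2 + 24 * x * k) + d * (m * k - u * m\<^sup>2))"
          unfolding d by (simp add: algebra_simps)
        finally have "[w * (c * x + 12 * k)\<^sup>2 + k * m = u * m\<^sup>2 + w * (12 * k + - 24 * u * m)\<^sup>2] (mod c)"
          by (simp add: cong_iff_dvd_diff)
        from ee_cong_int[OF this] show ?thesis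
          by (simp only: ee_add[symmetric] add_divide_distrib[symmetric] of_int_add)
      qed
      moreover have "W * E = P * (U * V)" if "E = P * K" "W * K = U * V" for E P K W U V :: complex
        using that by (simp add: mult.left_commute[of W])
      ultimately show ?thesis by blast
    qed
    ultimately show ?thesis by (simp only: f_def chi12_mult of_int_mult mult.assoc)
  qed
  have "(\<Sum>k\<in>{0..<c}. ee (of_int (w * (12 * k + - 24 * u * m)\<^sup>2) / of_int c)) = gauss_sum w c"
    unfolding gauss_sum_def
    by (rule sum_affine_periodic[where f = "\<lambda>k. ee (of_int (w * k\<^sup>2) / of_int c)"])
       (use c in \<open>auto intro!: ee_cong_int cong_scalar_left cong_pow simp del: of_int_mult of_int_power\<close>)
  moreover have "(\<Sum>r\<in>{0..<12 * c}. f r) = (\<Sum>x\<in>{0..<12}. \<Sum>k\<in>{0..<c}. f (c * x + 12 * k))"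
    by (rule sum_crt_periodic[OF _ c per]) simp_all
  moreover have gen: "(\<Sum>x\<in>X. \<Sum>k\<in>K. C * A x * (V * W k)) = C * (\<Sum>x\<in>X. A x) * (V * (\<Sum>k\<in>K. W k))"
    for X K :: "int set" and C V :: complex and A W
  proof -
    have "C * (\<Sum>x\<in>X. A x) * (V * (\<Sum>k\<in>K. W k)) = (C * V) * ((\<Sum>x\<in>X. A x) * (\<Sum>k\<in>K. W k))"
      by (simp only: mult_ac)
    also have "\<dots> = (C * V) * (\<Sum>x\<in>X. \<Sum>k\<in>K. A x * W k)" by (simp only: sum_product)
    also have "\<dots> = (\<Sum>x\<in>X. \<Sum>k\<in>K. C * A x * (V * W k))" by (simp only: sum_distrib_left mult_ac)
    finally show ?thesis ..
  qed
  ultimately have "(\<Sum>r\<in>{0..<12 * c}. f r) =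
    of_int (chi12 c) * (\<Sum>x\<in>{0..<12}. of_int (chi12 x) * ee (of_int (x * m) / 12)) * (ee (of_int (u * m\<^sup>2) / of_int c) * gauss_sum w c)"
    unfolding fx gen by (simp only:)
  then show ?thesis unfolding f_def chi12_fourier by (simp only: mult_ac)
qed

lemma theta12_Complex:
  assumes "y > 0"
  shows "theta12 (Complex (24 * of_int w / of_int c) y) =
    (\<Sum>\<^sub>\<infinity>n::int. (of_int (chi12 n) * ee (of_int (w * n\<^sup>2) / of_int c)) * of_real (exp (- pi * (y / 12) * (of_int n)\<^sup>2)))"
  unfolding theta12_def qpow_Complex by (intro infsum_cong) (simp add: mult_ac)

text \<open>Poisson summation with period 12 c. The dual series is again a theta series: the matrix
  with rows (24u, b), (c, -24w) takes the line Re z = 24 w/c to the line Re z = 24 u/c and height y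
  to height 1/(c^2 y).\<close>

lemma theta12_modular_line:
  fixes c u w :: int
  assumes c: "c > 0" "coprime 12 c" and uw: "[576 * u * w = -1] (mod c)" and y: "y > 0"
  shows "theta12 (Complex (24 * of_int w / of_int c) y) =
    of_int (chi12 c) * gauss_sum w c / of_real (of_int c * sqrt y) *
    theta12 (Complex (24 * of_int u / of_int c) (1 / ((of_int c)\<^sup>2 * y)))"
proof -
  have y': "1 / ((of_int c)\<^sup>2 * y) > 0" using c y by simp
  have "theta12 (Complex (24 * of_int w / of_int c) y) =
    of_real (1 / (of_int (12 * c) * sqrt (y / 12))) *
    (\<Sum>\<^sub>\<infinity>m. (\<Sum>r\<in>{0..<12 * c}. (of_int (chi12 r) * ee (of_int (w * r\<^sup>2) / of_int c)) * ee (of_int (r * m) / of_int (12 * c))) *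
      of_real (exp (- pi * (of_int m)\<^sup>2 / ((of_int (12 * c))\<^sup>2 * (y / 12)))))"
    unfolding theta12_Complex[OF y]
  proof (rule poisson_gaussian_periodic)
    show "12 * c > 0" "y / 12 > 0" using c y by auto
    fix a b assume ab: "[a = b] (mod 12 * c)"
    have "[a = b] (mod 12)" using ab by (rule cong_modulus_mult)
    moreover have "[a = b] (mod c)" using ab by (simp add: mult.commute[of 12] cong_modulus_mult)
    then have "ee (of_int (w * a\<^sup>2) / of_int c) = ee (of_int (w * b\<^sup>2) / of_int c)"
      by (intro ee_cong_int cong_scalar_left cong_pow)
    ultimately show "of_int (chi12 a) * ee (of_int (w * a\<^sup>2) / of_int c) = of_int (chi12 b) * ee (of_int (w * b\<^sup>2) / of_int c)"
      using chi12_cong by metis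
  qed
  also have "\<dots> = of_real (1 / (of_int (12 * c) * sqrt (y / 12))) * (of_real (sqrt 12) * of_int (chi12 c) * gauss_sum w c *
    theta12 (Complex (24 * of_int u / of_int c) (1 / ((of_int c)\<^sup>2 * y))))"
  proof -
    have "pi * (of_int m)\<^sup>2 / ((of_int (12 * c))\<^sup>2 * (y / 12)) = pi * (1 / ((of_int c)\<^sup>2 * y) / 12) * (of_int m)\<^sup>2" for m
      using c y by (simp add: field_simps power2_eq_square)
    then have e: "- pi * (of_int m)\<^sup>2 / ((of_int (12 * c))\<^sup>2 * (y / 12)) = - pi * (1 / ((of_int c)\<^sup>2 * y) / 12) * (of_int m)\<^sup>2" for m
      by simp
    show ?thesis
      unfolding theta12_Complex[OF y'] dft_chi12_quadratic[OF c uw] infsum_cmult_right'[symmetric] e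
      by (simp only: mult.assoc)
  qed
  \<comment> \<open>The factor 1 / sqrt 12 split off here cancels the Gauss sum sqrt 12 of the
    character.\<close>
  also have "1 / (of_int (12 * c) * sqrt (y / 12)) = 1 / (of_int c * sqrt y) / sqrt 12"
  proof -
    have gen: "C * (s * s) * (Y / s) = C * Y * s" if "s \<noteq> 0" for C Y s :: real
      using that by simp
    have "of_int (12 * c) * sqrt (y / 12) = of_int c * (sqrt 12 * sqrt 12) * (sqrt y / sqrt 12)"
      by (simp add: real_sqrt_divide)
    also have "\<dots> = of_int c * sqrt y * sqrt 12" by (rule gen) simp
    finally have "of_int (12 * c) * sqrt (y / 12) = of_int c * sqrt y * sqrt 12" .
    then show ?thesis by simp
  qed
  finally show ?thesis by (simp add: field_simps)
qed

lemma imaginary_powr_half: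
  assumes y: "y > 0"
  shows "Complex 0 y powr (1/2) = of_real (sqrt y) * ee (1/8)"
proof -
  have "Ln (Complex 0 y) = of_real (ln y) + \<i> * of_real pi / 2"
    using Ln_times_ii[of "of_real y"] y by (simp add: Complex_eq Ln_of_real mult.commute)
  moreover have "Complex 0 y \<noteq> 0" using y by (auto simp: complex_eq_iff)
  ultimately have "Complex 0 y powr (1/2) = exp (1/2 * (of_real (ln y) + \<i> * of_real pi / 2))"
    by (simp only: powr_def if_False)
  also have "1/2 * (of_real (ln y) + \<i> * of_real pi / 2) = of_real (ln y / 2) + \<i> * of_real pi / 4"
    by (simp add: field_simps)
  also have "exp \<dots> = exp (of_real (ln y / 2)) * exp (\<i> * of_real pi / 4)" by (rule exp_add)
  also have "exp (\<i> * of_real pi / 4) = ee (1/8)" by (simp add: ee_eq_exp mult_ac)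
  also have "exp (complex_of_real (ln y / 2)) = of_real (sqrt y)"
    using y by (simp add: exp_of_real powr_half_sqrt[symmetric] powr_def del: of_real_divide)
  finally show ?thesis .
qed

text \<open>On the imaginary axis this is \<open>theta12_modular_line\<close> with c = 1 and u = w =
  0; both sides are holomorphic.\<close>

lemma theta12_S:
  assumes z: "z \<in> upper_half_plane"
  shows "theta12 (-1 / z) = ee (-1/8) * z powr (1/2) * theta12 z"
proof -
  define D where "D z = theta12 (-1 / z) - ee (-1/8) * z powr (1/2) * theta12 z" for z
  have "D z = 0"
  proof (rule zero_on_vertical_line_imp_zero[OF _ _ z])
    have inv: "-1 / z \<in> upper_half_plane" if "z \<in> upper_half_plane" for z
      using that by (auto simp: upper_half_plane_iff Im_divide power2_eq_square intro!: divide_pos_pos sum_power2_gt_zero_iff[THEN iffD2, unfolded power2_eq_square])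
    have "(\<lambda>z. theta12 (-1 / z)) holomorphic_on upper_half_plane"
      by (rule holomorphic_on_compose_gen[OF _ holomorphic_theta12, unfolded o_def])
         (use inv in \<open>auto intro!: holomorphic_intros simp: upper_half_plane_iff\<close>)
    moreover have "(\<lambda>z. z powr (1/2)) holomorphic_on upper_half_plane"
      by (intro holomorphic_intros) (auto simp: upper_half_plane_iff complex_nonpos_Reals_iff)
    ultimately show "D holomorphic_on upper_half_plane"
      unfolding D_def by (intro holomorphic_on_diff holomorphic_on_mult holomorphic_on_const holomorphic_theta12)
    fix y :: real assume y: "y > 0"
    have "gauss_sum 0 1 = 1" by (simp add: gauss_sum_def)
    then have line: "theta12 (Complex 0 y) = 1 / of_real (sqrt y) * theta12 (Complex 0 (1 / y))"
      using theta12_modular_line[of 1 0 0 y] y by (simp add: chi12_def)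
    have "-1 / Complex 0 y = Complex 0 (1 / y)" using y by (simp add: complex_eq_iff Re_divide Im_divide power2_eq_square)
    moreover have "Complex 0 y powr (1/2) = of_real (sqrt y) * ee (1/8)"
      by (rule imaginary_powr_half[OF y])
    moreover have "ee (-1/8) * ee (1/8) = 1" by (simp flip: ee_add)
    ultimately show "D (Complex 0 y) = 0"
      using y by (simp add: D_def line)
  qed
  then show ?thesis by (simp add: D_def)
qed

text \<open>Vanishing on the line would force the function to vanish identically, but its
  coefficient at q^(1/24) is 2, from n = 1 and n = -1.\<close>

lemma theta12_nonzero_on_line: "\<exists>y>0. theta12 (Complex x y) \<noteq> 0"
proof (rule ccontr)
  assume "\<not> ?thesis"
  then have zero: "theta12 z = 0" if "z \<in> upper_half_plane" for z
    using zero_on_vertical_line_imp_zero[OF holomorphic_theta12 _ that, of x] by blast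
  \<comment> \<open>At real part 24 s the term of index n oscillates like e(n^2 s), so integration
    over a unit interval isolates n^2 = 1.\<close>
  define h where "h n s = of_int (chi12 n) * qpow ((of_int n)\<^sup>2 / 24) (Complex (24 * s) 1) * ee (- of_int 1 * s)" for n :: int and s
  let ?I = "{-1/2..1/2::real}"
  have "((\<lambda>n. integral ?I (h n)) has_sum integral ?I (\<lambda>s. \<Sum>\<^sub>\<infinity>n. h n s)) UNIV"
  proof (rule has_sum_integral)
    show "continuous_on ?I (h n)" for n
      unfolding h_def qpow_Complex by (intro continuous_intros)
    show "(\<lambda>n::int. exp (- (pi * 1 / 12) * (of_int n)\<^sup>2 + 0 * \<bar>of_int n\<bar>)) summable_on UNIV"
      by (rule summable_theta12_bound) simp
    show "norm (h n s) \<le> exp (- (pi * 1 / 12) * (of_int n)\<^sup>2 + 0 * \<bar>of_int n\<bar>)" for n s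
      using norm_theta12_term[of 1 "Complex (24 * s) 1" n] unfolding h_def norm_mult norm_ee mult_1_right by simp
  qed
  moreover have "(\<Sum>\<^sub>\<infinity>n. h n s) = 0" for s
    using zero[of "Complex (24 * s) 1"] unfolding h_def infsum_cmult_left' theta12_def[symmetric]
    by (simp add: upper_half_plane_iff)
  ultimately have 1: "((\<lambda>n. integral ?I (h n)) has_sum 0) UNIV" by simp
  have int: "integral ?I (h n) = of_int (chi12 n) * of_real (exp (- (2 * pi * ((of_int n)\<^sup>2 / 24)))) * (if n\<^sup>2 = 1 then 1 else 0)" for n
  proof -
    have "h n s = of_int (chi12 n) * of_real (exp (- (2 * pi * ((of_int n)\<^sup>2 / 24)))) * ee (of_int (n\<^sup>2 - 1) * s)" for s
    proof -
      have "ee ((of_int n)\<^sup>2 / 24 * (24 * s)) * ee (- of_int 1 * s) = ee (of_int (n\<^sup>2 - 1) * s)"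
        by (simp add: algebra_simps flip: ee_add)
      then show ?thesis by (simp add: h_def qpow_Complex mult.assoc)
    qed
    then have "integral ?I (h n) = integral ?I (\<lambda>s. of_int (chi12 n) * of_real (exp (- (2 * pi * ((of_int n)\<^sup>2 / 24)))) * ee (of_int (n\<^sup>2 - 1) * s))"
      by presburger
    then show ?thesis unfolding integral_mult_right integral_ee by simp
  qed
  have "((\<lambda>n. integral ?I (h n)) has_sum (\<Sum>n\<in>{-1, 1}. integral ?I (h n))) UNIV"
    unfolding int by (rule has_sum_finite_neutralI[OF _ _ _ refl]) (auto simp: power2_eq_1_iff)
  from has_sum_unique[OF this 1] have "(\<Sum>n\<in>{-1, 1}. integral ?I (h n)) = 0" .
  then show False unfolding int by (simp add: chi12_def)
qed

section \<open>Multiplier systems\<close>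

abbreviation jfac :: "int \<Rightarrow> int \<Rightarrow> complex \<Rightarrow> complex" where
  "jfac c d z \<equiv> of_int c * z + of_int d"

lemma jfac_nonzero:
  assumes "z \<in> upper_half_plane" "c \<noteq> 0 \<or> d \<noteq> 0"
  shows "jfac c d z \<noteq> 0"
  using assms by (auto simp: upper_half_plane_iff complex_eq_iff)

lemma det_nonzero: "a * d - b * c = (1::int) \<Longrightarrow> c \<noteq> 0 \<or> d \<noteq> 0"
  by auto

lemma moebius_upper_half_plane:
  assumes det: "a * d - b * c = 1" and z: "z \<in> upper_half_plane"
  shows "moebius a b c d z \<in> upper_half_plane"
proof -
  define w where "w = jfac c d z"
  have w: "w \<noteq> 0" unfolding w_def by (rule jfac_nonzero[OF z det_nonzero[OF det]])
  have "Im (moebius a b c d z) = (of_int a * Im z * Re w - (of_int a * Re z + of_int b) * Im w) / (cmod w)\<^sup>2"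
    unfolding moebius_def w_def[symmetric] by (simp add: Im_divide cmod_power2)
  also have "of_int a * Im z * Re w - (of_int a * Re z + of_int b) * Im w = of_int (a * d - b * c) * Im z"
    by (simp add: w_def algebra_simps)
  finally show ?thesis using z w by (simp add: upper_half_plane_iff det)
qed

lemma jfac_mult:
  assumes det: "a' * d' - b' * c' = 1" and z: "z \<in> upper_half_plane"
  shows "jfac (c * a' + d * c') (c * b' + d * d') z = jfac c d (moebius a' b' c' d' z) * jfac c' d' z"
  using jfac_nonzero[OF z det_nonzero[OF det]] by (simp add: moebius_def field_simps)

lemma moebius_mult:
  assumes det: "a' * d' - b' * c' = 1" and z: "z \<in> upper_half_plane"
  shows "moebius (a * a' + b * c') (a * b' + b * d') (c * a' + d * c') (c * b' + d * d') z =
    moebius a b c d (moebius a' b' c' d' z)"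
proof -
  define w where "w = moebius a' b' c' d' z"
  define j where "j = jfac c' d' z"
  have j: "j \<noteq> 0" unfolding j_def by (rule jfac_nonzero[OF z det_nonzero[OF det]])
  have "jfac (a * a' + b * c') (a * b' + b * d') z = jfac a b w * j"
    "jfac (c * a' + d * c') (c * b' + d * d') z = jfac c d w * j"
    unfolding w_def j_def by (rule jfac_mult[OF det z])+
  then have "moebius (a * a' + b * c') (a * b' + b * d') (c * a' + d * c') (c * b' + d * d') z = (jfac a b w * j) / (jfac c d w * j)"
    unfolding moebius_def[of "a * a' + b * c'"] by (simp only:)
  then show ?thesis using j by (simp add: moebius_def[of a] w_def)
qed

lemma det_mult:
  fixes a b c d a' b' c' d' :: int
  assumes "a * d - b * c = 1" "a' * d' - b' * c' = 1"
  shows "(a * a' + b * c') * (c * b' + d * d') - (a * b' + b * d') * (c * a' + d * c') = 1"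
proof -
  have "(a * a' + b * c') * (c * b' + d * d') - (a * b' + b * d') * (c * a' + d * c') = (a * d - b * c) * (a' * d' - b' * c')"
    by (simp add: algebra_simps)
  then show ?thesis by (simp add: assms)
qed

lemma powr_five_halves:
  assumes "(w::complex) \<noteq> 0" shows "w powr (5/2) = w powr (1/2) * w\<^sup>2"
proof -
  have "w powr (5/2) = w powr (1/2 + 2)" by simp
  also have "\<dots> = w powr (1/2) * w powr 2" by (rule powr_add)
  also have "w powr 2 = w\<^sup>2" using powr_nat'[of w 2] assms by simp
  finally show ?thesis .
qed

lemma powr_half_squared: "((w::complex) powr (1/2))\<^sup>2 = w"
  by (cases "w = 0") (simp_all add: power2_eq_square powr_add[symmetric])

lemma continuous_on_jfac_powr_half:
  assumes "c \<noteq> 0 \<or> d \<noteq> 0"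
  shows "continuous_on upper_half_plane (\<lambda>z. jfac c d z powr (1/2))"
proof (cases "c = 0")
  case False
  then show ?thesis
    by (intro continuous_intros) (auto simp: upper_half_plane_iff)
qed simp

lemma continuous_on_moebius:
  assumes "a * d - b * c = 1"
  shows "continuous_on upper_half_plane (moebius a b c d)"
  unfolding moebius_def using jfac_nonzero[OF _ det_nonzero[OF assms]]
  by (intro continuous_intros) auto

text \<open>Applied to the sign between a product of principal square roots and the root of the
  product.\<close>

lemma square_eq_1_constant:
  fixes s :: "complex \<Rightarrow> complex"
  assumes "continuous_on upper_half_plane s" "\<And>z. z \<in> upper_half_plane \<Longrightarrow> (s z)\<^sup>2 = 1"
    and z: "z \<in> upper_half_plane" "w \<in> upper_half_plane"
  shows "s z = s w"
proof -
  have "s ` upper_half_plane \<subseteq> {1, -1}" using assms(2) by (auto simp: power2_eq_1_iff)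
  then have "finite (s ` upper_half_plane)" by (rule finite_subset) simp
  then have "s constant_on upper_half_plane"
    by (intro continuous_finite_range_constant connected_upper_half_plane assms(1))
  then show ?thesis using z by (auto simp: constant_on_def)
qed

text \<open>\<open>eta_multiplier\<close> is a definite description, so its values are reached
  through a function that obeys the transformation law, at a point where it does not vanish. The
  translation law is assumed separately: it comes from the Fourier expansion and pins down the
  multiplier of the translations.\<close>

locale half_integral_form =
  fixes f :: "complex \<Rightarrow> complex"
  assumes modular: "\<And>a b c d z. a * d - b * c = 1 \<Longrightarrow> z \<in> upper_half_plane \<Longrightarrow>
      f (moebius a b c d z) = eta_multiplier a b c d * jfac c d z powr (5/2) * f z"
    and translate: "\<And>z n. z \<in> upper_half_plane \<Longrightarrow> f (z + of_int n) = ee (of_int n / 24) * f z"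
    and nontrivial: "\<exists>z\<in>upper_half_plane. f z \<noteq> 0"
begin

text \<open>Transforming f in two ways gives the relation in weight 5/2 at one point
  \<open>z0\<close>. Since w^(5/2) = w^(1/2) w^2 and the squares multiply exactly, the relation
  descends to weight 1/2. The sign \<open>s\<close> between the square roots is constant, which
  carries it to every z.\<close>

lemma multiplier_cocycle:
  assumes det: "a * d - b * c = 1" "a' * d' - b' * c' = 1" and z: "z \<in> upper_half_plane"
  shows "eta_multiplier (a * a' + b * c') (a * b' + b * d') (c * a' + d * c') (c * b' + d * d') *
      jfac (c * a' + d * c') (c * b' + d * d') z powr (1/2) =
    eta_multiplier a b c d * eta_multiplier a' b' c' d' *
      (jfac c d (moebius a' b' c' d' z) powr (1/2) * jfac c' d' z powr (1/2))"
proof -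
  define u where "u z = jfac c d (moebius a' b' c' d' z)" for z
  define v where "v z = jfac c' d' z" for z
  define w where "w z = jfac (c * a' + d * c') (c * b' + d * d') z" for z
  let ?E = "eta_multiplier (a * a' + b * c') (a * b' + b * d') (c * a' + d * c') (c * b' + d * d')"
  note det'' = det_mult[OF det]
  have w: "w z = u z * v z" if "z \<in> upper_half_plane" for z
    unfolding u_def v_def w_def by (rule jfac_mult[OF det(2) that])
  have nz: "w z \<noteq> 0" if "z \<in> upper_half_plane" for z
    unfolding w_def by (rule jfac_nonzero[OF that det_nonzero[OF det'']])
  define s where "s z = u z powr (1/2) * v z powr (1/2) / w z powr (1/2)" for z
  have s: "u z powr (1/2) * v z powr (1/2) = s z * w z powr (1/2)" if "z \<in> upper_half_plane" for z
    using nz[OF that] by (simp add: s_def)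
  have sc: "s z = s z'" if "z \<in> upper_half_plane" "z' \<in> upper_half_plane" for z z'
  proof (rule square_eq_1_constant[OF _ _ that])
    have "continuous_on upper_half_plane (\<lambda>z. u z powr (1/2))"
      unfolding u_def
      by (rule continuous_on_compose2[OF continuous_on_jfac_powr_half[OF det_nonzero[OF det(1)]] continuous_on_moebius[OF det(2)]])
         (use moebius_upper_half_plane[OF det(2)] in auto)
    moreover have "continuous_on upper_half_plane (\<lambda>z. v z powr (1/2))"
      unfolding v_def by (rule continuous_on_jfac_powr_half[OF det_nonzero[OF det(2)]])
    moreover have "continuous_on upper_half_plane (\<lambda>z. w z powr (1/2))"
      unfolding w_def by (rule continuous_on_jfac_powr_half[OF det_nonzero[OF det'']])
    ultimately show "continuous_on upper_half_plane s"
      unfolding s_def using nz by (intro continuous_on_divide continuous_on_mult) auto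
    show "(s z)\<^sup>2 = 1" if "z \<in> upper_half_plane" for z
      using nz[OF that] w[OF that] by (simp add: s_def power_divide power_mult_distrib powr_half_squared)
  qed
  obtain z0 where z0: "z0 \<in> upper_half_plane" "f z0 \<noteq> 0" using nontrivial by blast
  have uv0: "u z0 \<noteq> 0" "v z0 \<noteq> 0" using nz[OF z0(1)] w[OF z0(1)] by auto
  have "?E * w z0 powr (5/2) * f z0 = f (moebius (a * a' + b * c') (a * b' + b * d') (c * a' + d * c') (c * b' + d * d') z0)"
    unfolding w_def by (rule modular[OF det'' z0(1), symmetric])
  also have "\<dots> = f (moebius a b c d (moebius a' b' c' d' z0))"
    by (simp only: moebius_mult[OF det(2) z0(1)])
  also have "\<dots> = eta_multiplier a b c d * u z0 powr (5/2) * f (moebius a' b' c' d' z0)"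
    unfolding u_def by (rule modular[OF det(1) moebius_upper_half_plane[OF det(2) z0(1)]])
  also have "f (moebius a' b' c' d' z0) = eta_multiplier a' b' c' d' * v z0 powr (5/2) * f z0"
    unfolding v_def by (rule modular[OF det(2) z0(1)])
  finally have "?E * w z0 powr (5/2) = eta_multiplier a b c d * eta_multiplier a' b' c' d' * (u z0 powr (5/2) * v z0 powr (5/2))"
    using z0(2) by (simp add: mult_ac)
  moreover have "u z0 powr (5/2) * v z0 powr (5/2) = (u z0 powr (1/2) * v z0 powr (1/2)) * (w z0)\<^sup>2"
    by (simp add: powr_five_halves uv0 w[OF z0(1)] power_mult_distrib)
  moreover have "w z0 powr (5/2) = w z0 powr (1/2) * (w z0)\<^sup>2"
    by (rule powr_five_halves[OF nz[OF z0(1)]])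
  ultimately have "?E * w z0 powr (1/2) = eta_multiplier a b c d * eta_multiplier a' b' c' d' * (u z0 powr (1/2) * v z0 powr (1/2))"
    using nz[OF z0(1)] by (simp add: mult.assoc[symmetric])
  then have E: "?E = eta_multiplier a b c d * eta_multiplier a' b' c' d' * s z0"
    using nz[OF z0(1)] unfolding s[OF z0(1)] by (simp add: mult.assoc[symmetric])
  show ?thesis
    unfolding u_def[symmetric] v_def[symmetric] w_def[symmetric] s[OF z] E sc[OF z z0(1)] by (simp only: mult.assoc)
qed

lemma multiplier_T: "eta_multiplier 1 n 0 1 = ee (of_int n / 24)"
proof -
  obtain z0 where z0: "z0 \<in> upper_half_plane" "f z0 \<noteq> 0" using nontrivial by blast
  have "f (moebius 1 n 0 1 z0) = eta_multiplier 1 n 0 1 * jfac 0 1 z0 powr (5/2) * f z0"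
    by (rule modular) (use z0 in auto)
  then show ?thesis using translate[OF z0(1), of n] z0(2) by (simp add: moebius_def)
qed

lemma multiplier_neg_one: "eta_multiplier (-1) 0 0 (-1) * (-1) powr (1/2) = 1"
proof -
  obtain z0 where z0: "z0 \<in> upper_half_plane" "f z0 \<noteq> 0" using nontrivial by blast
  have "f (moebius (-1) 0 0 (-1) z0) = eta_multiplier (-1) 0 0 (-1) * jfac 0 (-1) z0 powr (5/2) * f z0"
    by (rule modular) (use z0 in auto)
  then have "eta_multiplier (-1) 0 0 (-1) * (-1) powr (5/2) = 1" using z0(2) by (simp add: moebius_def)
  then show ?thesis using powr_five_halves[of "-1"] by simp
qed

text \<open>The relations S^2 = -1 and (ST)^3 = -1, read at the fixed points i and e(1/3), give S^2
  e(1/4) = 1 and S^3 e(1/8) e(1/4) = 1 for the multiplier value S. The first leaves a sign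
  undetermined, the second decides it.\<close>

lemma multiplier_S: "eta_multiplier 0 (-1) 1 0 = ee (-1/8)"
proof -
  define S where "S = eta_multiplier 0 (-1) 1 0"
  have i: "\<i> \<in> upper_half_plane" by (simp add: upper_half_plane_iff)
  have fi: "moebius 0 (-1) 1 0 \<i> = \<i>" by (simp add: moebius_def complex_eq_iff Re_divide Im_divide)
  have ip: "\<i> powr (1/2) = ee (1/8)" using imaginary_powr_half[of 1] by (simp add: Complex_eq)
  have S2: "S * S * ee (1/4) = 1"
    using multiplier_cocycle[of 0 0 "-1" 1 0 0 "-1" 1 \<i>] i multiplier_neg_one
    by (simp add: fi ip S_def flip: ee_add)
  define \<rho> where "\<rho> = ee (1/3)"
  have rho: "\<rho> + 1 = ee (1/6)" and rho_eq: "\<rho> = Complex (-1/2) (sqrt 3 / 2)"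
    using ee_twelfths(2,4) by (simp_all add: \<rho>_def complex_eq_iff)
  have rH: "\<rho> \<in> upper_half_plane" by (simp add: upper_half_plane_iff rho_eq)
  have rp: "(\<rho> + 1) powr (1/2) = ee (1/12)"
  proof -
    have "Ln (\<rho> + 1) = \<i> * of_real (pi / 3)"
      by (rule Ln_unique) (auto simp: rho ee_eq_exp mult_ac)
    moreover have "\<rho> + 1 \<noteq> 0" by (simp add: rho)
    ultimately have "(\<rho> + 1) powr (1/2) = exp (1/2 * (\<i> * of_real (pi / 3)))"
      by (simp only: powr_def if_False)
    also have "1/2 * (\<i> * of_real (pi / 3)) = 2 * of_real pi * \<i> * of_real (1/12)" by simp
    finally show ?thesis by (simp only: ee_eq_exp)
  qed
  have fr: "moebius 0 (-1) 1 1 \<rho> = \<rho>"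
    unfolding moebius_def using ee_nonzero[of "1/6"]
    by (simp add: rho, simp add: \<rho>_def divide_simps, simp add: ee_def complex_eq_iff cos_60 sin_60 cos_120 sin_120 flip: ee_add)
  define K where "K = eta_multiplier 0 (-1) 1 1"
  have "K * ee (1/12) = S * ee (1/24) * ee (1/12)"
    using multiplier_cocycle[of 0 0 "-1" 1 1 1 1 0 \<rho>] rH multiplier_T[of 1]
    by (simp add: K_def S_def rp moebius_def)
  then have K: "K = S * ee (1/24)" by simp
  \<comment> \<open>The square root of the fixed point that belongs to the square of ST can stay
    unevaluated: it cancels between the next two relations.\<close>
  define K2 where "K2 = eta_multiplier (-1) (-1) 1 0"
  have k2: "K2 * \<rho> powr (1/2) = K * K * (ee (1/12) * ee (1/12))"
    using multiplier_cocycle[of 0 1 "-1" 1 0 1 "-1" 1 \<rho>] rH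
    by (simp add: K_def K2_def rp fr)
  have "1 = K2 * K * (\<rho> powr (1/2) * ee (1/12))"
    using multiplier_cocycle[of "-1" 0 "-1" 1 0 1 "-1" 1 \<rho>] rH multiplier_neg_one
    by (simp add: K_def K2_def rp fr)
  also have "\<dots> = K * K * K * (ee (1/12) * ee (1/12) * ee (1/12))"
    using k2 by (simp add: mult_ac)
  also have "\<dots> = (S * S * ee (1/4)) * S * (ee (1/24) * ee (1/24) * ee (1/24))"
    unfolding K by (simp add: mult_ac flip: ee_add)
  also have "\<dots> = S * ee (1/8)" unfolding S2 by (simp flip: ee_add)
  finally have "S * ee (1/8) = 1" ..
  then have "S = 1 / ee (1/8)" by (simp add: field_simps)
  then show ?thesis using ee_minus[of "1/8"] by (simp add: S_def inverse_eq_divide)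
qed

text \<open>The weight is a parameter because one multiplier serves the theta series in weight 1/2
  and the Hecke image in weight 5/2.\<close>

definition transforms :: "complex \<Rightarrow> (complex \<Rightarrow> complex) \<Rightarrow> int \<Rightarrow> int \<Rightarrow> int \<Rightarrow> int \<Rightarrow> bool" where
  "transforms k G a b c d \<longleftrightarrow> a * d - b * c = 1 \<and> (\<forall>z\<in>upper_half_plane.
     G (moebius a b c d z) = eta_multiplier a b c d * jfac c d z powr k * G z)"

lemma transforms_mult:
  assumes k: "k = 1/2 \<or> k = 5/2" and 1: "transforms k G a b c d" and 2: "transforms k G a' b' c' d'"
  shows "transforms k G (a * a' + b * c') (a * b' + b * d') (c * a' + d * c') (c * b' + d * d')"
  unfolding transforms_def
proof (intro conjI ballI)
  have det: "a * d - b * c = 1" "a' * d' - b' * c' = 1" using 1 2 by (auto simp: transforms_def)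
  show det'': "(a * a' + b * c') * (c * b' + d * d') - (a * b' + b * d') * (c * a' + d * c') = 1"
    by (rule det_mult[OF det])
  fix z assume z: "z \<in> upper_half_plane"
  define u where "u = jfac c d (moebius a' b' c' d' z)"
  define v where "v = jfac c' d' z"
  define w where "w = jfac (c * a' + d * c') (c * b' + d * d') z"
  let ?E = "eta_multiplier (a * a' + b * c') (a * b' + b * d') (c * a' + d * c') (c * b' + d * d')"
  let ?P = "eta_multiplier a b c d * eta_multiplier a' b' c' d'"
  have w: "w = u * v" unfolding u_def v_def w_def by (rule jfac_mult[OF det(2) z])
  have "w \<noteq> 0" unfolding w_def by (rule jfac_nonzero[OF z det_nonzero[OF det'']])
  then have nz: "u \<noteq> 0" "v \<noteq> 0" "w \<noteq> 0" using w by auto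
  have "?E * w powr (1/2) = ?P * (u powr (1/2) * v powr (1/2))"
    unfolding u_def v_def w_def by (rule multiplier_cocycle[OF det z])
  moreover from this have "?E * w powr (5/2) = ?P * (u powr (5/2) * v powr (5/2))"
    unfolding powr_five_halves[OF nz(1)] powr_five_halves[OF nz(2)] powr_five_halves[OF nz(3)]
    by (simp add: w power_mult_distrib mult.assoc[symmetric])
  ultimately have coc: "?E * w powr k = ?P * (u powr k * v powr k)" using k by blast
  have "G (moebius (a * a' + b * c') (a * b' + b * d') (c * a' + d * c') (c * b' + d * d') z) =
    G (moebius a b c d (moebius a' b' c' d' z))" by (simp only: moebius_mult[OF det(2) z])
  also have "\<dots> = eta_multiplier a b c d * u powr k * G (moebius a' b' c' d' z)"
    unfolding u_def using 1 moebius_upper_half_plane[OF det(2) z] by (simp add: transforms_def)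
  also have "G (moebius a' b' c' d' z) = eta_multiplier a' b' c' d' * v powr k * G z"
    unfolding v_def using 2 z by (simp add: transforms_def)
  also have "eta_multiplier a b c d * u powr k * (eta_multiplier a' b' c' d' * v powr k * G z) = ?E * w powr k * G z"
    unfolding coc by (simp only: mult_ac)
  finally show "G (moebius (a * a' + b * c') (a * b' + b * d') (c * a' + d * c') (c * b' + d * d') z) =
    ?E * jfac (c * a' + d * c') (c * b' + d * d') z powr k * G z" by (simp only: w_def)
qed

text \<open>Euclid's algorithm on the bottom row reduces every matrix to a power of \<open>T\<close> up to sign.\<close>
lemma transforms_of_generators:
  assumes k: "k = 1/2 \<or> k = 5/2"
    and T: "\<And>z n. z \<in> upper_half_plane \<Longrightarrow> G (z + of_int n) = ee (of_int n / 24) * G z"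
    and S: "\<And>z. z \<in> upper_half_plane \<Longrightarrow> G (-1 / z) = ee (-1/8) * z powr k * G z"
    and det: "a * d - b * c = 1"
  shows "transforms k G a b c d"
proof -
  have tT: "transforms k G 1 n 0 1" for n
    using T by (simp add: transforms_def moebius_def multiplier_T)
  have tS: "transforms k G 0 (-1) 1 0"
    using S by (simp add: transforms_def moebius_def multiplier_S)
  note mult = transforms_mult[OF k]
  have tN: "transforms k G (-1) 0 0 (-1)" using mult[OF tS tS] by simp
  show ?thesis using det
  proof (induction "nat \<bar>c\<bar>" arbitrary: a b c d rule: less_induct)
    case less
    show ?case
    proof (cases "c = 0")
      case True
      then have "a * d = 1" using less.prems by simp
      then consider "a = 1" "d = 1" | "a = -1" "d = -1" by (auto simp: zmult_eq_1_iff)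
      then show ?thesis
      proof cases
        case 1
        then show ?thesis using tT True by simp
      next
        case 2
        then show ?thesis using mult[OF tN tT[of "-b"]] True by simp
      qed
    next
      case False
      define q r where "q = d div c" and "r = d mod c"
      have d: "d = c * q + r" by (simp add: q_def r_def)
      \<comment> \<open>With M the given matrix this one is M T^(-q) S. Multiplying by S three times
        and by T^q restores M, since S^3 is the inverse of S.\<close>
      have "transforms k G (b - q * a) (- a) r (- c)"
      proof (rule less.hyps)
        show "nat \<bar>r\<bar> < nat \<bar>c\<bar>" using abs_mod_less[OF False, of d] by (simp add: r_def)
        show "(b - q * a) * (- c) - (- a) * r = 1" using less.prems by (simp add: d algebra_simps)
      qed
      from mult[OF mult[OF mult[OF mult[OF this tS] tS] tS] tT[of q]]
      show ?thesis by (simp add: d algebra_simps)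
    qed
  qed
qed

text \<open>On the line Re z = 24 w/c the automorphy factor cz - 24w equals i c y, whose square root
  is explicit. Comparing the abstract law of the theta series with
  \<open>theta12_modular_line\<close>, at a point where it does not vanish, solves for the
  multiplier.\<close>

lemma multiplier_gauss_sum:
  assumes c: "c > 0" "coprime 12 c" and bc: "b * c = -1 - 576 * u * w"
  shows "eta_multiplier (24 * u) b c (-24 * w) * of_int (chi12 c) * gauss_sum w c * ee (1/8) = of_real (sqrt (of_int c))"
proof -
  have det: "(24 * u) * (-24 * w) - b * c = 1" using bc by simp
  have tr: "transforms (1/2) theta12 (24 * u) b c (-24 * w)"
    by (rule transforms_of_generators[OF _ _ _ det]) (use theta12_translate theta12_S in auto)
  have uw: "[576 * u * w = -1] (mod c)" unfolding cong_iff_dvd_diff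
  proof (rule dvdI[of _ _ "-b"])
    show "576 * u * w - -1 = c * - b" using bc by (simp add: mult.commute)
  qed
  obtain y where y: "y > 0" "theta12 (Complex (24 * of_int w / of_int c) y) \<noteq> 0"
    using theta12_nonzero_on_line by blast
  define z where "z = Complex (24 * of_int w / of_int c) y"
  have z: "z \<in> upper_half_plane" using y by (simp add: z_def upper_half_plane_iff)
  have j: "jfac c (-24 * w) z = Complex 0 (of_int c * y)" using c by (simp add: z_def complex_eq_iff)
  have cb: "of_int b = (-1 - 576 * of_int u * of_int w) / (of_int c :: real)"
  proof -
    have "real_of_int (b * c) = of_int (-1 - 576 * u * w)" by (simp only: bc)
    then show ?thesis using c by (simp add: field_simps)
  qed
  have "jfac (24 * u) b z = Complex (24 * of_int u / of_int c) (1 / ((of_int c)\<^sup>2 * y)) * Complex 0 (of_int c * y)"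
    using c y by (simp add: z_def complex_eq_iff cb field_simps power2_eq_square)
  moreover have "Complex 0 (of_int c * y) \<noteq> 0" using c y by (simp add: complex_eq_iff)
  ultimately have mz: "moebius (24 * u) b c (-24 * w) z = Complex (24 * of_int u / of_int c) (1 / ((of_int c)\<^sup>2 * y))"
    unfolding moebius_def j by simp
  have cy: "of_int c * y > 0" using c y by simp
  have cancel: "1 = K * M" if "T = K * (M * T)" "T \<noteq> 0" for T K M :: complex
    using that by (metis mult.assoc mult_cancel_right1)
  have "theta12 z = of_int (chi12 c) * gauss_sum w c / of_real (of_int c * sqrt y) * theta12 (moebius (24 * u) b c (-24 * w) z)"
    unfolding mz unfolding z_def by (rule theta12_modular_line[OF c uw y(1)])
  also have "theta12 (moebius (24 * u) b c (-24 * w) z) =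
    eta_multiplier (24 * u) b c (-24 * w) * (of_real (sqrt (of_int c * y)) * ee (1/8)) * theta12 z"
    using tr z unfolding transforms_def imaginary_powr_half[OF cy, symmetric] j[symmetric] by blast
  finally have "1 = of_int (chi12 c) * gauss_sum w c / of_real (of_int c * sqrt y) *
    (eta_multiplier (24 * u) b c (-24 * w) * (of_real (sqrt (of_int c * y)) * ee (1/8)))"
    using y(2) cancel[of "theta12 z"] unfolding z_def[symmetric] by blast
  also have "\<dots> = (eta_multiplier (24 * u) b c (-24 * w) * of_int (chi12 c) * gauss_sum w c * ee (1/8)) *
    of_real (sqrt (of_int c * y) / (of_int c * sqrt y))" by (simp add: field_simps)
  also have "sqrt (of_int c * y) / (of_int c * sqrt y) = 1 / sqrt (of_int c)"
    using c y by (simp add: real_sqrt_mult field_simps)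
  finally show ?thesis using c by (simp add: field_simps)
qed

end

section \<open>Hecke operators as averages\<close>

definition res24 :: "int set" where
  "res24 = {n. [n = 1] (mod 24)}"

lemma integral_ee_24:
  "integral {0..24} (\<lambda>x. ee (of_int m * x / 24)) = (if m = 0 then 24 else 0)"
proof (cases "m = 0")
  case True
  then show ?thesis by (simp add: scaleR_conv_of_real)
next
  case False
  define c where "c = complex_of_real (2 * pi * (of_int m / 24)) * \<i>"
  have c: "c \<noteq> 0" using False by (simp add: c_def)
  have "((\<lambda>x. c * ee (of_int m / 24 * x)) has_integral (ee (of_int m / 24 * 24) - ee (of_int m / 24 * 0))) {0..24}"
    unfolding c_def by (intro fundamental_theorem_of_calculus ee_has_vector_derivative) auto
  then have "((\<lambda>x. c * ee (of_int m / 24 * x)) has_integral 0) {0..24}" by simp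
  from has_integral_mult_right[OF this, of "inverse c"] show ?thesis
    using c False by (simp add: mult.assoc[symmetric] integral_unique)
qed

text \<open>The case x = 0 of the expansion already gives absolute summability of the coefficients.
  This is a majorant independent of x, so integration over the period may be done term by
  term.\<close>

lemma fourier_coeff_eq:
  fixes A :: "int set"
  assumes f: "\<And>x. ((\<lambda>n. b n * ee (of_int n * x / 24)) has_sum f (Complex x y)) A" and m: "m \<in> A"
  shows "fourier_coeff f m y = b m"
proof -
  define h where "h n x = b n * ee (of_int n * x / 24) * ee (- of_int m * x / 24)" for n x
  have "(\<lambda>n. b n) summable_on A" using f[of 0] by (auto simp: has_sum_imp_summable)
  then have M: "(\<lambda>n. norm (b n)) summable_on A" by (simp add: summable_on_iff_abs_summable_on_complex)
  have "((\<lambda>n. integral {0..24} (h n)) has_sum integral {0..24} (\<lambda>x. \<Sum>\<^sub>\<infinity>n\<in>A. h n x)) A"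
  proof (rule has_sum_integral[OF _ M])
    show "continuous_on {0..24} (h n)" for n unfolding h_def by (intro continuous_intros) auto
    show "norm (h n x) \<le> norm (b n)" for n x by (simp add: h_def norm_mult)
  qed
  moreover have "(\<Sum>\<^sub>\<infinity>n\<in>A. h n x) = f (Complex x y) * exp (- 2 * of_real pi * \<i> * of_int m * of_real x / 24)" for x
    unfolding h_def infsum_cmult_left' infsumI[OF f] by (simp add: ee_eq_exp mult_ac)
  ultimately have 1: "((\<lambda>n. integral {0..24} (h n)) has_sum (24 * fourier_coeff f m y)) A"
    by (simp add: fourier_coeff_def)
  have h: "h n = (\<lambda>x. b n * ee (of_int (n - m) * x / 24))" for n
  proof
    fix x :: real
    have "of_int n * x / 24 + - of_int m * x / 24 = of_int (n - m) * x / 24" by (simp add: field_simps)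
    then show "h n x = b n * ee (of_int (n - m) * x / 24)" by (simp only: h_def mult.assoc ee_add[symmetric])
  qed
  have int: "integral {0..24} (h n) = b n * (if n = m then 24 else 0)" for n
    unfolding h integral_mult_right integral_ee_24 by simp
  have "((\<lambda>n. integral {0..24} (h n)) has_sum (\<Sum>n\<in>{m}. integral {0..24} (h n))) A"
    unfolding int by (rule has_sum_finite_neutralI[OF _ _ _ refl]) (use m in auto)
  from has_sum_unique[OF this 1] show ?thesis by (simp add: int)
qed

text \<open>Such a prime does not divide 3, so \<open>Legendre_3\<close> shows that
  \<open>chi12\<close> does not vanish at it.\<close>

lemma int_prime_square_mod_24:
  assumes "prime l" "5 \<le> (l::nat)"
  shows "[(int l)\<^sup>2 = 1] (mod 24)"
proof (rule chi12_square)
  have "Legendre 3 (int l) \<noteq> 0"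
    using assms by (auto simp: Legendre_eq_0_iff dest: zdvd_imp_le)
  then show "chi12 (int l) \<noteq> 0" using Legendre_3[OF assms] by simp
qed

lemma image_square_res24:
  assumes L: "[L\<^sup>2 = 1] (mod 24)"
  shows "(\<lambda>n. L\<^sup>2 * n) ` res24 = {n \<in> res24. L\<^sup>2 dvd n}"
proof -
  have "[L\<^sup>2 * n = 1] (mod 24) \<longleftrightarrow> [n = 1] (mod 24)" for n
    using cong_scalar_right[OF L, of n] by (simp add: cong_def)
  then show ?thesis by (auto simp: res24_def image_iff elim!: dvdE)
qed

lemma res24_div_square:
  assumes "[L\<^sup>2 = 1] (mod 24)" "L\<^sup>2 dvd n" "n \<in> res24"
  shows "n div L\<^sup>2 \<in> res24"
proof -
  have "n \<in> (\<lambda>n. L\<^sup>2 * n) ` res24" using image_square_res24[OF assms(1)] assms by blast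
  then obtain k where "n = L\<^sup>2 * k" "k \<in> res24" by blast
  moreover have "L \<noteq> 0" using assms(1) by (auto simp: cong_def)
  ultimately show ?thesis by simp
qed

text \<open>
  Averaging over \<open>v\<close> modulo \<open>\<ell>\<^sup>2\<close> selects the coefficients with index divisible by \<open>\<ell>\<^sup>2\<close>, and the twisted
  average modulo \<open>\<ell>\<close> multiplies the coefficient of index \<open>n\<close> by \<open>(n/\<ell>)\<close> times a Gauss sum.
\<close>
definition hecke_sum :: "nat \<Rightarrow> (complex \<Rightarrow> complex) \<Rightarrow> complex \<Rightarrow> complex" where
  "hecke_sum l f z =
    1 / of_nat l ^ 2 * (\<Sum>v\<in>{0..<(int l)\<^sup>2}. f ((z + 24 * of_int v) / of_nat l ^ 2)) +
    of_nat l * of_int (Legendre 3 (int l)) / gauss_sum 1 (int l) *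
      (\<Sum>v\<in>{0..<int l}. of_int (Legendre v (int l)) * f (z + 24 * of_int v / of_nat l)) +
    of_nat l ^ 3 * f (of_nat l ^ 2 * z)"

definition hecke_coeff :: "nat \<Rightarrow> (int \<Rightarrow> real \<Rightarrow> complex) \<Rightarrow> int \<Rightarrow> real \<Rightarrow> complex" where
  "hecke_coeff l b n y = b ((int l)\<^sup>2 * n) (y / (real l)\<^sup>2) + of_nat l * of_int (Legendre (3 * n) (int l)) * b n y +
    of_nat l ^ 3 * (if (int l)\<^sup>2 dvd n then b (n div (int l)\<^sup>2) ((real l)\<^sup>2 * y) else 0)"

lemma gauss_sum_nonzero:
  assumes "prime l" "2 < (l::nat)"
  shows "gauss_sum 1 (int l) \<noteq> 0"
  using gauss_sum_squared[OF assms] assms by auto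

lemma hecke_sum_has_sum:
  assumes l: "prime l" "5 \<le> l"
    and F: "\<And>x y. y > 0 \<Longrightarrow> ((\<lambda>n. b n y * ee (of_int n * x / 24)) has_sum F (Complex x y)) res24"
    and y: "y > 0"
  shows "((\<lambda>n. hecke_coeff l b n y * ee (of_int n * x / 24)) has_sum hecke_sum l F (Complex x y)) res24"
proof -
  define L where "L = int l"
  have L0: "L > 0" "L\<^sup>2 > 0" and l2: "2 < l" using l by (auto simp: L_def prime_gt_0_nat)
  have rl: "real l > 0" using l by (auto simp: prime_gt_0_nat)
  have L24: "[L\<^sup>2 = 1] (mod 24)" unfolding L_def by (rule int_prime_square_mod_24[OF l])
  have lL: "of_nat l = (of_int L :: complex)" "real l = of_int L" by (simp_all add: L_def)
  have inj: "inj_on (\<lambda>n. L\<^sup>2 * n) res24" using L0 by (auto simp: inj_on_def)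
  \<comment> \<open>Only indices divisible by L^2 survive the average. Dividing them by L^2 keeps
    them in the class 1 modulo 24, because L^2 lies in that class.\<close>
  have U: "((\<lambda>n. b (L\<^sup>2 * n) (y / (of_int L)\<^sup>2) * ee (of_int n * x / 24)) has_sum
    (1 / of_int L ^ 2 * (\<Sum>v\<in>{0..<L\<^sup>2}. F ((Complex x y + 24 * of_int v) / of_int L ^ 2)))) res24"
  proof -
    define Y where "Y = y / (of_int L)\<^sup>2"
    have Y: "Y > 0" using y L0 by (simp add: Y_def)
    have "((\<lambda>n. b n Y * ee (of_int n * ((x + 24 * of_int v) / (of_int L)\<^sup>2) / 24)) has_sum F ((Complex x y + 24 * of_int v) / of_int L ^ 2)) res24" for v
    proof -
      have "(Complex x y + 24 * of_int v) / of_int L ^ 2 = Complex ((x + 24 * of_int v) / (of_int L)\<^sup>2) Y"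
      proof -
        have "of_int L ^ 2 = complex_of_real ((of_int L)\<^sup>2)" by simp
        then show ?thesis by (simp only: Y_def) (simp add: complex_eq_iff Re_divide_of_real Im_divide_of_real del: of_real_power)
      qed
      then show ?thesis using F[OF Y, of "(x + 24 * of_int v) / (of_int L)\<^sup>2"] by (simp only:)
    qed
    then have "((\<lambda>n. 1 / of_int L ^ 2 * (\<Sum>v\<in>{0..<L\<^sup>2}. b n Y * ee (of_int n * ((x + 24 * of_int v) / (of_int L)\<^sup>2) / 24))) has_sum
      1 / of_int L ^ 2 * (\<Sum>v\<in>{0..<L\<^sup>2}. F ((Complex x y + 24 * of_int v) / of_int L ^ 2))) res24"
      by (intro has_sum_cmult_right has_sum_finite_sum) auto
    moreover have "1 / of_int L ^ 2 * (\<Sum>v\<in>{0..<L\<^sup>2}. b n Y * ee (of_int n * ((x + 24 * of_int v) / (of_int L)\<^sup>2) / 24)) =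
      (if L\<^sup>2 dvd n then b n Y * ee (of_int n * x / (of_int L)\<^sup>2 / 24) else 0)" for n
    proof -
      have "of_int n * ((x + 24 * of_int v) / (of_int L)\<^sup>2) / 24 = of_int n * x / (of_int L)\<^sup>2 / 24 + of_int (n * v) / of_int (L\<^sup>2)" for v
        using L0 by (simp add: field_simps)
      then have "(\<Sum>v\<in>{0..<L\<^sup>2}. b n Y * ee (of_int n * ((x + 24 * of_int v) / (of_int L)\<^sup>2) / 24)) =
        b n Y * ee (of_int n * x / (of_int L)\<^sup>2 / 24) * (\<Sum>v\<in>{0..<L\<^sup>2}. ee (of_int (n * v) / of_int (L\<^sup>2)))"
        by (simp only: ee_add sum_distrib_left mult.assoc)
      then show ?thesis unfolding sum_ee_residues[OF L0(2)] using L0 by simp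
    qed
    ultimately have "((\<lambda>n. if L\<^sup>2 dvd n then b n Y * ee (of_int n * x / (of_int L)\<^sup>2 / 24) else 0) has_sum
      1 / of_int L ^ 2 * (\<Sum>v\<in>{0..<L\<^sup>2}. F ((Complex x y + 24 * of_int v) / of_int L ^ 2))) res24"
      by (simp only:)
    also have "?this \<longleftrightarrow> ((\<lambda>n. b n Y * ee (of_int n * x / (of_int L)\<^sup>2 / 24)) has_sum
      1 / of_int L ^ 2 * (\<Sum>v\<in>{0..<L\<^sup>2}. F ((Complex x y + 24 * of_int v) / of_int L ^ 2))) {n \<in> res24. L\<^sup>2 dvd n}"
      by (rule has_sum_cong_neutral) auto
    also have "\<dots> \<longleftrightarrow> ((\<lambda>n. b (L\<^sup>2 * n) Y * ee (of_int (L\<^sup>2 * n) * x / (of_int L)\<^sup>2 / 24)) has_sum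
      1 / of_int L ^ 2 * (\<Sum>v\<in>{0..<L\<^sup>2}. F ((Complex x y + 24 * of_int v) / of_int L ^ 2))) res24"
      unfolding image_square_res24[OF L24, symmetric] has_sum_reindex[OF inj] o_def ..
    also have "(\<lambda>n. of_int (L\<^sup>2 * n) * x / (of_int L)\<^sup>2 / 24) = (\<lambda>n. of_int n * x / 24)"
      using L0 by (simp add: fun_eq_iff)
    finally show ?thesis using L0 by (simp add: Y_def)
  qed
  \<comment> \<open>The twisted sum produces (n/l) times the Gauss sum G; the prefactor l (3/l) / G
    completes this to l (3n/l).\<close>
  have M: "((\<lambda>n. of_int L * of_int (Legendre (3 * n) L) * b n y * ee (of_int n * x / 24)) has_sum
    (of_int L * of_int (Legendre 3 L) / gauss_sum 1 L *
      (\<Sum>v\<in>{0..<L}. of_int (Legendre v L) * F (Complex x y + 24 * of_int v / of_int L)))) res24"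
  proof -
    have "((\<lambda>n. b n y * ee (of_int n * (x + 24 * of_int v / of_int L) / 24)) has_sum F (Complex x y + 24 * of_int v / of_int L)) res24" for v
    proof -
      have "Complex x y + 24 * of_int v / of_int L = Complex (x + 24 * of_int v / of_int L) y"
      proof -
        have "24 * of_int v / of_int L = complex_of_real (24 * of_int v / of_int L)" by simp
        then show ?thesis by (simp only:) (simp add: complex_eq_iff)
      qed
      then show ?thesis using F[OF y, of "x + 24 * of_int v / of_int L"] by (simp only:)
    qed
    then have "((\<lambda>n. of_int L * of_int (Legendre 3 L) / gauss_sum 1 L *
       (\<Sum>v\<in>{0..<L}. of_int (Legendre v L) * (b n y * ee (of_int n * (x + 24 * of_int v / of_int L) / 24)))) has_sum
      of_int L * of_int (Legendre 3 L) / gauss_sum 1 L *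
      (\<Sum>v\<in>{0..<L}. of_int (Legendre v L) * F (Complex x y + 24 * of_int v / of_int L))) res24"
      by (intro has_sum_cmult_right has_sum_finite_sum) auto
    moreover have "of_int L * of_int (Legendre 3 L) / gauss_sum 1 L *
       (\<Sum>v\<in>{0..<L}. of_int (Legendre v L) * (b n y * ee (of_int n * (x + 24 * of_int v / of_int L) / 24))) =
       of_int L * of_int (Legendre (3 * n) L) * b n y * ee (of_int n * x / 24)" for n
    proof -
      have "of_int n * (x + 24 * of_int v / of_int L) / 24 = of_int n * x / 24 + of_int (n * v) / of_int L" for v
        using L0 by (simp add: field_simps)
      then have "(\<Sum>v\<in>{0..<L}. of_int (Legendre v L) * (b n y * ee (of_int n * (x + 24 * of_int v / of_int L) / 24))) =
        b n y * ee (of_int n * x / 24) * (\<Sum>v\<in>{0..<L}. of_int (Legendre v L) * ee (of_int (n * v) / of_int L))"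
        by (simp only: ee_add sum_distrib_left mult_ac)
      also have "(\<Sum>v\<in>{0..<L}. of_int (Legendre v L) * ee (of_int (n * v) / of_int L)) = of_int (Legendre n L) * gauss_sum 1 L"
        unfolding L_def by (rule twisted_sum_eq[OF l(1) l2])
      finally show ?thesis
        using gauss_sum_nonzero[OF l(1) l2] by (simp add: L_def Legendre_mult[OF l(1) l2])
    qed
    ultimately show ?thesis by (simp only:)
  qed
  have D: "((\<lambda>n. of_int L ^ 3 * (if L\<^sup>2 dvd n then b (n div L\<^sup>2) ((of_int L)\<^sup>2 * y) else 0) * ee (of_int n * x / 24)) has_sum
    (of_int L ^ 3 * F (of_int L ^ 2 * Complex x y))) res24"
  proof -
    define Y where "Y = (of_int L)\<^sup>2 * y"
    have Y: "Y > 0" using y L0 by (simp add: Y_def)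
    define g where "g n = (if L\<^sup>2 dvd n then b (n div L\<^sup>2) Y else 0) * ee (of_int n * x / 24)" for n
    have "of_int L ^ 2 * Complex x y = Complex ((of_int L)\<^sup>2 * x) Y"
    proof -
      have "of_int L ^ 2 = complex_of_real ((of_int L)\<^sup>2)" by simp
      then show ?thesis by (simp only: Y_def) (simp add: complex_eq_iff del: of_real_power)
    qed
    then have "((\<lambda>n. b n Y * ee (of_int n * ((of_int L)\<^sup>2 * x) / 24)) has_sum F (of_int L ^ 2 * Complex x y)) res24"
      using F[OF Y, of "(of_int L)\<^sup>2 * x"] by (simp only:)
    moreover have "b n Y * ee (of_int n * ((of_int L)\<^sup>2 * x) / 24) = g (L\<^sup>2 * n)" for n
      using L0 by (simp add: g_def mult_ac)
    ultimately have "((\<lambda>n. g (L\<^sup>2 * n)) has_sum F (of_int L ^ 2 * Complex x y)) res24" by simp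
    then have "(g has_sum F (of_int L ^ 2 * Complex x y)) {n \<in> res24. L\<^sup>2 dvd n}"
      unfolding image_square_res24[OF L24, symmetric] has_sum_reindex[OF inj] o_def .
    also have "?this \<longleftrightarrow> (g has_sum F (of_int L ^ 2 * Complex x y)) res24"
      by (rule has_sum_cong_neutral) (auto simp: g_def)
    finally have "((\<lambda>n. of_int L ^ 3 * g n) has_sum (of_int L ^ 3 * F (of_int L ^ 2 * Complex x y))) res24"
      by (rule has_sum_cmult_right)
    then show ?thesis by (simp only: g_def Y_def mult.assoc)
  qed
  show ?thesis
    using has_sum_add[OF has_sum_add[OF U M] D]
    unfolding hecke_coeff_def hecke_sum_def lL L_def[symmetric] by (simp only: distrib_right mult.assoc)
qed

lemma hecke_eq_hecke_sum:
  assumes l: "prime l" "5 \<le> l"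
    and f: "\<And>x y. y > 0 \<Longrightarrow> ((\<lambda>n. b n y * ee (of_int n * x / 24)) has_sum f (Complex x y)) res24"
    and z: "Im z > 0"
  shows "hecke l f z = hecke_sum l f z"
proof -
  have L24: "[(int l)\<^sup>2 = 1] (mod 24)" by (rule int_prime_square_mod_24[OF l])
  have rl: "real l > 0" using l by (auto simp: prime_gt_0_nat)
  have fc: "fourier_coeff f n y = b n y" if "n \<in> res24" "y > 0" for n y
    using fourier_coeff_eq[OF f that(1)] that(2) by blast
  have "hecke l f z = (\<Sum>\<^sub>\<infinity>n\<in>res24. hecke_coeff l b n (Im z) * ee (of_int n * Re z / 24))"
    unfolding hecke_def res24_def[symmetric]
  proof (rule infsum_cong)
    fix n assume n: "n \<in> res24"
    have "(int l)\<^sup>2 * n \<in> res24" using image_square_res24[OF L24] n by blast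
    moreover have "n div (int l)\<^sup>2 \<in> res24" if "(int l)\<^sup>2 dvd n" using res24_div_square[OF L24 that n] .
    moreover have "exp (2 * of_real pi * \<i> * of_int n * of_real (Re z) / 24) = ee (of_int n * Re z / 24)"
      by (simp add: ee_eq_exp mult_ac)
    ultimately show "(fourier_coeff f ((int l)\<^sup>2 * n) (Im z / (real l)\<^sup>2)
      + of_nat l * of_int (Legendre (3 * n) (int l)) * fourier_coeff f n (Im z)
      + of_nat l ^ 3 * (if (int l)\<^sup>2 dvd n then fourier_coeff f (n div (int l)\<^sup>2) ((real l)\<^sup>2 * Im z) else 0))
     * exp (2 * of_real pi * \<i> * of_int n * of_real (Re z) / 24) = hecke_coeff l b n (Im z) * ee (of_int n * Re z / 24)"
      using z rl n by (simp add: hecke_coeff_def fc)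
  qed
  also have "\<dots> = hecke_sum l f z"
    using infsumI[OF hecke_sum_has_sum[OF l f z, of "Re z"]] by simp
  finally show ?thesis .
qed

section \<open>Hecke operators and the inversion\<close>

lemma coprime_12_prime:
  assumes "prime l" "5 \<le> (l::nat)" shows "coprime 12 (int l)"
proof -
  have "\<not> l dvd 12"
  proof
    assume "l dvd 12"
    then have "l dvd 2 * 2 * 3" by simp
    then have "l dvd 2 \<or> l dvd 3" using assms(1) by (metis prime_dvd_multD)
    then show False using assms(2) by (auto dest: dvd_imp_le)
  qed
  then have "coprime l 12" using assms(1) by (rule prime_imp_coprime[rotated])
  then have "coprime (int 12) (int l)" by (simp only: coprime_int_iff coprime_commute)
  then show ?thesis by simp
qed

text \<open>A positive factor does not change the argument, so the principal branch is
  multiplicative here.\<close>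

lemma powr_five_halves_scale:
  fixes r :: real and z :: complex
  assumes "r > 0"
  shows "(of_real r * z) powr (5/2) = of_real (sqrt r * r\<^sup>2) * z powr (5/2)"
proof -
  have "(of_real r * z) powr (5/2) = of_real r powr (5/2) * z powr (5/2)"
    using assms by (intro powr_times_real_left) auto
  also have "complex_of_real r powr (5/2) = of_real (sqrt r * r\<^sup>2)"
  proof -
    have "complex_of_real r powr (1/2) = complex_of_real r powr of_real (1/2)" by simp
    also have "\<dots> = of_real (r powr (1/2))" using assms by (intro powr_of_real) simp
    finally have "complex_of_real r powr (1/2) = of_real (sqrt r)" using assms by (simp add: powr_half_sqrt)
    then show ?thesis using powr_five_halves[of "of_real r"] assms by simp
  qed
  finally show ?thesis .
qed

text \<open>An involution on the units modulo \<open>c\<close>; unspecified elsewhere.\<close>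
definition dual_residue :: "int \<Rightarrow> int \<Rightarrow> int" where
  "dual_residue c v = (SOME w. w \<in> {0..<c} \<and> [576 * v * w = -1] (mod c))"

lemma coprime_576:
  assumes "coprime 12 (c::int)" shows "coprime 576 c" "coprime 24 c"
proof -
  have "coprime 4 c" "coprime 2 c"
    using coprime_divisors[of 4 12 c c] coprime_divisors[of 2 12 c c] assms by simp_all
  then have "coprime (12 * (12 * 4)) c" "coprime (12 * 2) c"
    unfolding coprime_mult_left_iff using assms by blast+
  then show "coprime 576 c" "coprime 24 c" by simp_all
qed

lemma dual_residue:
  assumes "c > 0" "coprime 12 c" "coprime v c"
  shows "dual_residue c v \<in> {0..<c}" "[576 * v * dual_residue c v = -1] (mod c)"
proof -
  have "coprime (576 * v) c" using coprime_576[OF assms(2)] assms(3) by simp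
  then obtain x where x: "[576 * v * x = 1] (mod c)" using cong_solve_coprime_int by blast
  define w where "w = (- x) mod c"
  have "[576 * v * w = 576 * v * (- x)] (mod c)" unfolding w_def by (intro cong_scalar_left) simp
  also have "576 * v * (- x) = - (576 * v * x)" by simp
  also have "[\<dots> = -1] (mod c)" using x by (simp add: cong_minus_minus_iff)
  finally have "w \<in> {0..<c} \<and> [576 * v * w = -1] (mod c)" using assms(1) by (simp add: w_def)
  then have "dual_residue c v \<in> {0..<c} \<and> [576 * v * dual_residue c v = -1] (mod c)"
    unfolding dual_residue_def by (rule someI)
  then show "dual_residue c v \<in> {0..<c}" "[576 * v * dual_residue c v = -1] (mod c)" by blast+
qed

lemma dual_residue_coprime:
  fixes c v w :: int
  assumes "[576 * v * w = -1] (mod c)" shows "coprime w c"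
proof -
  have "c dvd - (576 * v * w - -1)" using assms by (simp only: cong_iff_dvd_diff dvd_minus_iff)
  also have "- (576 * v * w - -1) = w * (- 576 * v) - 1" by simp
  finally have "[w * (- 576 * v) = 1] (mod c)" by (simp only: cong_iff_dvd_diff)
  then show ?thesis using coprime_iff_invertible_int by blast
qed

lemma sum_dual_residue:
  fixes g :: "int \<Rightarrow> 'a::comm_monoid_add"
  assumes c: "c > 0" "coprime 12 c"
  shows "(\<Sum>v\<in>{v\<in>{0..<c}. coprime v c}. g (dual_residue c v)) = (\<Sum>v\<in>{v\<in>{0..<c}. coprime v c}. g v)"
proof (rule sum.reindex_bij_betw)
  let ?U = "{v\<in>{0..<c}. coprime v c}"
  have mem: "dual_residue c v \<in> ?U" if "v \<in> ?U" for v
    using that dual_residue[OF c, of v] dual_residue_coprime[OF dual_residue(2)[OF c, of v]] by blast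
  have invol: "dual_residue c (dual_residue c v) = v" if v: "v \<in> ?U" for v
  proof -
    define w where "w = dual_residue c v"
    have w: "w \<in> ?U" unfolding w_def by (rule mem[OF v])
    have "[576 * w * dual_residue c w = -1] (mod c)" using w dual_residue(2)[OF c] by blast
    moreover have "[576 * w * v = -1] (mod c)"
      using v dual_residue(2)[OF c, of v] by (simp add: w_def mult_ac)
    ultimately have *: "[576 * w * dual_residue c w = 576 * w * v] (mod c)" by (metis cong_sym cong_trans)
    have "coprime (576 * w) c" using coprime_576[OF c(2)] w by simp
    with * have "[dual_residue c w = v] (mod c)" by (simp add: cong_mult_lcancel)
    moreover have "dual_residue c w \<in> {0..<c}" "v \<in> {0..<c}" using mem[OF w] v by auto
    ultimately show ?thesis unfolding w_def by (auto simp: cong_def)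
  qed
  show "bij_betw (dual_residue c) ?U ?U"
    by (rule bij_betw_byWitness[where f' = "dual_residue c"]) (use mem invol in auto)
qed

lemma sum_units_split:
  fixes g :: "int \<Rightarrow> 'a::comm_monoid_add"
  assumes "prime (l::int)"
  shows "(\<Sum>v\<in>{0..<l}. g v) = g 0 + (\<Sum>v\<in>{v\<in>{0..<l}. coprime v l}. g v)"
proof -
  have l: "l > 1" using assms by (rule prime_gt_1_int)
  have "coprime v l \<longleftrightarrow> v \<noteq> 0" if "v \<in> {0..<l}" for v
  proof
    assume "coprime v l" then show "v \<noteq> 0" using l by auto
  next
    assume "v \<noteq> 0"
    then have "\<not> l dvd v" using that zdvd_imp_le by fastforce
    then show "coprime v l" using prime_imp_coprime[OF assms, of v] by (metis coprime_commute)
  qed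
  then have "{0..<l} = insert 0 {v\<in>{0..<l}. coprime v l}" "0 \<notin> {v\<in>{0..<l}. coprime v l}" using l by auto
  then show ?thesis by (metis (no_types, lifting) finite_atLeastLessThan_int finite_insert sum.insert)
qed

text \<open>Separates shifts that the inversion treats differently; \<open>sum_units_split\<close>
  further isolates 0 among the multiples of l.\<close>

lemma sum_units_split_square:
  fixes g :: "int \<Rightarrow> 'a::comm_monoid_add"
  assumes "prime (l::int)"
  shows "(\<Sum>v\<in>{0..<l\<^sup>2}. g v) = (\<Sum>v\<in>{v\<in>{0..<l\<^sup>2}. coprime v (l\<^sup>2)}. g v) + (\<Sum>u\<in>{0..<l}. g (l * u))"
proof -
  have l: "l > 1" using assms by (rule prime_gt_1_int)
  have cop: "coprime v (l\<^sup>2) \<longleftrightarrow> \<not> l dvd v" for v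
  proof
    assume "coprime v (l\<^sup>2)"
    then have "coprime v l" by simp
    then show "\<not> l dvd v" using l by (metis coprime_absorb_right coprime_commute not_prime_unit assms)
  next
    assume "\<not> l dvd v"
    then have "coprime v l" using prime_imp_coprime[OF assms, of v] by (metis coprime_commute)
    then show "coprime v (l\<^sup>2)" by simp
  qed
  have fin: "finite {v\<in>{0..<l\<^sup>2}. R v}" for R
    by (rule finite_subset[of _ "{0..<l\<^sup>2}"]) auto
  have img: "{v\<in>{0..<l\<^sup>2}. \<not> coprime v (l\<^sup>2)} = (\<lambda>u. l * u) ` {0..<l}"
    unfolding cop using l by (auto simp: power2_eq_square zero_le_mult_iff elim!: dvdE)
  have inj: "inj_on (\<lambda>u. l * u) {0..<l}" using l by (auto simp: inj_on_def)
  have "(\<Sum>v\<in>{0..<l\<^sup>2}. g v) = (\<Sum>v\<in>{v\<in>{0..<l\<^sup>2}. coprime v (l\<^sup>2)} \<union> {v\<in>{0..<l\<^sup>2}. \<not> coprime v (l\<^sup>2)}. g v)"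
    by (rule sum.cong) auto
  also have "\<dots> = (\<Sum>v\<in>{v\<in>{0..<l\<^sup>2}. coprime v (l\<^sup>2)}. g v) + (\<Sum>v\<in>{v\<in>{0..<l\<^sup>2}. \<not> coprime v (l\<^sup>2)}. g v)"
    by (rule sum.union_disjoint[OF fin fin]) auto
  finally show ?thesis unfolding img sum.reindex[OF inj] o_def .
qed

text \<open>576 is the square of 24, a unit modulo l, so v w agrees with -1 up to a square.\<close>

lemma Legendre_dual:
  assumes l: "prime l" "5 \<le> (l::nat)" and vw: "[576 * v * w = -1] (mod int l)"
  shows "Legendre v (int l) * Legendre w (int l) = Legendre (-1) (int l)"
proof -
  have l2: "2 < l" using l by simp
  note mult = Legendre_mult[OF l(1) l2]
  have "\<not> int l dvd 24"
  proof
    assume "int l dvd 24"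
    moreover have "coprime (int l) 24"
      using coprime_576(2)[OF coprime_12_prime[OF l]] by (metis coprime_commute)
    ultimately have "is_unit (int l)" by (metis coprime_absorb_left)
    then show False using l by simp
  qed
  then have 24: "Legendre 24 (int l) * Legendre 24 (int l) = 1" by (rule Legendre_square)
  have "Legendre (-1) (int l) = Legendre (24 * 24 * (v * w)) (int l)"
    by (rule Legendre_cong[OF cong_sym]) (use vw in \<open>simp add: mult.assoc\<close>)
  also have "\<dots> = Legendre v (int l) * Legendre w (int l)"
    unfolding mult 24 by simp
  finally show ?thesis ..
qed

context half_integral_form
begin

text \<open>For zeta = (t + 24 w)/c the automorphy factor c zeta - 24 w is t itself, so on shifted
  and rescaled arguments the matrix acts like the inversion of t.\<close>

lemma modular_shift:
  assumes c: "c > 0" and vw: "[576 * v * w = -1] (mod c)" and t: "t \<in> upper_half_plane"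
  shows "f ((24 * of_int v - 1 / t) / of_int c) =
    eta_multiplier (24 * v) ((-1 - 576 * v * w) div c) c (-24 * w) * t powr (5/2) * f ((t + 24 * of_int w) / of_int c)"
proof -
  define b where "b = (-1 - 576 * v * w) div c"
  have "c dvd 576 * v * w - -1" using vw by (simp only: cong_iff_dvd_diff)
  then have "c dvd - (576 * v * w - -1)" by (simp only: dvd_minus_iff)
  then have "c dvd -1 - 576 * v * w" by (simp add: algebra_simps)
  then have bc: "b * c = -1 - 576 * v * w" by (simp add: b_def)
  then have det: "(24 * v) * (-24 * w) - b * c = 1" by simp
  have t0: "t \<noteq> 0" using t by (auto simp: upper_half_plane_iff)
  define \<zeta> where "\<zeta> = (t + 24 * of_int w) / of_int c"
  have "Im \<zeta> = Im t / of_int c" using c by (simp add: \<zeta>_def)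
  then have z: "\<zeta> \<in> upper_half_plane" using t c by (simp add: upper_half_plane_iff)
  have j: "jfac c (-24 * w) \<zeta> = t" using c by (simp add: \<zeta>_def)
  have cb: "of_int b * of_int c = (-1 - 576 * of_int v * of_int w :: complex)"
    using arg_cong[OF bc, of "of_int :: int \<Rightarrow> complex"] by simp
  have "moebius (24 * v) b c (-24 * w) \<zeta> = (24 * of_int v * \<zeta> + of_int b) / t"
    unfolding moebius_def j by simp
  also have "24 * of_int v * \<zeta> + of_int b = (24 * of_int v * (t + 24 * of_int w) + of_int b * of_int c) / of_int c"
    using c by (simp add: \<zeta>_def field_simps)
  also have "\<dots> / t = (24 * of_int v - 1 / t) / of_int c"
    unfolding cb using t0 c by (simp add: field_simps)
  finally have "moebius (24 * v) b c (-24 * w) \<zeta> = (24 * of_int v - 1 / t) / of_int c" .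
  with modular[OF det z] show ?thesis unfolding j b_def[symmetric] \<zeta>_def[symmetric] by simp
qed

text \<open>The Gauss sum modulo l^2 is l for every admissible w and the character is 1 at l^2, so
  the value is that of the inversion.\<close>

lemma multiplier_prime_square:
  assumes l: "prime l" "5 \<le> l" and vw: "[576 * v * w = -1] (mod (int l)\<^sup>2)"
  shows "eta_multiplier (24 * v) ((-1 - 576 * v * w) div (int l)\<^sup>2) ((int l)\<^sup>2) (-24 * w) = ee (-1/8)"
proof -
  let ?b = "(-1 - 576 * v * w) div (int l)\<^sup>2"
  have l0: "(int l)\<^sup>2 > 0" using l by (simp add: prime_gt_0_nat)
  have "(int l)\<^sup>2 dvd 576 * v * w - -1" using vw by (simp only: cong_iff_dvd_diff)
  then have "(int l)\<^sup>2 dvd - (576 * v * w - -1)" by (simp only: dvd_minus_iff)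
  then have "(int l)\<^sup>2 dvd -1 - 576 * v * w" by (simp add: algebra_simps)
  then have bc: "?b * (int l)\<^sup>2 = -1 - 576 * v * w" by simp
  have cop: "coprime 12 ((int l)\<^sup>2)" using coprime_12_prime[OF l] by simp
  have chi: "chi12 ((int l)\<^sup>2) = 1"
    using int_prime_square_mod_24[OF l] chi12_cong[of "(int l)\<^sup>2" 1] cong_modulus_mult[of "(int l)\<^sup>2" 1 12 2]
    by (simp add: chi12_def)
  have "coprime w ((int l)\<^sup>2)" by (rule dual_residue_coprime[OF vw])
  then have "coprime w (int l)" by simp
  then have "\<not> int l dvd w" using l by (metis coprime_absorb_right coprime_commute not_prime_unit prime_int_nat_transfer prime_nat_int_transfer)
  then have g: "gauss_sum w ((int l)\<^sup>2) = of_int (int l)"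
    by (intro gauss_sum_prime_square) (use l in auto)
  have "eta_multiplier (24 * v) ?b ((int l)\<^sup>2) (-24 * w) * of_nat l * ee (1/8) = of_nat l"
    using multiplier_gauss_sum[OF l0 cop bc] unfolding chi g by simp
  then have "eta_multiplier (24 * v) ?b ((int l)\<^sup>2) (-24 * w) * ee (1/8) = 1"
    using l by (simp add: prime_gt_0_nat field_simps)
  then have "eta_multiplier (24 * v) ?b ((int l)\<^sup>2) (-24 * w) * (ee (1/8) * ee (-1/8)) = ee (-1/8)"
    by (simp only: mult.assoc[symmetric] mult_1_left)
  also have "ee (1/8) * ee (-1/8) = 1" by (simp flip: ee_add)
  finally show ?thesis by simp
qed

text \<open>\<open>multiplier_gauss_sum\<close> for c = l, with (12/l) = (3/l) and Gauss sum (w/l)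
  G. Legendre symbols of units have square 1, so they may change sides.\<close>

lemma multiplier_prime:
  assumes l: "prime l" "5 \<le> l" and vw: "[576 * v * w = -1] (mod int l)"
  shows "eta_multiplier (24 * v) ((-1 - 576 * v * w) div int l) (int l) (-24 * w) =
    ee (-1/8) * of_int (Legendre w (int l)) * of_int (Legendre 3 (int l)) * of_real (sqrt l) / gauss_sum 1 (int l)"
proof -
  let ?b = "(-1 - 576 * v * w) div int l"
  let ?E = "eta_multiplier (24 * v) ?b (int l) (-24 * w)"
  have l0: "int l > 0" and l2: "2 < l" using l by (simp_all add: prime_gt_0_nat)
  have "int l dvd 576 * v * w - -1" using vw by (simp only: cong_iff_dvd_diff)
  then have "int l dvd - (576 * v * w - -1)" by (simp only: dvd_minus_iff)
  then have "int l dvd -1 - 576 * v * w" by (simp add: algebra_simps)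
  then have bc: "?b * int l = -1 - 576 * v * w" by simp
  have "coprime w (int l)" by (rule dual_residue_coprime[OF vw])
  then have w: "\<not> int l dvd w" using l by (metis coprime_absorb_right coprime_commute not_prime_unit prime_int_nat_transfer prime_nat_int_transfer)
  have Lw: "of_int (Legendre w (int l)) * of_int (Legendre w (int l)) = (1::complex)"
    using arg_cong[OF Legendre_square[OF w], of "of_int :: int \<Rightarrow> complex"] by simp
  have "\<not> int l dvd 3" using l by (auto dest: zdvd_imp_le)
  then have L3: "of_int (Legendre 3 (int l)) * of_int (Legendre 3 (int l)) = (1::complex)"
    using arg_cong[OF Legendre_square, of "int l" 3 "of_int :: int \<Rightarrow> complex"] by simp
  have S: "of_real (sqrt l) = ?E * of_int (Legendre 3 (int l)) * (of_int (Legendre w (int l)) * gauss_sum 1 (int l)) * ee (1/8)"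
    using multiplier_gauss_sum[OF l0 coprime_12_prime[OF l] bc]
    unfolding Legendre_3[OF l, symmetric] gauss_sum_prime[OF l(1) l2 w] by simp
  have "of_real (sqrt l) * (of_int (Legendre w (int l)) * of_int (Legendre 3 (int l))) * ee (-1/8) =
    ?E * gauss_sum 1 (int l) * (of_int (Legendre w (int l)) * of_int (Legendre w (int l))) *
      (of_int (Legendre 3 (int l)) * of_int (Legendre 3 (int l))) * (ee (1/8) * ee (-1/8))"
    unfolding S by (simp only: mult_ac)
  also have "ee (1/8) * ee (-1/8) = 1" by (simp flip: ee_add)
  finally show ?thesis
    unfolding Lw L3 using gauss_sum_nonzero[OF l(1) l2] by (simp add: field_simps)
qed

text \<open>The inversion sends the shift by a unit modulo l^2 to its dual, exchanges the shifts l u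
  (u a unit modulo l) with the twisted terms, and the shift 0 with the dilation. Each case is
  \<open>modular_shift\<close> or the plain inversion at a positive multiple t of z, and the power
  t^(5/2) supplies the power of l that makes the prefactors match.\<close>

lemma hecke_sum_S:
  assumes l: "prime l" "5 \<le> l" and z: "z \<in> upper_half_plane"
  shows "hecke_sum l f (-1 / z) = ee (-1/8) * z powr (5/2) * hecke_sum l f z"
proof -
  define L where "L = int l"
  define r where "r = complex_of_nat l"
  define s where "s = complex_of_real (sqrt l)"
  define G where "G = gauss_sum 1 L"
  define lam where "lam v = complex_of_int (Legendre v L)" for v
  define X where "X = ee (-1/8) * z powr (5/2)"
  define P where "P w = f ((z + 24 * of_int w) / r ^ 2)" for w
  define Q where "Q w = f (z + 24 * of_int w / r)" for w
  define R where "R = f (r ^ 2 * z)"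
  define U where "U = {v\<in>{0..<L}. coprime v L}"
  define U2 where "U2 = {v\<in>{0..<L\<^sup>2}. coprime v (L\<^sup>2)}"
  have l0: "real l > 0" and l2: "2 < l" using l by (simp_all add: prime_gt_0_nat)
  have L: "L > 0" "L\<^sup>2 > 0" "prime L" using l by (simp_all add: L_def prime_gt_0_nat)
  have cop: "coprime 12 L" "coprime 12 (L\<^sup>2)" using coprime_12_prime[OF l] by (simp_all add: L_def)
  have r0: "r \<noteq> 0" and rL: "of_int L = r" "of_int (L\<^sup>2) = r ^ 2" using l0 by (simp_all add: r_def L_def)
  have s2: "s * s = r" and s0: "s \<noteq> 0"
    using l0 by (simp_all add: s_def r_def flip: of_real_mult)
  have G0: "G \<noteq> 0" unfolding G_def L_def by (rule gauss_sum_nonzero[OF l(1) l2])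
  have z0: "z \<noteq> 0" using z by (auto simp: upper_half_plane_iff)
  have scaled: "of_real a * z \<in> upper_half_plane" if "a > 0" for a using z that by (simp add: upper_half_plane_iff)
  have dual: "dual_residue c v \<in> {0..<c}" "[576 * v * dual_residue c v = -1] (mod c)"
    if "c = L \<and> v \<in> U \<or> c = L\<^sup>2 \<and> v \<in> U2" for c v
    using that dual_residue[of c v] L cop by (auto simp: U_def U2_def)
  have fS: "f (- 1 / t) = ee (-1/8) * t powr (5/2) * f t" if "t \<in> upper_half_plane" for t
    using modular[of 0 0 "-1" 1 t] that by (simp add: moebius_def multiplier_S)

  have U_unit: "f ((-1 / z + 24 * of_int v) / r ^ 2) = X * P (dual_residue (L\<^sup>2) v)" if v: "v \<in> U2" for v
  proof -
    define w where "w = dual_residue (L\<^sup>2) v"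
    have w: "[576 * v * w = -1] (mod L\<^sup>2)" unfolding w_def using dual v by blast
    have "f ((24 * of_int v - 1 / z) / of_int (L\<^sup>2)) = ee (-1/8) * z powr (5/2) * f ((z + 24 * of_int w) / of_int (L\<^sup>2))"
      unfolding modular_shift[OF L(2) w z] using multiplier_prime_square[OF l w[unfolded L_def]] by (simp add: L_def)
    moreover have "-1 / z + 24 * of_int v = 24 * of_int v - 1 / z" by simp
    ultimately show ?thesis by (simp only: rL P_def X_def w_def)
  qed
  \<comment> \<open>Here t = l z, and l^(5/2) is written as s r^2 with s = sqrt l.\<close>
  have U_mult: "f ((-1 / z + 24 * of_int (L * u)) / r ^ 2) =
      X * (lam (dual_residue L u) * lam 3 * s / G * (s * r ^ 2)) * Q (dual_residue L u)" if u: "u \<in> U" for u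
  proof -
    define w where "w = dual_residue L u"
    have w: "[576 * u * w = -1] (mod L)" unfolding w_def using dual u by blast
    have t: "of_real (real l) * z \<in> upper_half_plane" using scaled[OF l0] .
    have rr: "of_real (real l) = r" by (simp add: r_def)
    have p: "(r * z) powr (5/2) = of_real (sqrt l * (real l)\<^sup>2) * z powr (5/2)"
      using powr_five_halves_scale[OF l0, of z] unfolding rr .
    have "f ((24 * of_int u - 1 / (r * z)) / r) = (ee (-1/8) * lam w * lam 3 * s / G) *
      (of_real (sqrt l * (real l)\<^sup>2) * z powr (5/2)) * f ((r * z + 24 * of_int w) / r)"
      using modular_shift[OF L(1) w t] multiplier_prime[OF l w[unfolded L_def]]
      using p unfolding rr rL by (simp add: L_def lam_def G_def s_def)
    moreover have "(24 * of_int u - 1 / (r * z)) / r = (-1 / z + 24 * of_int (L * u)) / r ^ 2"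
      using r0 z0 by (simp add: rL field_simps power2_eq_square)
    moreover have "(r * z + 24 * of_int w) / r = z + 24 * of_int w / r" using r0 by (simp add: field_simps)
    moreover have "complex_of_real (sqrt l * (real l)\<^sup>2) = s * r ^ 2" by (simp add: s_def r_def)
    ultimately have "f ((-1 / z + 24 * of_int (L * u)) / r ^ 2) = (ee (-1/8) * lam w * lam 3 * s / G) *
      (s * r ^ 2 * z powr (5/2)) * f (z + 24 * of_int w / r)" by (simp only:)
    then show ?thesis unfolding w_def[symmetric] Q_def X_def by (simp add: mult_ac)
  qed
  \<comment> \<open>Here t = l^2 z gives l^5; after the prefactor 1/l^2 this is the weight l^3 of
    the dilation.\<close>
  have U_zero: "f ((-1 / z + 24 * of_int 0) / r ^ 2) = X * r ^ 5 * R"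
  proof -
    have l2': "(real l)\<^sup>2 > 0" using l0 by simp
    have rr: "of_real ((real l)\<^sup>2) = r ^ 2" by (simp add: r_def)
    have "f (-1 / (r ^ 2 * z)) = ee (-1/8) * (of_real (sqrt ((real l)\<^sup>2) * ((real l)\<^sup>2)\<^sup>2) * z powr (5/2)) * f (r ^ 2 * z)"
      using fS[OF scaled[OF l2']] powr_five_halves_scale[OF l2', of z] unfolding rr by simp
    moreover have "complex_of_real (sqrt ((real l)\<^sup>2) * ((real l)\<^sup>2)\<^sup>2) = r ^ 5"
      using l0 by (simp add: r_def flip: power_mult power_Suc)
    moreover have "(-1 / z + 24 * of_int 0) / r ^ 2 = -1 / (r ^ 2 * z)" by (simp add: field_simps)
    ultimately show ?thesis by (simp add: X_def R_def mult_ac)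
  qed
  \<comment> \<open>The exchange in the other direction: t = z / l, hence the factor
    l^(-5/2).\<close>
  have M_unit: "f (-1 / z + 24 * of_int v / r) =
      X * (lam (dual_residue L v) * lam 3 * s / G / (s * r ^ 2)) * P (L * dual_residue L v)" if v: "v \<in> U" for v
  proof -
    define w where "w = dual_residue L v"
    have w: "[576 * v * w = -1] (mod L)" unfolding w_def using dual v by blast
    have li: "1 / real l > 0" using l0 by simp
    have rr: "of_real (1 / real l) * z = z / r" by (simp add: r_def)
    have t: "z / r \<in> upper_half_plane" using scaled[OF li] unfolding rr .
    have "(z / r) powr (5/2) = of_real (sqrt (1 / real l) * (1 / real l)\<^sup>2) * z powr (5/2)"
      using powr_five_halves_scale[OF li, of z] unfolding rr .
    also have "complex_of_real (sqrt (1 / real l) * (1 / real l)\<^sup>2) = 1 / (s * r ^ 2)"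
      by (simp add: s_def r_def real_sqrt_divide power_divide)
    finally have p: "(z / r) powr (5/2) = 1 / (s * r ^ 2) * z powr (5/2)" .
    have "f ((24 * of_int v - 1 / (z / r)) / r) = (ee (-1/8) * lam w * lam 3 * s / G) *
      (1 / (s * r ^ 2) * z powr (5/2)) * f ((z / r + 24 * of_int w) / r)"
      using modular_shift[OF L(1) w t] multiplier_prime[OF l w[unfolded L_def]]
      unfolding p rL by (simp add: L_def lam_def G_def s_def)
    moreover have "(24 * of_int v - 1 / (z / r)) / r = -1 / z + 24 * of_int v / r"
      using r0 z0 by (simp add: field_simps)
    moreover have "(z / r + 24 * of_int w) / r = (z + 24 * of_int (L * w)) / r ^ 2"
      using r0 by (simp add: rL field_simps power2_eq_square)
    ultimately have "f (-1 / z + 24 * of_int v / r) = (ee (-1/8) * lam w * lam 3 * s / G) *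
      (1 / (s * r ^ 2) * z powr (5/2)) * P (L * w)" by (simp only: P_def)
    then show ?thesis unfolding w_def[symmetric] X_def by (simp add: mult_ac)
  qed
  \<comment> \<open>Here t = z / l^2; the weight l^3 times l^(-5) is the prefactor 1/l^2 of the
    shift 0.\<close>
  have D: "f (r ^ 2 * (-1 / z)) = X / r ^ 5 * P 0"
  proof -
    have li: "1 / (real l)\<^sup>2 > 0" using l0 by simp
    have rr: "of_real (1 / (real l)\<^sup>2) * z = z / r ^ 2" by (simp add: r_def)
    have "(z / r ^ 2) powr (5/2) = of_real (sqrt (1 / (real l)\<^sup>2) * (1 / (real l)\<^sup>2)\<^sup>2) * z powr (5/2)"
      using powr_five_halves_scale[OF li, of z] unfolding rr .
    also have "complex_of_real (sqrt (1 / (real l)\<^sup>2) * (1 / (real l)\<^sup>2)\<^sup>2) = 1 / r ^ 5"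
      using l0 by (simp add: r_def real_sqrt_divide power_divide flip: power_mult power_Suc)
    finally have p: "(z / r ^ 2) powr (5/2) = 1 / r ^ 5 * z powr (5/2)" .
    have "f (-1 / (z / r ^ 2)) = ee (-1/8) * (1 / r ^ 5 * z powr (5/2)) * f (z / r ^ 2)"
      using fS[OF scaled[OF li]] unfolding rr p .
    moreover have "-1 / (z / r ^ 2) = r ^ 2 * (-1 / z)" using r0 z0 by (simp add: field_simps)
    ultimately show ?thesis by (simp add: X_def P_def)
  qed

  define A where "A = r * lam 3 / G"
  have L0: "lam 0 = 0" by (simp add: lam_def Legendre_def)
  have split2: "(\<Sum>v\<in>{0..<L\<^sup>2}. g v) = (\<Sum>v\<in>U2. g v) + (g 0 + (\<Sum>u\<in>U. g (L * u)))" for g :: "int \<Rightarrow> complex"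
    unfolding sum_units_split_square[OF L(3)] U2_def[symmetric] sum_units_split[OF L(3)] U_def[symmetric] by simp
  have H: "hecke_sum l f w = 1 / r ^ 2 * ((\<Sum>v\<in>U2. f ((w + 24 * of_int v) / r ^ 2)) +
      (f ((w + 24 * of_int 0) / r ^ 2) + (\<Sum>u\<in>U. f ((w + 24 * of_int (L * u)) / r ^ 2)))) +
    A * (\<Sum>v\<in>U. lam v * f (w + 24 * of_int v / r)) + r ^ 3 * f (r ^ 2 * w)" for w
    unfolding hecke_sum_def L_def[symmetric] r_def[symmetric] split2 A_def G_def
    by (simp add: sum_units_split[OF L(3)] U_def lam_def[symmetric] L0)
  have ll: "lam 3 * lam 3 = 1"
  proof -
    have "\<not> int l dvd 3" using l by (auto dest: zdvd_imp_le)
    then show ?thesis using arg_cong[OF Legendre_square, of "int l" 3 "of_int :: int \<Rightarrow> complex"] by (simp add: lam_def L_def)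
  qed
  have vw: "lam v * lam (dual_residue L v) = lam (-1)" if "v \<in> U" for v
    using arg_cong[OF Legendre_dual[OF l, of v "dual_residue L v"], of "of_int :: int \<Rightarrow> complex"] dual[of L v] that
    by (simp add: lam_def L_def)
  have GG: "lam (-1) * (G * G) = r"
    using gauss_sum_squared[OF l(1) l2] by (simp add: lam_def G_def L_def r_def power2_eq_square)
  have l1: "lam (-1) * lam (-1) = 1"
  proof -
    have "\<not> int l dvd -1" using l by (auto dest: zdvd_imp_le)
    then show ?thesis using arg_cong[OF Legendre_square, of "int l" "-1" "of_int :: int \<Rightarrow> complex"] by (simp add: lam_def L_def)
  qed
  have eU2: "(\<Sum>v\<in>U2. f ((-1 / z + 24 * of_int v) / r ^ 2)) = X * (\<Sum>v\<in>U2. P v)"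
  proof -
    have "(\<Sum>v\<in>U2. f ((-1 / z + 24 * of_int v) / r ^ 2)) = X * (\<Sum>v\<in>U2. P (dual_residue (L\<^sup>2) v))"
      using U_unit by (simp add: sum_distrib_left)
    then show ?thesis unfolding U2_def sum_dual_residue[OF L(2) cop(2)] .
  qed
  \<comment> \<open>The multiplier contributes the twist by the dual residue and one factor 1/G, and
    s s = l restores the prefactor \<open>A\<close>.\<close>
  have eU: "(\<Sum>u\<in>U. f ((-1 / z + 24 * of_int (L * u)) / r ^ 2)) = X * (r ^ 2 * A) * (\<Sum>v\<in>U. lam v * Q v)"
  proof -
    have "s * (s * r ^ 2) = r * r ^ 2" using s2 by (simp add: mult.assoc[symmetric])
    then have "lam w * lam 3 * s / G * (s * r ^ 2) = (r ^ 2 * A) * lam w" for w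
      unfolding A_def by (simp add: mult_ac times_divide_eq_left times_divide_eq_right)
    then have "(\<Sum>u\<in>U. f ((-1 / z + 24 * of_int (L * u)) / r ^ 2)) =
      X * (r ^ 2 * A) * (\<Sum>v\<in>U. lam (dual_residue L v) * Q (dual_residue L v))"
      using U_mult by (simp add: sum_distrib_left mult.assoc)
    then show ?thesis unfolding U_def sum_dual_residue[OF L(1) cop(1), of "\<lambda>v. lam v * Q v"] .
  qed
  \<comment> \<open>Two factors 1/G meet here, one from the normalisation and one from the
    multiplier. They are removed by (-1/l) G^2 = l, and the remaining (-1/l) cancels against the
    product of the symbols of v and its dual.\<close>
  have eM: "A * (\<Sum>v\<in>U. lam v * f (-1 / z + 24 * of_int v / r)) = X * (1 / r ^ 2) * (\<Sum>v\<in>U. P (L * v))"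
  proof -
    have "A * (lam v * f (-1 / z + 24 * of_int v / r)) = X * (1 / r ^ 2) * P (L * dual_residue L v)" if v: "v \<in> U" for v
    proof -
      have "A * (lam v * f (-1 / z + 24 * of_int v / r)) =
        X * ((lam v * lam (dual_residue L v)) * (lam 3 * lam 3) * r / (G * G) / r ^ 2) * P (L * dual_residue L v)"
        unfolding M_unit[OF v] A_def using s0 G0 r0 by (simp add: field_simps)
      also have "(lam v * lam (dual_residue L v)) * (lam 3 * lam 3) * r / (G * G) = lam (-1) * r / (G * G)"
        unfolding vw[OF v] ll by simp
      also have "lam (-1) * r / (G * G) = (lam (-1) * lam (-1)) * (G * G) / (G * G)"
        unfolding GG[symmetric] by (simp only: mult.assoc)
      also have "\<dots> = 1" unfolding l1 using G0 by simp
      finally show ?thesis .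
    qed
    then have "A * (\<Sum>v\<in>U. lam v * f (-1 / z + 24 * of_int v / r)) = X * (1 / r ^ 2) * (\<Sum>v\<in>U. P (L * dual_residue L v))"
      by (simp add: sum_distrib_left)
    then show ?thesis unfolding U_def sum_dual_residue[OF L(1) cop(1), of "\<lambda>v. P (L * v)"] .
  qed
  have "hecke_sum l f (-1 / z) = 1 / r ^ 2 * (X * (\<Sum>v\<in>U2. P v) + (X * r ^ 5 * R + X * (r ^ 2 * A) * (\<Sum>v\<in>U. lam v * Q v))) +
    X * (1 / r ^ 2) * (\<Sum>v\<in>U. P (L * v)) + r ^ 3 * (X / r ^ 5 * P 0)"
    unfolding H eU2 eU eM U_zero D ..
  also have "\<dots> = X * (1 / r ^ 2 * ((\<Sum>v\<in>U2. P v) + (P 0 + (\<Sum>v\<in>U. P (L * v)))) + A * (\<Sum>v\<in>U. lam v * Q v) + r ^ 3 * R)"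
  proof -
    have "r ^ 5 = r ^ 2 * r ^ 3" "r ^ 3 = r ^ 2 * r" by (simp_all add: power_numeral_reduce)
    then have "1 / r ^ 2 * (X * a + (X * r ^ 5 * R + X * (r ^ 2 * A) * b)) + X * (1 / r ^ 2) * d + r ^ 3 * (X / r ^ 5 * e) =
      X * (1 / r ^ 2 * (a + (e + d)) + A * b + r ^ 3 * R)" for a b d e
      using r0 by (simp add: field_simps)
    then show ?thesis .
  qed
  also have "\<dots> = X * hecke_sum l f z" unfolding H P_def Q_def R_def ..
  finally show ?thesis unfolding X_def .
qed

end

section \<open>Real analytic functions and the Laplacian\<close>

text \<open>The Laplacian contains no mixed derivatives, so expansions along the horizontal and the
  vertical line through a point determine its value there.\<close>

definition has_line_series :: "(real \<Rightarrow> complex) \<Rightarrow> (nat \<Rightarrow> complex) \<Rightarrow> bool" where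
  "has_line_series g a \<longleftrightarrow> (\<exists>r>0. \<forall>t. \<bar>t\<bar> < r \<longrightarrow> (\<lambda>n. a n * of_real t ^ n) sums g t)"

lemma has_line_series_cong:
  assumes "has_line_series g a" "r > 0" "\<And>t. \<bar>t\<bar> < r \<Longrightarrow> h t = g t"
  shows "has_line_series h a"
proof -
  obtain s where "s > 0" "\<forall>t. \<bar>t\<bar> < s \<longrightarrow> (\<lambda>n. a n * of_real t ^ n) sums g t"
    using assms(1) unfolding has_line_series_def by blast
  with assms show ?thesis unfolding has_line_series_def by (intro exI[of _ "min r s"]) auto
qed

lemma has_line_series_add:
  assumes "has_line_series g a" "has_line_series h b"
  shows "has_line_series (\<lambda>t. g t + h t) (\<lambda>n. a n + b n)"
proof -
  obtain r s where "r > 0" "\<forall>t. \<bar>t\<bar> < r \<longrightarrow> (\<lambda>n. a n * of_real t ^ n) sums g t"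
    "s > 0" "\<forall>t. \<bar>t\<bar> < s \<longrightarrow> (\<lambda>n. b n * of_real t ^ n) sums h t"
    using assms unfolding has_line_series_def by blast
  then show ?thesis unfolding has_line_series_def
    by (intro exI[of _ "min r s"]) (auto simp: distrib_right intro: sums_add)
qed

lemma has_line_series_cmult:
  assumes "has_line_series g a"
  shows "has_line_series (\<lambda>t. c * g t) (\<lambda>n. c * a n)"
proof -
  obtain r where "r > 0" "\<forall>t. \<bar>t\<bar> < r \<longrightarrow> (\<lambda>n. a n * of_real t ^ n) sums g t"
    using assms unfolding has_line_series_def by blast
  then show ?thesis unfolding has_line_series_def
    by (intro exI[of _ r]) (auto simp: mult.assoc intro: sums_mult)
qed

lemma has_line_series_scale:
  assumes "has_line_series g a" "s > 0"
  shows "has_line_series (\<lambda>t. g (s * t)) (\<lambda>n. a n * of_real s ^ n)"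
proof -
  obtain r where r: "r > 0" "\<And>t. \<bar>t\<bar> < r \<Longrightarrow> (\<lambda>n. a n * of_real t ^ n) sums g t"
    using assms unfolding has_line_series_def by blast
  have "(\<lambda>n. a n * of_real s ^ n * of_real t ^ n) sums g (s * t)" if "\<bar>t\<bar> < r / s" for t
    using r(2)[of "s * t"] that assms(2) by (simp add: abs_mult field_simps)
  with r assms(2) show ?thesis unfolding has_line_series_def by (intro exI[of _ "r / s"]) auto
qed

text \<open>The derivative is taken at every t near 0, not only at 0, so that the result can be
  iterated for second derivatives.\<close>

lemma has_line_series_deriv:
  assumes "has_line_series g a"
  shows "has_line_series (\<lambda>t. vector_derivative (\<lambda>s. g (t + s)) (at 0)) (diffs a)"
proof -
  obtain r where r: "r > 0" "\<And>t. \<bar>t\<bar> < r \<Longrightarrow> (\<lambda>n. a n * of_real t ^ n) sums g t"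
    using assms unfolding has_line_series_def by blast
  have summ: "summable (\<lambda>n. a n * z ^ n)" if "norm z < r" for z
  proof -
    obtain t where t: "norm z < t" "t < r" using dense \<open>norm z < r\<close> by blast
    then have "summable (\<lambda>n. a n * of_real t ^ n)"
      using norm_ge_zero[of z] by (intro sums_summable[OF r(2)]) linarith
    then show ?thesis by (rule powser_inside) (use t norm_ge_zero[of z] in auto)
  qed
  have "(\<lambda>n. diffs a n * of_real t ^ n) sums vector_derivative (\<lambda>s. g (t + s)) (at 0)" if t: "\<bar>t\<bar> < r" for t
  proof -
    obtain K where K: "\<bar>t\<bar> < K" "K < r" using dense t by blast
    have "((\<lambda>z. \<Sum>n. a n * z ^ n) has_field_derivative (\<Sum>n. diffs a n * of_real t ^ n)) (at (of_real t))"
      by (rule termdiffs_strong[of a "of_real K", OF summ]) (use K in auto)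
    from has_vector_derivative_real_field[OF this]
    have "((\<lambda>s. \<Sum>n. a n * of_real s ^ n) has_vector_derivative (\<Sum>n. diffs a n * of_real t ^ n)) (at t)" .
    then have "(g has_vector_derivative (\<Sum>n. diffs a n * of_real t ^ n)) (at t)"
    proof (rule has_vector_derivative_transform_within_open)
      show "open (ball 0 r :: real set)" "t \<in> ball 0 r" using t by auto
      show "(\<Sum>n. a n * of_real s ^ n) = g s" if "s \<in> ball 0 r" for s
        using r(2)[of s] that by (auto simp: sums_iff)
    qed
    then have "(g \<circ> (\<lambda>s. t + s) has_vector_derivative 1 *\<^sub>R (\<Sum>n. diffs a n * of_real t ^ n)) (at 0)"
      by (intro vector_diff_chain_at) (auto intro!: derivative_eq_intros)
    then have "((\<lambda>s. g (t + s)) has_vector_derivative (\<Sum>n. diffs a n * of_real t ^ n)) (at 0)"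
      by (simp add: o_def)
    then have "vector_derivative (\<lambda>s. g (t + s)) (at 0) = (\<Sum>n. diffs a n * of_real t ^ n)"
      by (rule vector_derivative_at)
    moreover have "summable (\<lambda>n. diffs a n * of_real t ^ n)"
      by (rule termdiff_converges[of _ r]) (use t summ in auto)
    ultimately show ?thesis by (simp add: summable_sums)
  qed
  with r(1) show ?thesis unfolding has_line_series_def by blast
qed

lemma has_line_series_0: "has_line_series g a \<Longrightarrow> g 0 = a 0"
proof -
  assume "has_line_series g a"
  then obtain r where "r > 0" "\<forall>t. \<bar>t\<bar> < r \<longrightarrow> (\<lambda>n. a n * of_real t ^ n) sums g t"
    unfolding has_line_series_def by blast
  then have "(\<lambda>n. a n * 0 ^ n) sums g 0" by (metis abs_zero of_real_0)
  from sums_unique2[OF this powser_sums_zero] show "g 0 = a 0" .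
qed

lemma partial_x_series:
  assumes "has_line_series (\<lambda>t. f (z + of_real t)) a"
  shows "partial_x f z = a 1" "partial_x (partial_x f) z = 2 * a 2"
proof -
  have eq: "(\<lambda>t. partial_x f (z + of_real t)) = (\<lambda>t. vector_derivative (\<lambda>s. f (z + of_real (t + s))) (at 0))"
    by (simp add: partial_x_def add.assoc fun_eq_iff)
  have 1: "has_line_series (\<lambda>t. partial_x f (z + of_real t)) (diffs a)"
    unfolding eq by (rule has_line_series_deriv[OF assms])
  show "partial_x f z = a 1" using has_line_series_0[OF 1] by (simp add: diffs_def)
  show "partial_x (partial_x f) z = 2 * a 2"
    using has_line_series_0[OF has_line_series_deriv[OF 1]] by (simp add: diffs_def partial_x_def numeral_2_eq_2)
qed

lemma partial_y_series:
  assumes "has_line_series (\<lambda>t. f (z + \<i> * of_real t)) a"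
  shows "partial_y f z = a 1" "partial_y (partial_y f) z = 2 * a 2"
proof -
  have eq: "(\<lambda>t. partial_y f (z + \<i> * of_real t)) = (\<lambda>t. vector_derivative (\<lambda>s. f (z + \<i> * of_real (t + s))) (at 0))"
    by (simp add: partial_y_def add.assoc fun_eq_iff distrib_left)
  have 1: "has_line_series (\<lambda>t. partial_y f (z + \<i> * of_real t)) (diffs a)"
    unfolding eq by (rule has_line_series_deriv[OF assms])
  show "partial_y f z = a 1" using has_line_series_0[OF 1] by (simp add: diffs_def)
  show "partial_y (partial_y f) z = 2 * a 2"
    using has_line_series_0[OF has_line_series_deriv[OF 1]] by (simp add: diffs_def partial_y_def numeral_2_eq_2)
qed

lemma hyp_laplacian_series:
  assumes "has_line_series (\<lambda>t. f (z + of_real t)) a" "has_line_series (\<lambda>t. f (z + \<i> * of_real t)) b"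
  shows "hyp_laplacian k f z = - (of_real (Im z))\<^sup>2 * (2 * a 2 + 2 * b 2) + \<i> * of_real k * of_real (Im z) * (a 1 + \<i> * b 1)"
  by (simp add: hyp_laplacian_def partial_x_series[OF assms(1)] partial_y_series[OF assms(2)])

lemma real_analytic_on_series:
  assumes f: "real_analytic_on f S" and z: "z \<in> S"
  obtains a b where "has_line_series (\<lambda>t. f (z + of_real t)) a" "has_line_series (\<lambda>t. f (z + \<i> * of_real t)) b"
proof -
  obtain r c where r: "r > 0" and c: "\<And>x y :: real. \<bar>x\<bar> < r \<Longrightarrow> \<bar>y\<bar> < r \<Longrightarrow>
    ((\<lambda>(i, j). c (i, j) * of_real x ^ i * of_real y ^ j) has_sum f (z + Complex x y)) UNIV"
    using f z unfolding real_analytic_on_def by meson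
  have "(\<lambda>i. c (i, 0) * of_real t ^ i) sums f (z + of_real t)" if t: "\<bar>t\<bar> < r" for t
  proof -
    have "((\<lambda>(i, j). c (i, j) * of_real t ^ i * of_real 0 ^ j) has_sum f (z + of_real t)) UNIV"
      using c[of t 0] t r by (simp add: complex_of_real_def)
    also have "?this \<longleftrightarrow> ((\<lambda>(i, j). c (i, j) * of_real t ^ i * of_real 0 ^ j) has_sum f (z + of_real t)) (range (\<lambda>i. (i, 0)))"
      by (rule has_sum_cong_neutral) (auto simp: image_iff)
    also have "\<dots> \<longleftrightarrow> ((\<lambda>i. c (i, 0) * of_real t ^ i) has_sum f (z + of_real t)) UNIV"
      by (subst has_sum_reindex) (auto simp: inj_def o_def)
    finally show ?thesis by (rule has_sum_imp_sums)
  qed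
  then have 1: "has_line_series (\<lambda>t. f (z + of_real t)) (\<lambda>i. c (i, 0))"
    using r unfolding has_line_series_def by blast
  have "(\<lambda>i. c (0, i) * of_real t ^ i) sums f (z + \<i> * of_real t)" if t: "\<bar>t\<bar> < r" for t
  proof -
    have "((\<lambda>(i, j). c (i, j) * of_real 0 ^ i * of_real t ^ j) has_sum f (z + \<i> * of_real t)) UNIV"
      using c[of 0 t] t r by (simp add: Complex_eq)
    also have "?this \<longleftrightarrow> ((\<lambda>(i, j). c (i, j) * of_real 0 ^ i * of_real t ^ j) has_sum f (z + \<i> * of_real t)) (range (\<lambda>i. (0, i)))"
      by (rule has_sum_cong_neutral) (auto simp: image_iff)
    also have "\<dots> \<longleftrightarrow> ((\<lambda>i. c (0, i) * of_real t ^ i) has_sum f (z + \<i> * of_real t)) UNIV"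
      by (subst has_sum_reindex) (auto simp: inj_def o_def)
    finally show ?thesis by (rule has_sum_imp_sums)
  qed
  then have 2: "has_line_series (\<lambda>t. f (z + \<i> * of_real t)) (\<lambda>i. c (0, i))"
    using r unfolding has_line_series_def by blast
  from that[OF 1 2] show thesis .
qed

section \<open>Harmonicity under affine substitutions and finite sums\<close>

definition real_harmonic :: "real \<Rightarrow> (complex \<Rightarrow> complex) \<Rightarrow> bool" where
  "real_harmonic k f \<longleftrightarrow> real_analytic_on f upper_half_plane \<and> (\<forall>z\<in>upper_half_plane. hyp_laplacian k f z = 0)"

lemma upper_half_plane_nhd:
  assumes "z \<in> upper_half_plane"
  obtains r where "r > 0" "\<And>x y. \<bar>y\<bar> < r \<Longrightarrow> z + Complex x y \<in> upper_half_plane"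
  using assms by (intro that[of "Im z"]) (auto simp: upper_half_plane_def abs_less_iff)

text \<open>The domain is open, so series and derivatives at its points see only values inside it.
  This permits setting a function to 0 outside.\<close>

lemma real_harmonic_cong:
  assumes f: "real_harmonic k f" and eq: "\<And>z. z \<in> upper_half_plane \<Longrightarrow> g z = f z"
  shows "real_harmonic k g"
  unfolding real_harmonic_def
proof (intro conjI ballI)
  show "real_analytic_on g upper_half_plane"
    unfolding real_analytic_on_def
  proof
    fix z assume z: "z \<in> upper_half_plane"
    obtain s where s: "s > 0" "\<And>x y. \<bar>y\<bar> < s \<Longrightarrow> z + Complex x y \<in> upper_half_plane"
      using upper_half_plane_nhd[OF z] by blast
    obtain r c where "r > 0" "\<And>x y :: real. \<bar>x\<bar> < r \<Longrightarrow> \<bar>y\<bar> < r \<Longrightarrow>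
      ((\<lambda>(i, j). c (i, j) * of_real x ^ i * of_real y ^ j) has_sum f (z + Complex x y)) UNIV"
      using f z unfolding real_harmonic_def real_analytic_on_def by meson
    with s eq show "\<exists>r>0. \<exists>c. \<forall>x y :: real. \<bar>x\<bar> < r \<and> \<bar>y\<bar> < r \<longrightarrow>
      ((\<lambda>(i, j). c (i, j) * of_real x ^ i * of_real y ^ j) has_sum g (z + Complex x y)) UNIV"
      by (intro exI[of _ "min r s"] conjI exI[of _ c]) auto
  qed
  fix z assume z: "z \<in> upper_half_plane"
  obtain s where s: "s > 0" "\<And>x y. \<bar>y\<bar> < s \<Longrightarrow> z + Complex x y \<in> upper_half_plane"
    using upper_half_plane_nhd[OF z] by blast
  have x: "z + of_real t \<in> upper_half_plane" for t
    using z by (simp add: upper_half_plane_def)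
  have y: "z + \<i> * of_real t \<in> upper_half_plane" if "\<bar>t\<bar> < s" for t
    using s(2)[OF that, of 0] by (simp add: Complex_eq)
  obtain a b where ab: "has_line_series (\<lambda>t. f (z + of_real t)) a" "has_line_series (\<lambda>t. f (z + \<i> * of_real t)) b"
    using real_analytic_on_series f z unfolding real_harmonic_def by blast
  have "has_line_series (\<lambda>t. g (z + of_real t)) a"
    by (rule has_line_series_cong[OF ab(1) s(1)]) (use x eq in blast)
  moreover have "has_line_series (\<lambda>t. g (z + \<i> * of_real t)) b"
    by (rule has_line_series_cong[OF ab(2) s(1)]) (use y eq in blast)
  ultimately have "hyp_laplacian k g z = hyp_laplacian k f z"
    using hyp_laplacian_series ab by simp
  then show "hyp_laplacian k g z = 0" using f z by (simp add: real_harmonic_def)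
qed

lemma real_harmonic_add:
  assumes f: "real_harmonic k f" and g: "real_harmonic k g"
  shows "real_harmonic k (\<lambda>z. f z + g z)"
  unfolding real_harmonic_def
proof (intro conjI ballI)
  show "real_analytic_on (\<lambda>z. f z + g z) upper_half_plane"
    unfolding real_analytic_on_def
  proof
    fix z assume z: "z \<in> upper_half_plane"
    obtain r c where r: "r > 0" "\<And>x y :: real. \<bar>x\<bar> < r \<Longrightarrow> \<bar>y\<bar> < r \<Longrightarrow>
      ((\<lambda>(i, j). c (i, j) * of_real x ^ i * of_real y ^ j) has_sum f (z + Complex x y)) UNIV"
      using f z unfolding real_harmonic_def real_analytic_on_def by meson
    obtain s d where s: "s > 0" "\<And>x y :: real. \<bar>x\<bar> < s \<Longrightarrow> \<bar>y\<bar> < s \<Longrightarrow>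
      ((\<lambda>(i, j). d (i, j) * of_real x ^ i * of_real y ^ j) has_sum g (z + Complex x y)) UNIV"
      using g z unfolding real_harmonic_def real_analytic_on_def by meson
    have "((\<lambda>(i, j). (c (i, j) + d (i, j)) * of_real x ^ i * of_real y ^ j) has_sum (f (z + Complex x y) + g (z + Complex x y))) UNIV"
      if "\<bar>x\<bar> < min r s" "\<bar>y\<bar> < min r s" for x y :: real
      using has_sum_add[OF r(2)[of x y] s(2)[of x y]] that by (simp add: case_prod_unfold distrib_right)
    with r s show "\<exists>r>0. \<exists>c. \<forall>x y :: real. \<bar>x\<bar> < r \<and> \<bar>y\<bar> < r \<longrightarrow>
      ((\<lambda>(i, j). c (i, j) * of_real x ^ i * of_real y ^ j) has_sum (f (z + Complex x y) + g (z + Complex x y))) UNIV"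
      by (intro exI[of _ "min r s"] conjI exI[of _ "\<lambda>p. c p + d p"]) auto
  qed
  fix z assume z: "z \<in> upper_half_plane"
  obtain a b where ab: "has_line_series (\<lambda>t. f (z + of_real t)) a" "has_line_series (\<lambda>t. f (z + \<i> * of_real t)) b"
    using real_analytic_on_series f z unfolding real_harmonic_def by blast
  obtain a' b' where ab': "has_line_series (\<lambda>t. g (z + of_real t)) a'" "has_line_series (\<lambda>t. g (z + \<i> * of_real t)) b'"
    using real_analytic_on_series g z unfolding real_harmonic_def by blast
  have "hyp_laplacian k (\<lambda>z. f z + g z) z = hyp_laplacian k f z + hyp_laplacian k g z"
    unfolding hyp_laplacian_series[OF has_line_series_add[OF ab(1) ab'(1)] has_line_series_add[OF ab(2) ab'(2)]]
      hyp_laplacian_series[OF ab] hyp_laplacian_series[OF ab'] by (simp add: algebra_simps)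
  then show "hyp_laplacian k (\<lambda>z. f z + g z) z = 0" using f g z by (simp add: real_harmonic_def)
qed

lemma real_harmonic_cmult:
  assumes f: "real_harmonic k f"
  shows "real_harmonic k (\<lambda>z. \<alpha> * f z)"
  unfolding real_harmonic_def
proof (intro conjI ballI)
  show "real_analytic_on (\<lambda>z. \<alpha> * f z) upper_half_plane"
    unfolding real_analytic_on_def
  proof
    fix z assume z: "z \<in> upper_half_plane"
    obtain r c where r: "r > 0" "\<And>x y :: real. \<bar>x\<bar> < r \<Longrightarrow> \<bar>y\<bar> < r \<Longrightarrow>
      ((\<lambda>(i, j). c (i, j) * of_real x ^ i * of_real y ^ j) has_sum f (z + Complex x y)) UNIV"
      using f z unfolding real_harmonic_def real_analytic_on_def by meson
    have "((\<lambda>(i, j). (\<alpha> * c (i, j)) * of_real x ^ i * of_real y ^ j) has_sum (\<alpha> * f (z + Complex x y))) UNIV"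
      if "\<bar>x\<bar> < r" "\<bar>y\<bar> < r" for x y :: real
      using has_sum_cmult_right[OF r(2)[of x y], of \<alpha>] that by (simp add: case_prod_unfold mult.assoc)
    with r show "\<exists>r>0. \<exists>c. \<forall>x y :: real. \<bar>x\<bar> < r \<and> \<bar>y\<bar> < r \<longrightarrow>
      ((\<lambda>(i, j). c (i, j) * of_real x ^ i * of_real y ^ j) has_sum (\<alpha> * f (z + Complex x y))) UNIV"
      by (intro exI[of _ r] conjI exI[of _ "\<lambda>p. \<alpha> * c p"]) auto
  qed
  fix z assume z: "z \<in> upper_half_plane"
  obtain a b where ab: "has_line_series (\<lambda>t. f (z + of_real t)) a" "has_line_series (\<lambda>t. f (z + \<i> * of_real t)) b"
    using real_analytic_on_series f z unfolding real_harmonic_def by blast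
  have "hyp_laplacian k (\<lambda>z. \<alpha> * f z) z = \<alpha> * hyp_laplacian k f z"
    unfolding hyp_laplacian_series[OF has_line_series_cmult[OF ab(1)] has_line_series_cmult[OF ab(2)]]
      hyp_laplacian_series[OF ab] by (simp add: algebra_simps)
  then show "hyp_laplacian k (\<lambda>z. \<alpha> * f z) z = 0" using f z by (simp add: real_harmonic_def)
qed

text \<open>Second derivatives carry the factor y^2 and first derivatives the factor y, so the
  powers of s from the chain rule are absorbed by Im (s z + t) = s Im z.\<close>

lemma real_harmonic_affine:
  assumes f: "real_harmonic k f" and s: "s > 0"
  shows "real_harmonic k (\<lambda>z. f (of_real s * z + of_real t))"
  unfolding real_harmonic_def
proof (intro conjI ballI)
  have up: "of_real s * z + of_real t \<in> upper_half_plane" if "z \<in> upper_half_plane" for z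
    using that s by (simp add: upper_half_plane_def)
  show "real_analytic_on (\<lambda>z. f (of_real s * z + of_real t)) upper_half_plane"
    unfolding real_analytic_on_def
  proof
    fix z assume z: "z \<in> upper_half_plane"
    obtain r c where r: "r > 0" "\<And>x y :: real. \<bar>x\<bar> < r \<Longrightarrow> \<bar>y\<bar> < r \<Longrightarrow>
      ((\<lambda>(i, j). c (i, j) * of_real x ^ i * of_real y ^ j) has_sum f ((of_real s * z + of_real t) + Complex x y)) UNIV"
      using f up[OF z] unfolding real_harmonic_def real_analytic_on_def by meson
    have "((\<lambda>(i, j). (c (i, j) * of_real s ^ (i + j)) * of_real x ^ i * of_real y ^ j) has_sum f (of_real s * (z + Complex x y) + of_real t)) UNIV"
      if "\<bar>x\<bar> < r / s" "\<bar>y\<bar> < r / s" for x y :: real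
    proof -
      have eq: "of_real s * (z + Complex x y) + of_real t = (of_real s * z + of_real t) + Complex (s * x) (s * y)"
        by (simp add: complex_eq_iff algebra_simps)
      have "\<bar>s * x\<bar> < r" "\<bar>s * y\<bar> < r"
        using that s by (simp_all add: abs_mult pos_less_divide_eq mult.commute)
      from r(2)[OF this] have "((\<lambda>(i, j). c (i, j) * of_real (s * x) ^ i * of_real (s * y) ^ j) has_sum f (of_real s * (z + Complex x y) + of_real t)) UNIV"
        unfolding eq .
      moreover have "(\<lambda>(i, j). c (i, j) * of_real (s * x) ^ i * of_real (s * y) ^ j) =
        (\<lambda>(i, j). (c (i, j) * of_real s ^ (i + j)) * of_real x ^ i * of_real y ^ j)"
        by (auto simp: fun_eq_iff power_mult_distrib power_add mult_ac)
      ultimately show ?thesis by (simp only:)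
    qed
    with r s show "\<exists>r>0. \<exists>c. \<forall>x y :: real. \<bar>x\<bar> < r \<and> \<bar>y\<bar> < r \<longrightarrow>
      ((\<lambda>(i, j). c (i, j) * of_real x ^ i * of_real y ^ j) has_sum f (of_real s * (z + Complex x y) + of_real t)) UNIV"
      by (intro exI[of _ "r / s"] conjI exI[of _ "\<lambda>(i, j). c (i, j) * of_real s ^ (i + j)"]) auto
  qed
  fix z assume z: "z \<in> upper_half_plane"
  define w where "w = of_real s * z + of_real t"
  obtain a b where ab: "has_line_series (\<lambda>t. f (w + of_real t)) a" "has_line_series (\<lambda>t. f (w + \<i> * of_real t)) b"
    using real_analytic_on_series f up[OF z] unfolding real_harmonic_def w_def by blast
  have "has_line_series (\<lambda>u. f (of_real s * (z + of_real u) + of_real t)) (\<lambda>n. a n * of_real s ^ n)"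
    using has_line_series_scale[OF ab(1) s] by (simp add: w_def algebra_simps)
  moreover have "has_line_series (\<lambda>u. f (of_real s * (z + \<i> * of_real u) + of_real t)) (\<lambda>n. b n * of_real s ^ n)"
    using has_line_series_scale[OF ab(2) s] by (simp add: w_def algebra_simps)
  ultimately have "hyp_laplacian k (\<lambda>z. f (of_real s * z + of_real t)) z = hyp_laplacian k f w"
    unfolding hyp_laplacian_series[OF ab] by (subst hyp_laplacian_series) (assumption | simp add: w_def power2_eq_square algebra_simps)+
  then show "hyp_laplacian k (\<lambda>z. f (of_real s * z + of_real t)) z = 0"
    using f up[OF z] by (simp add: real_harmonic_def w_def)
qed

lemma real_harmonic_sum:
  assumes "finite F" "F \<noteq> {}" "\<And>i. i \<in> F \<Longrightarrow> real_harmonic k (f i)"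
  shows "real_harmonic k (\<lambda>z. \<Sum>i\<in>F. f i z)"
  using assms by (induction F rule: finite_ne_induct) (auto intro: real_harmonic_add)

section \<open>Fourier expansions of the basis elements\<close>

text \<open>The nonholomorphic series is reindexed by n -> -n. Both series then run over
  \<open>res24\<close>, and the Hecke operator acts on both coefficient sequences by one
  formula.\<close>

definition expands :: "(int \<Rightarrow> complex) \<Rightarrow> (int \<Rightarrow> complex) \<Rightarrow> (complex \<Rightarrow> complex) \<Rightarrow> bool" where
  "expands a c f \<longleftrightarrow> (\<forall>z\<in>upper_half_plane. \<exists>u v.
     ((\<lambda>n. a n * qpow (of_int n / 24) z) has_sum u) res24 \<and>
     ((\<lambda>n. c n * beta_fun (- of_int n * Im z) * qpow (of_int n / 24) z) has_sum v) res24 \<and> f z = u + v)"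

lemma has_sum_uminus_res24:
  assumes "\<And>n. n \<in> A \<longleftrightarrow> - n \<in> (B :: int set)"
  shows "(g has_sum v) A \<longleftrightarrow> ((\<lambda>n. g (- n)) has_sum v) B"
proof -
  have "A = uminus ` B" using assms by (force simp: image_iff)
  then show ?thesis using has_sum_reindex[of uminus B g v] by (simp add: o_def)
qed

lemma uminus_mem_res24: "[n = -1] (mod 24) \<longleftrightarrow> - n \<in> res24"
  using cong_minus_minus_iff[of "- n" 1 "24::int"] by (simp add: res24_def)

lemma maass_expansion_iff: "maass_expansion (5/2) ap am f \<longleftrightarrow> expands ap (\<lambda>n. am (- n)) f"
proof -
  have "((\<lambda>n. am n * incomplete_Gamma (1 - of_real (5/2)) (pi * of_int n * Im z / 6) * qpow (- of_int n / 24) z) has_sum v) {n. [n = -1] (mod 24)}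
    \<longleftrightarrow> ((\<lambda>n. am (- n) * beta_fun (- of_int n * Im z) * qpow (of_int n / 24) z) has_sum v) res24" for z v
  proof -
    have "(\<lambda>n. am (- n) * incomplete_Gamma (1 - of_real (5/2)) (pi * of_int (- n) * Im z / 6) * qpow (- of_int (- n) / 24) z) =
      (\<lambda>n. am (- n) * beta_fun (- of_int n * Im z) * qpow (of_int n / 24) z)"
      by (simp add: fun_eq_iff beta_fun_def mult.assoc)
    moreover have "n \<in> {n. [n = -1] (mod 24)} \<longleftrightarrow> - n \<in> res24" for n by (simp add: uminus_mem_res24)
    ultimately show ?thesis
      using has_sum_uminus_res24[of "{n. [n = -1] (mod 24)}" res24
        "\<lambda>n. am n * incomplete_Gamma (1 - of_real (5/2)) (pi * of_int n * Im z / 6) * qpow (- of_int n / 24) z" v]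
      by (simp only:)
  qed
  then show ?thesis unfolding maass_expansion_def expands_def res24_def[symmetric] by (simp only:)
qed

lemma expands_has_sum:
  assumes "expands a c f" "y > 0"
  shows "((\<lambda>n. ((a n + c n * beta_fun (- of_int n * y)) * of_real (exp (- (2 * pi * (of_int n / 24) * y)))) * ee (of_int n * x / 24)) has_sum f (Complex x y)) res24"
proof -
  obtain u v where "((\<lambda>n. a n * qpow (of_int n / 24) (Complex x y)) has_sum u) res24"
    "((\<lambda>n. c n * beta_fun (- of_int n * y) * qpow (of_int n / 24) (Complex x y)) has_sum v) res24" "f (Complex x y) = u + v"
    using assms unfolding expands_def by (force simp: upper_half_plane_iff)
  from has_sum_add[OF this(1,2)] this(3) show ?thesis
    by (simp add: qpow_Complex distrib_right mult.assoc)
qed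

lemma translate_of_expansion:
  assumes f: "\<And>x y. y > 0 \<Longrightarrow> ((\<lambda>n. b n y * ee (of_int n * x / 24)) has_sum f (Complex x y)) res24"
    and z: "z \<in> upper_half_plane"
  shows "f (z + of_int k) = ee (of_int k / 24) * f z"
proof -
  obtain x y where z_eq: "z = Complex x y" by (cases z)
  have y: "y > 0" using z by (simp add: z_eq upper_half_plane_iff)
  have "ee (of_int n * (x + of_int k) / 24) = ee (of_int k / 24) * ee (of_int n * x / 24)" if "n \<in> res24" for n
  proof -
    have "ee (of_int (n * k) / of_int 24) = ee (of_int (1 * k) / of_int 24)"
      using that by (intro ee_cong_int cong_scalar_right) (simp add: res24_def)
    moreover have "of_int n * (x + of_int k) / 24 = of_int (n * k) / of_int 24 + of_int n * x / 24"
      by (simp add: field_simps)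
    ultimately show ?thesis by (simp only: ee_add) simp
  qed
  then have "((\<lambda>n. ee (of_int k / 24) * (b n y * ee (of_int n * x / 24))) has_sum f (Complex (x + of_int k) y)) res24"
    using f[OF y, of "x + of_int k"] by (subst has_sum_cong) (auto simp: mult_ac)
  from has_sum_unique[OF this has_sum_cmult_right[OF f[OF y, of x]]]
  have "f (Complex (x + of_int k) y) = ee (of_int k / 24) * f (Complex x y)" .
  moreover have "z + of_int k = Complex (x + of_int k) y" by (simp add: z_eq complex_eq_iff)
  ultimately show ?thesis by (simp add: z_eq)
qed

lemma expands_add:
  assumes "expands a c f" "expands a' c' g"
  shows "expands (\<lambda>n. a n + a' n) (\<lambda>n. c n + c' n) (\<lambda>z. f z + g z)"
  unfolding expands_def
proof
  fix z assume z: "z \<in> upper_half_plane"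
  obtain u v where 1: "((\<lambda>n. a n * qpow (of_int n / 24) z) has_sum u) res24"
    "((\<lambda>n. c n * beta_fun (- of_int n * Im z) * qpow (of_int n / 24) z) has_sum v) res24" "f z = u + v"
    using assms(1) z unfolding expands_def by blast
  obtain u' v' where 2: "((\<lambda>n. a' n * qpow (of_int n / 24) z) has_sum u') res24"
    "((\<lambda>n. c' n * beta_fun (- of_int n * Im z) * qpow (of_int n / 24) z) has_sum v') res24" "g z = u' + v'"
    using assms(2) z unfolding expands_def by blast
  show "\<exists>u v. ((\<lambda>n. (a n + a' n) * qpow (of_int n / 24) z) has_sum u) res24 \<and>
    ((\<lambda>n. (c n + c' n) * beta_fun (- of_int n * Im z) * qpow (of_int n / 24) z) has_sum v) res24 \<and> f z + g z = u + v"
    using has_sum_add[OF 1(1) 2(1)] has_sum_add[OF 1(2) 2(2)] 1(3) 2(3)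
    by (intro exI[of _ "u + u'"] exI[of _ "v + v'"]) (simp add: distrib_right)
qed

lemma expands_cmult:
  assumes "expands a c f"
  shows "expands (\<lambda>n. \<alpha> * a n) (\<lambda>n. \<alpha> * c n) (\<lambda>z. \<alpha> * f z)"
  unfolding expands_def
proof
  fix z assume z: "z \<in> upper_half_plane"
  obtain u v where 1: "((\<lambda>n. a n * qpow (of_int n / 24) z) has_sum u) res24"
    "((\<lambda>n. c n * beta_fun (- of_int n * Im z) * qpow (of_int n / 24) z) has_sum v) res24" "f z = u + v"
    using assms(1) z unfolding expands_def by blast
  show "\<exists>u v. ((\<lambda>n. \<alpha> * a n * qpow (of_int n / 24) z) has_sum u) res24 \<and>
    ((\<lambda>n. \<alpha> * c n * beta_fun (- of_int n * Im z) * qpow (of_int n / 24) z) has_sum v) res24 \<and> \<alpha> * f z = u + v"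
    using has_sum_cmult_right[OF 1(1), of \<alpha>] has_sum_cmult_right[OF 1(2), of \<alpha>] 1(3)
    by (intro exI[of _ "\<alpha> * u"] exI[of _ "\<alpha> * v"]) (simp add: distrib_left mult.assoc)
qed

lemma expands_cong:
  assumes "expands a c f" "\<And>z. z \<in> upper_half_plane \<Longrightarrow> g z = f z"
  shows "expands a c g"
  using assms unfolding expands_def by simp

text \<open>\<open>hecke_coeff\<close> stripped of y: the factors exp (-2 pi n y/24) and
  \<open>beta_fun\<close> at -n y depend on n y alone, and so are unchanged when (n, y) becomes (l^2
  n, y/l^2) or (n/l^2, l^2 y).\<close>

definition coeff_hecke :: "nat \<Rightarrow> (int \<Rightarrow> complex) \<Rightarrow> int \<Rightarrow> complex" where
  "coeff_hecke l a n = a ((int l)\<^sup>2 * n) + of_nat l * of_int (Legendre (3 * n) (int l)) * a n +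
    of_nat l ^ 3 * (if (int l)\<^sup>2 dvd n then a (n div (int l)\<^sup>2) else 0)"

lemma hecke_sum_add:
  "hecke_sum l (\<lambda>z. f z + g z) z = hecke_sum l f z + hecke_sum l g z"
  by (simp add: hecke_sum_def sum.distrib distrib_left)

lemma hecke_sum_arguments:
  assumes "z \<in> upper_half_plane" "l > 0"
  shows "(z + 24 * of_int v) / of_nat l ^ 2 \<in> upper_half_plane" "z + 24 * of_int v / of_nat l \<in> upper_half_plane"
    "of_nat l ^ 2 * z \<in> upper_half_plane"
proof -
  have 1: "(z + 24 * of_int v) / of_nat l ^ 2 = (z + 24 * of_int v) / of_real ((real l)\<^sup>2)" by simp
  have 2: "z + 24 * of_int v / of_nat l = z + of_real (24 * of_int v / real l)" by simp
  have 3: "of_nat l ^ 2 * z = of_real ((real l)\<^sup>2) * z" by simp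
  show "(z + 24 * of_int v) / of_nat l ^ 2 \<in> upper_half_plane" "z + 24 * of_int v / of_nat l \<in> upper_half_plane"
    "of_nat l ^ 2 * z \<in> upper_half_plane"
    unfolding 1 2 3 upper_half_plane_iff using assms
    by (simp_all add: upper_half_plane_iff Im_divide_of_real del: of_real_power of_real_divide)
qed

lemma hecke_sum_cong:
  assumes "\<And>z. z \<in> upper_half_plane \<Longrightarrow> f z = g z" "z \<in> upper_half_plane" "l > 0"
  shows "hecke_sum l f z = hecke_sum l g z"
  unfolding hecke_sum_def using hecke_sum_arguments[OF assms(2,3)] assms(1) by simp

lemma expands_hecke_sum:
  assumes l: "prime l" "5 \<le> l" and f: "expands a c f"
  shows "expands (coeff_hecke l a) (coeff_hecke l c) (hecke_sum l f)"
  unfolding expands_def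
proof
  fix z assume z: "z \<in> upper_half_plane"
  define E where "E n y = complex_of_real (exp (- (2 * pi * (of_int n / 24) * y)))" for n :: int and y :: real
  \<comment> \<open>The holomorphic part and, below, the nonholomorphic part \<open>q\<close>;
    \<open>expands\<close> asks for the two series separately, so the Hecke sum is computed on
    each.\<close>
  define p where "p z = (\<Sum>\<^sub>\<infinity>n\<in>res24. a n * qpow (of_int n / 24) z)" for z
  define q where "q z = (\<Sum>\<^sub>\<infinity>n\<in>res24. c n * beta_fun (- of_int n * Im z) * qpow (of_int n / 24) z)" for z
  have pq: "((\<lambda>n. a n * qpow (of_int n / 24) z) has_sum p z) res24 \<and>
    ((\<lambda>n. c n * beta_fun (- of_int n * Im z) * qpow (of_int n / 24) z) has_sum q z) res24 \<and> f z = p z + q z"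
    if "z \<in> upper_half_plane" for z
    using f that unfolding expands_def p_def q_def by (auto simp: infsumI)
  have l0: "l > 0" using l by (simp add: prime_gt_0_nat)
  have rl: "(real l)\<^sup>2 \<noteq> 0" using l0 by simp
  have E1: "E ((int l)\<^sup>2 * n) (y / (real l)\<^sup>2) = E n y" for n y using l0 by (simp add: E_def)
  have E2: "E (n div (int l)\<^sup>2) ((real l)\<^sup>2 * y) = E n y" if "(int l)\<^sup>2 dvd n" for n y
  proof -
    obtain k where "n = (int l)\<^sup>2 * k" using \<open>(int l)\<^sup>2 dvd n\<close> by blast
    then show ?thesis using l0 by (simp add: E_def mult_ac)
  qed
  have B2: "beta_fun (- (real_of_int (n div (int l)\<^sup>2) * ((real l)\<^sup>2 * y))) = beta_fun (- (of_int n * y))" if "(int l)\<^sup>2 dvd n" for n y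
  proof -
    obtain k where "n = (int l)\<^sup>2 * k" using \<open>(int l)\<^sup>2 dvd n\<close> by blast
    then show ?thesis using l0 by (simp add: mult_ac)
  qed
  have z_eq: "z = Complex (Re z) (Im z)" by simp
  have y: "Im z > 0" using z by (simp add: upper_half_plane_iff)
  have q_Complex: "qpow (of_int n / 24) (Complex x y) = E n y * ee (of_int n * x / 24)" for n x y
    by (simp add: qpow_Complex E_def)
  have "((\<lambda>n. hecke_coeff l (\<lambda>n y. a n * E n y) n (Im z) * ee (of_int n * Re z / 24)) has_sum hecke_sum l p (Complex (Re z) (Im z))) res24"
  proof (rule hecke_sum_has_sum[OF l _ y])
    show "((\<lambda>n. a n * E n y * ee (of_int n * x / 24)) has_sum p (Complex x y)) res24" if "y > 0" for x y
      using pq[of "Complex x y"] that by (simp add: upper_half_plane_iff q_Complex mult.assoc)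
  qed
  moreover have "hecke_coeff l (\<lambda>n y. a n * E n y) n (Im z) = coeff_hecke l a n * E n (Im z)" for n
    using E1 E2 by (simp add: hecke_coeff_def coeff_hecke_def distrib_right mult.assoc)
  ultimately have P: "((\<lambda>n. coeff_hecke l a n * qpow (of_int n / 24) z) has_sum hecke_sum l p z) res24"
    using q_Complex[of _ "Re z" "Im z"] by (simp add: mult.assoc)
  have "((\<lambda>n. hecke_coeff l (\<lambda>n y. c n * beta_fun (- of_int n * y) * E n y) n (Im z) * ee (of_int n * Re z / 24)) has_sum hecke_sum l q (Complex (Re z) (Im z))) res24"
  proof (rule hecke_sum_has_sum[OF l _ y])
    show "((\<lambda>n. c n * beta_fun (- of_int n * y) * E n y * ee (of_int n * x / 24)) has_sum q (Complex x y)) res24" if "y > 0" for x y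
      using pq[of "Complex x y"] that by (simp add: upper_half_plane_iff q_Complex mult.assoc)
  qed
  moreover have "hecke_coeff l (\<lambda>n y. c n * beta_fun (- of_int n * y) * E n y) n (Im z) =
    coeff_hecke l c n * beta_fun (- of_int n * Im z) * E n (Im z)" for n
    using E1 E2 B2 rl by (simp add: hecke_coeff_def coeff_hecke_def distrib_right mult.assoc)
  ultimately have Q: "((\<lambda>n. coeff_hecke l c n * beta_fun (- of_int n * Im z) * qpow (of_int n / 24) z) has_sum hecke_sum l q z) res24"
    using q_Complex[of _ "Re z" "Im z"] by (simp add: mult.assoc)
  have "hecke_sum l f z = hecke_sum l (\<lambda>z. p z + q z) z"
    by (rule hecke_sum_cong[OF _ z l0]) (use pq in blast)
  with P Q show "\<exists>u v. ((\<lambda>n. coeff_hecke l a n * qpow (of_int n / 24) z) has_sum u) res24 \<and>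
    ((\<lambda>n. coeff_hecke l c n * beta_fun (- of_int n * Im z) * qpow (of_int n / 24) z) has_sum v) res24 \<and> hecke_sum l f z = u + v"
    unfolding hecke_sum_add by blast
qed

lemma real_harmonic_hecke_sum:
  assumes l: "prime l" and f: "real_harmonic k f"
  shows "real_harmonic k (hecke_sum l f)"
proof -
  have l0: "real l > 0" using l by (simp add: prime_gt_0_nat)
  have 1: "real_harmonic k (\<lambda>z. f ((z + 24 * of_int v) / of_nat l ^ 2))" for v
    by (rule real_harmonic_cong[OF real_harmonic_affine[OF f, of "1 / (real l)\<^sup>2" "24 * of_int v / (real l)\<^sup>2"]])
       (use l0 in \<open>auto simp: add_divide_distrib\<close>)
  have 2: "real_harmonic k (\<lambda>z. f (z + 24 * of_int v / of_nat l))" for v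
    by (rule real_harmonic_cong[OF real_harmonic_affine[OF f, of 1 "24 * of_int v / real l"]]) auto
  have 3: "real_harmonic k (\<lambda>z. f (of_nat l ^ 2 * z))"
    by (rule real_harmonic_cong[OF real_harmonic_affine[OF f, of "(real l)\<^sup>2" 0]]) (use l0 in auto)
  have ne: "{0..<(int l)\<^sup>2} \<noteq> {}" "{0..<int l} \<noteq> {}" using l0 by auto
  show ?thesis
    unfolding hecke_sum_def
    by (intro real_harmonic_add real_harmonic_cmult real_harmonic_sum 1 2 3 ne finite_atLeastLessThan_int)
qed

text \<open>The principal part of h_m in the indexing of \<open>expands\<close>, where c at n > 0
  belongs to beta at a negative argument. Each clause is a constant times a delta at m, with the
  constant 0 written out, to fit \<open>coeff_hecke_delta\<close>.\<close>

definition h_shape :: "int \<Rightarrow> (int \<Rightarrow> complex) \<Rightarrow> (int \<Rightarrow> complex) \<Rightarrow> bool" where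
  "h_shape m a c \<longleftrightarrow>
    (\<forall>n\<in>{n\<in>res24. n < 0}. a n = (if m < 0 then 1 else 0) * of_bool (n = m)) \<and>
    (\<forall>n\<in>{n\<in>res24. n > 0}. c n = (if m < 0 then 0 else \<i>) * of_bool (n = m)) \<and>
    (m < 0 \<longrightarrow> (\<forall>n\<in>res24. c n = 0 * of_bool (n = m)))"

lemma zero_notin_res24: "0 \<notin> res24"
  by (simp add: res24_def cong_def)

lemma is_maass_h_expands:
  assumes m: "m \<in> res24" and f: "is_maass_h m f"
  obtains a c where "expands a c f" "h_shape m a c"
proof (cases "m < 0")
  case True
  then obtain pp where pp: "\<And>z. z \<in> upper_half_plane \<Longrightarrow> \<exists>u.
      ((\<lambda>n. pp n * qpow (of_int n / 24) z) has_sum u) {n. 0 < n \<and> [n = 1] (mod 24)} \<and> f z = qpow (of_int m / 24) z + u"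
    using f by (auto simp: is_maass_h_def)
  define a where "a n = (if n > 0 then pp n else of_bool (n = m))" for n
  show thesis
  proof (rule that)
    show "h_shape m a (\<lambda>_. 0)" using True by (simp add: h_shape_def a_def)
    show "expands a (\<lambda>_. 0) f" unfolding expands_def
    proof
      fix z assume z: "z \<in> upper_half_plane"
      obtain u where u: "((\<lambda>n. pp n * qpow (of_int n / 24) z) has_sum u) {n. 0 < n \<and> [n = 1] (mod 24)}" "f z = qpow (of_int m / 24) z + u"
        using pp[OF z] by blast
      have "((\<lambda>n. if n > 0 then pp n * qpow (of_int n / 24) z else 0) has_sum u) res24"
        using u(1) by (subst has_sum_cong_neutral[where T = "{n. 0 < n \<and> [n = 1] (mod 24)}"]) (auto simp: res24_def)
      moreover have "((\<lambda>n. if n = m then qpow (of_int n / 24) z else 0) has_sum qpow (of_int m / 24) z) res24"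
        by (rule has_sum_finite_neutralI[of "{m}"]) (use m in auto)
      ultimately have "((\<lambda>n. (if n > 0 then pp n * qpow (of_int n / 24) z else 0) + (if n = m then qpow (of_int n / 24) z else 0)) has_sum (u + qpow (of_int m / 24) z)) res24"
        by (rule has_sum_add)
      moreover have "(if n > 0 then pp n * qpow (of_int n / 24) z else 0) + (if n = m then qpow (of_int n / 24) z else 0) = a n * qpow (of_int n / 24) z" for n
        using True by (simp add: a_def)
      ultimately show "\<exists>u v. ((\<lambda>n. a n * qpow (of_int n / 24) z) has_sum u) res24 \<and>
        ((\<lambda>n. 0 * beta_fun (- of_int n * Im z) * qpow (of_int n / 24) z) has_sum v) res24 \<and> f z = u + v"
        using u(2) by (intro exI[of _ "u + qpow (of_int m / 24) z"] exI[of _ 0]) simp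
    qed
  qed
next
  case False
  then have "\<exists>pp pm :: int \<Rightarrow> complex. \<forall>z\<in>upper_half_plane. \<exists>u v.
       ((\<lambda>n. pp n * qpow (of_int n / 24) z) has_sum u) {n. 0 < n \<and> [n = 1] (mod 24)} \<and>
       ((\<lambda>n. pm n * beta_fun (of_int n * Im z) * qpow (- of_int n / 24) z) has_sum v) {n. 0 < n \<and> [n = -1] (mod 24)} \<and>
       f z = u + \<i> * beta_fun (- of_int m * Im z) * qpow (of_int m / 24) z + v"
    using f unfolding is_maass_h_def by (simp only: if_False)
  then obtain pp pm :: "int \<Rightarrow> complex" where pp: "\<forall>z\<in>upper_half_plane. \<exists>u v.
       ((\<lambda>n. pp n * qpow (of_int n / 24) z) has_sum u) {n. 0 < n \<and> [n = 1] (mod 24)} \<and>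
       ((\<lambda>n. pm n * beta_fun (of_int n * Im z) * qpow (- of_int n / 24) z) has_sum v) {n. 0 < n \<and> [n = -1] (mod 24)} \<and>
       f z = u + \<i> * beta_fun (- of_int m * Im z) * qpow (of_int m / 24) z + v"
    by (elim exE)
  have m0: "m > 0" using False m zero_notin_res24 by (cases "m = 0") auto
  define a where "a n = (if n > 0 then pp n else 0)" for n
  define c where "c n = (if n < 0 then pm (- n) else \<i> * of_bool (n = m))" for n
  show thesis
  proof (rule that)
    show "h_shape m a c" using m0 by (simp add: h_shape_def a_def c_def)
    show "expands a c f" unfolding expands_def
    proof
      fix z assume z: "z \<in> upper_half_plane"
      define B where "B n = beta_fun (- of_int n * Im z) * qpow (of_int n / 24) z" for n
      obtain u v where u: "((\<lambda>n. pp n * qpow (of_int n / 24) z) has_sum u) {n. 0 < n \<and> [n = 1] (mod 24)}"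
        and v: "((\<lambda>n. pm n * beta_fun (of_int n * Im z) * qpow (- of_int n / 24) z) has_sum v) {n. 0 < n \<and> [n = -1] (mod 24)}"
        and fz: "f z = u + \<i> * B m + v"
        using bspec[OF pp z] by (auto simp: B_def mult.assoc)
      have 1: "((\<lambda>n. a n * qpow (of_int n / 24) z) has_sum u) res24"
        using u by (subst has_sum_cong_neutral[where T = "{n. 0 < n \<and> [n = 1] (mod 24)}" and g = "\<lambda>n. pp n * qpow (of_int n / 24) z"])
          (auto simp: res24_def a_def)
      have "((\<lambda>n. pm (- n) * B n) has_sum v) {n\<in>res24. n < 0}"
      proof -
        have "(\<lambda>n. pm (- n) * beta_fun (of_int (- n) * Im z) * qpow (- of_int (- n) / 24) z) = (\<lambda>n. pm (- n) * B n)"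
          by (simp add: fun_eq_iff B_def mult.assoc)
        moreover have "n \<in> {n. 0 < n \<and> [n = -1] (mod 24)} \<longleftrightarrow> - n \<in> {n\<in>res24. n < 0}" for n
          by (auto simp: uminus_mem_res24)
        ultimately show ?thesis
          using v has_sum_uminus_res24[of "{n. 0 < n \<and> [n = -1] (mod 24)}" "{n\<in>res24. n < 0}"
            "\<lambda>n. pm n * beta_fun (of_int n * Im z) * qpow (- of_int n / 24) z" v]
          by (simp only:)
      qed
      then have "((\<lambda>n. if n < 0 then pm (- n) * B n else 0) has_sum v) res24"
        by (subst has_sum_cong_neutral[where T = "{n\<in>res24. n < 0}" and g = "\<lambda>n. pm (- n) * B n"]) auto
      moreover have "((\<lambda>n. if n = m then \<i> * B n else 0) has_sum \<i> * B m) res24"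
        by (rule has_sum_finite_neutralI[of "{m}"]) (use m in auto)
      ultimately have "((\<lambda>n. (if n < 0 then pm (- n) * B n else 0) + (if n = m then \<i> * B n else 0)) has_sum (v + \<i> * B m)) res24"
        by (rule has_sum_add)
      moreover have "(if n < 0 then pm (- n) * B n else 0) + (if n = m then \<i> * B n else 0) = c n * beta_fun (- of_int n * Im z) * qpow (of_int n / 24) z" for n
        using m0 by (simp add: c_def B_def)
      ultimately have 2: "((\<lambda>n. c n * beta_fun (- of_int n * Im z) * qpow (of_int n / 24) z) has_sum (v + \<i> * B m)) res24" by simp
      show "\<exists>u v. ((\<lambda>n. a n * qpow (of_int n / 24) z) has_sum u) res24 \<and>
        ((\<lambda>n. c n * beta_fun (- of_int n * Im z) * qpow (of_int n / 24) z) has_sum v) res24 \<and> f z = u + v"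
        using 1 2 fz by (intro exI[of _ u] exI[of _ "v + \<i> * B m"]) simp
    qed
  qed
qed

text \<open>The principal term is separated from its series by adding the negative of that term as a
  series with one nonzero entry; \<open>h_shape\<close> confines the remaining support.\<close>

lemma is_maass_hI:
  assumes m: "m \<in> res24" and wm: "f \<in> weak_harmonic_maass (5/2)" and f: "expands a c f" and shape: "h_shape m a c"
  shows "is_maass_h m f"
proof (cases "m < 0")
  case True
  have "\<exists>u. ((\<lambda>n. a n * qpow (of_int n / 24) z) has_sum u) {n. 0 < n \<and> [n = 1] (mod 24)} \<and> f z = qpow (of_int m / 24) z + u"
    if z: "z \<in> upper_half_plane" for z
  proof -
    obtain u v where uv: "((\<lambda>n. a n * qpow (of_int n / 24) z) has_sum u) res24"
      "((\<lambda>n. c n * beta_fun (- of_int n * Im z) * qpow (of_int n / 24) z) has_sum v) res24" "f z = u + v"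
      using f z unfolding expands_def by blast
    have "((\<lambda>n. c n * beta_fun (- of_int n * Im z) * qpow (of_int n / 24) z) has_sum 0) res24"
      by (rule has_sum_0) (use shape True in \<open>simp add: h_shape_def\<close>)
    then have v: "v = 0" using uv(2) has_sum_unique by blast
    have "((\<lambda>n. if n = m then - qpow (of_int n / 24) z else 0) has_sum (- qpow (of_int m / 24) z)) res24"
      by (rule has_sum_finite_neutralI[of "{m}"]) (use m in auto)
    from has_sum_add[OF uv(1) this]
    have "((\<lambda>n. a n * qpow (of_int n / 24) z) has_sum (u + - qpow (of_int m / 24) z)) {n. 0 < n \<and> [n = 1] (mod 24)}"
    proof (rule has_sum_cong_neutral[THEN iffD1, rotated -1])
      fix n assume "n \<in> res24 - {n. 0 < n \<and> [n = 1] (mod 24)}"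
      then have "n \<in> {n\<in>res24. n < 0}" using zero_notin_res24 by (cases "n = 0") (auto simp: res24_def)
      then have "a n = of_bool (n = m)" using shape True unfolding h_shape_def by auto
      then show "a n * qpow (of_int n / 24) z + (if n = m then - qpow (of_int n / 24) z else 0) = 0" by simp
    qed (use True in \<open>auto simp: res24_def\<close>)
    then show ?thesis using uv(3) v by (intro exI[of _ "u + - qpow (of_int m / 24) z"]) simp
  qed
  then show ?thesis using wm True unfolding is_maass_h_def by auto
next
  case False
  have m0: "m > 0" using False m zero_notin_res24 by (cases "m = 0") auto
  have "\<exists>u v. ((\<lambda>n. a n * qpow (of_int n / 24) z) has_sum u) {n. 0 < n \<and> [n = 1] (mod 24)} \<and>
       ((\<lambda>n. c (- n) * beta_fun (of_int n * Im z) * qpow (- of_int n / 24) z) has_sum v) {n. 0 < n \<and> [n = -1] (mod 24)} \<and>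
       f z = u + \<i> * beta_fun (- of_int m * Im z) * qpow (of_int m / 24) z + v"
    if z: "z \<in> upper_half_plane" for z
  proof -
    define B where "B n = beta_fun (- of_int n * Im z) * qpow (of_int n / 24) z" for n
    obtain u v where uv: "((\<lambda>n. a n * qpow (of_int n / 24) z) has_sum u) res24"
      "((\<lambda>n. c n * B n) has_sum v) res24" "f z = u + v"
      using f z unfolding expands_def B_def by (auto simp: mult.assoc)
    have 1: "((\<lambda>n. a n * qpow (of_int n / 24) z) has_sum u) {n. 0 < n \<and> [n = 1] (mod 24)}"
      using uv(1)
    proof (rule has_sum_cong_neutral[THEN iffD1, rotated -1])
      fix n assume "n \<in> res24 - {n. 0 < n \<and> [n = 1] (mod 24)}"
      then have "n \<in> {n\<in>res24. n < 0}" using zero_notin_res24 by (cases "n = 0") (auto simp: res24_def)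
      then have "a n = 0" using shape False unfolding h_shape_def by auto
      then show "a n * qpow (of_int n / 24) z = 0" by simp
    qed (auto simp: res24_def)
    have "((\<lambda>n. if n = m then - \<i> * B n else 0) has_sum (- \<i> * B m)) res24"
      by (rule has_sum_finite_neutralI[of "{m}"]) (use m in auto)
    from has_sum_add[OF uv(2) this]
    have "((\<lambda>n. c n * B n) has_sum (v + - \<i> * B m)) {n\<in>res24. n < 0}"
    proof (rule has_sum_cong_neutral[THEN iffD1, rotated -1])
      fix n assume "n \<in> res24 - {n\<in>res24. n < 0}"
      then have "n \<in> {n\<in>res24. n > 0}" using zero_notin_res24 by (cases "n = 0") auto
      then have "c n = \<i> * of_bool (n = m)" using shape False unfolding h_shape_def by auto
      then show "c n * B n + (if n = m then - \<i> * B n else 0) = 0" by simp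
    qed (use m0 in auto)
    then have 2: "((\<lambda>n. c (- n) * beta_fun (of_int n * Im z) * qpow (- of_int n / 24) z) has_sum (v + - \<i> * B m)) {n. 0 < n \<and> [n = -1] (mod 24)}"
      using has_sum_uminus_res24[of "{n. 0 < n \<and> [n = -1] (mod 24)}" "{n\<in>res24. n < 0}" "\<lambda>n. c (- n) * beta_fun (of_int n * Im z) * qpow (- of_int n / 24) z"]
      by (simp add: uminus_mem_res24 B_def mult.assoc conj_commute)
    show ?thesis using 1 2 uv(3)
      by (intro exI[of _ u] exI[of _ "v + - \<i> * B m"]) (simp add: B_def mult.assoc)
  qed
  note * = ballI[OF this]
  have "\<exists>pp pm :: int \<Rightarrow> complex. \<forall>z\<in>upper_half_plane. \<exists>u v.
       ((\<lambda>n. pp n * qpow (of_int n / 24) z) has_sum u) {n. 0 < n \<and> [n = 1] (mod 24)} \<and>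
       ((\<lambda>n. pm n * beta_fun (of_int n * Im z) * qpow (- of_int n / 24) z) has_sum v) {n. 0 < n \<and> [n = -1] (mod 24)} \<and>
       f z = u + \<i> * beta_fun (- of_int m * Im z) * qpow (of_int m / 24) z + v"
    by (rule exI[where x = a], rule exI[where x = "\<lambda>n. c (- n)"], rule *)
  then show ?thesis using wm False unfolding is_maass_h_def by (simp only: if_False)
qed

text \<open>The Hecke operator carries a delta at m to deltas at m/l^2, m and l^2 m with weights 1,
  l (3m/l) and l^3, the first one only if l^2 divides m. The added terms cancel the first two. The
  set S is any index set stable under the changes of index, since a and c are prescribed only on
  some of the indices.\<close>

lemma coeff_hecke_delta:
  assumes l: "l > 0" and S: "\<And>n. n \<in> S \<Longrightarrow> (int l)\<^sup>2 * n \<in> S" "\<And>n. n \<in> S \<Longrightarrow> (int l)\<^sup>2 dvd n \<Longrightarrow> n div (int l)\<^sup>2 \<in> S"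
    and a: "\<And>n. n \<in> S \<Longrightarrow> a n = \<kappa> * of_bool (n = m)"
    and a': "\<And>n. (int l)\<^sup>2 dvd m \<Longrightarrow> n \<in> S \<Longrightarrow> a' n = \<kappa> * of_bool (n = m div (int l)\<^sup>2)"
    and n: "n \<in> S"
  shows "coeff_hecke l a n + (- (of_int (Legendre (3 * m) (int l)) * of_nat l)) * a n + (- of_bool ((int l)\<^sup>2 dvd m)) * a' n =
    of_nat l ^ 3 * (\<kappa> * of_bool (n = (int l)\<^sup>2 * m))"
proof -
  have l0: "(int l)\<^sup>2 \<noteq> 0" using l by simp
  have 1: "a ((int l)\<^sup>2 * n) = of_bool ((int l)\<^sup>2 dvd m) * a' n"
  proof (cases "(int l)\<^sup>2 dvd m")
    case True
    then have "(int l)\<^sup>2 * n = m \<longleftrightarrow> n = m div (int l)\<^sup>2" using l0 by auto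
    then show ?thesis using True a[OF S(1)[OF n]] a'[OF True n] by simp
  next
    case False
    then have "(int l)\<^sup>2 * n \<noteq> m" by auto
    then show ?thesis using False a[OF S(1)[OF n]] by simp
  qed
  have 2: "of_int (Legendre (3 * n) (int l)) * a n = of_int (Legendre (3 * m) (int l)) * a n"
    using a[OF n] by (cases "n = m") auto
  have 3: "(if (int l)\<^sup>2 dvd n then a (n div (int l)\<^sup>2) else 0) = \<kappa> * of_bool (n = (int l)\<^sup>2 * m)"
  proof (cases "(int l)\<^sup>2 dvd n")
    case True
    then have "n div (int l)\<^sup>2 = m \<longleftrightarrow> n = (int l)\<^sup>2 * m" using l0 by auto
    then show ?thesis using True a[OF S(2)[OF n True]] by simp
  qed auto
  show ?thesis
    unfolding coeff_hecke_def 1 3 mult.assoc 2 by (simp add: algebra_simps)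
qed

text \<open>\<open>coeff_hecke_delta\<close> on the negative indices for a, on the positive ones for
  c, and for m < 0 on all indices for c. Multiplication and exact division by l^2 preserve signs and
  the class 1 modulo 24.\<close>

lemma h_shape_coeff_hecke:
  assumes l: "prime l" "5 \<le> l" and m: "m \<in> res24" and s: "h_shape m a c"
    and s': "(int l)\<^sup>2 dvd m \<Longrightarrow> h_shape (m div (int l)\<^sup>2) a' c'"
  defines "T \<equiv> \<lambda>a a' n. 1 / of_nat l ^ 3 * (coeff_hecke l a n + (- (of_int (Legendre (3 * m) (int l)) * of_nat l)) * a n + (- of_bool ((int l)\<^sup>2 dvd m)) * a' n)"
  shows "h_shape ((int l)\<^sup>2 * m) (T a a') (T c c')"
proof -
  define L where "L = (int l)\<^sup>2"
  have l0: "l > 0" and L: "L > 0" using l by (simp_all add: L_def prime_gt_0_nat)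
  have L24: "[L = 1] (mod 24)" unfolding L_def by (rule int_prime_square_mod_24[OF l])
  have S1: "L * n \<in> res24" if "n \<in> res24" for n
    using image_square_res24[of "int l"] L24 that unfolding L_def by blast
  have S2: "n div L \<in> res24" if "n \<in> res24" "L dvd n" for n
    using res24_div_square[of "int l" n] L24 that unfolding L_def by blast
  have neg: "L * n < 0 \<longleftrightarrow> n < 0" "L * n > 0 \<longleftrightarrow> n > 0" for n
    using L by (simp_all add: mult_less_0_iff zero_less_mult_iff)
  have dneg: "n div L < 0 \<longleftrightarrow> n < 0" "n div L > 0 \<longleftrightarrow> n > 0" if dvd: "L dvd n" for n
  proof -
    obtain k where "n = L * k" using dvd by blast
    then show "n div L < 0 \<longleftrightarrow> n < 0" "n div L > 0 \<longleftrightarrow> n > 0" using L neg[of k] by simp_all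
  qed
  have T: "T a a' n = \<kappa> * of_bool (n = L * m)"
    if "\<And>n. n \<in> S \<Longrightarrow> L * n \<in> S" "\<And>n. n \<in> S \<Longrightarrow> L dvd n \<Longrightarrow> n div L \<in> S"
      "\<And>n. n \<in> S \<Longrightarrow> a n = \<kappa> * of_bool (n = m)" "\<And>n. L dvd m \<Longrightarrow> n \<in> S \<Longrightarrow> a' n = \<kappa> * of_bool (n = m div L)" "n \<in> S"
    for S n \<kappa> a a'
  proof -
    have eq: "coeff_hecke l a n + (- (of_int (Legendre (3 * m) (int l)) * of_nat l)) * a n + (- of_bool ((int l)\<^sup>2 dvd m)) * a' n =
      of_nat l ^ 3 * (\<kappa> * of_bool (n = (int l)\<^sup>2 * m))"
      by (rule coeff_hecke_delta[OF l0 that[unfolded L_def]])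
    show ?thesis unfolding T_def eq L_def using l0 by simp
  qed
  have "T a a' n = (if L * m < 0 then 1 else 0) * of_bool (n = L * m)" if "n \<in> {n\<in>res24. n < 0}" for n
    using that
  proof (rule T[rotated -1])
    show "a n = (if L * m < 0 then 1 else 0) * of_bool (n = m)" if "n \<in> {n\<in>res24. n < 0}" for n
      using s that unfolding h_shape_def neg by blast
    show "a' n = (if L * m < 0 then 1 else 0) * of_bool (n = m div L)" if "L dvd m" "n \<in> {n\<in>res24. n < 0}" for n
      using s' that dneg[OF that(1)] unfolding h_shape_def neg L_def[symmetric] by auto
  qed (use S1 S2 neg dneg in auto)
  moreover have "T c c' n = (if L * m < 0 then 0 else \<i>) * of_bool (n = L * m)" if "n \<in> {n\<in>res24. n > 0}" for n
    using that
  proof (rule T[rotated -1])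
    show "c n = (if L * m < 0 then 0 else \<i>) * of_bool (n = m)" if "n \<in> {n\<in>res24. n > 0}" for n
      using s that unfolding h_shape_def neg by blast
    show "c' n = (if L * m < 0 then 0 else \<i>) * of_bool (n = m div L)" if "L dvd m" "n \<in> {n\<in>res24. n > 0}" for n
      using s' that dneg[OF that(1)] unfolding h_shape_def neg L_def[symmetric] by auto
  qed (use S1 S2 neg dneg in auto)
  moreover have "T c c' n = 0 * of_bool (n = L * m)" if "m < 0" "n \<in> res24" for n
    using that(2)
  proof (rule T[rotated -1])
    show "c n = 0 * of_bool (n = m)" if "n \<in> res24" for n
      using s that \<open>m < 0\<close> unfolding h_shape_def by blast
    show "c' n = 0 * of_bool (n = m div L)" if "L dvd m" "n \<in> res24" for n
      using s' that \<open>m < 0\<close> dneg[OF that(1)] unfolding h_shape_def L_def[symmetric] by auto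
  qed (use S1 S2 in auto)
  ultimately show ?thesis unfolding h_shape_def L_def[symmetric] neg by blast
qed

lemma weak_harmonic_maass_real_harmonic:
  "f \<in> weak_harmonic_maass k \<Longrightarrow> real_harmonic k f"
  by (simp add: weak_harmonic_maass_def real_harmonic_def)

lemma weak_harmonic_maass_modular:
  assumes "f \<in> weak_harmonic_maass (5/2)" "a * d - b * c = 1" "z \<in> upper_half_plane"
  shows "f (moebius a b c d z) = eta_multiplier a b c d * jfac c d z powr (5/2) * f z"
  using assms by (simp add: weak_harmonic_maass_def)

lemma weak_harmonic_maass_expands:
  assumes "f \<in> weak_harmonic_maass (5/2)"
  obtains a c where "expands a c f"
  using assms by (auto simp: weak_harmonic_maass_def maass_expansion_iff)

lemma half_integral_formI:
  assumes f: "f \<in> weak_harmonic_maass (5/2)" and nz: "\<exists>z\<in>upper_half_plane. f z \<noteq> 0"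
  shows "half_integral_form f"
proof
  obtain a c where "expands a c f" using weak_harmonic_maass_expands[OF f] .
  from translate_of_expansion[OF expands_has_sum[OF this]]
  show "f (z + of_int n) = ee (of_int n / 24) * f z" if "z \<in> upper_half_plane" for z n
    using that by blast
qed (use weak_harmonic_maass_modular[OF f] nz in auto)

text \<open>For m < 0 the holomorphic coefficient at m is 1 and the beta coefficient there is 0, so
  the Fourier coefficient of index m at height 1 is an exponential.\<close>

lemma is_maass_h_negative_nontrivial:
  assumes m: "m \<in> res24" "m < 0" and f: "is_maass_h m f"
  shows "\<exists>z\<in>upper_half_plane. f z \<noteq> 0"
proof (rule ccontr)
  assume "\<not> ?thesis"
  then have zero: "f (Complex x 1) = 0" for x by (simp add: upper_half_plane_iff)
  obtain a c where ac: "expands a c f" "h_shape m a c" using is_maass_h_expands[OF m(1) f] .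
  have "fourier_coeff f m 1 = (a m + c m * beta_fun (- of_int m * 1)) * of_real (exp (- (2 * pi * (of_int m / 24) * 1)))"
    by (rule fourier_coeff_eq[OF expands_has_sum[OF ac(1)] m(1)]) simp
  moreover have "fourier_coeff f m 1 = 0" by (simp add: fourier_coeff_def zero)
  moreover have "a m = 1" "c m = 0" using ac(2) m by (auto simp: h_shape_def)
  ultimately show False by simp
qed

section \<open>The Hecke image of a basis element\<close>

context
  fixes m :: int and l :: nat
  assumes h_exists_unique: "\<And>m'. [m' = 1] (mod 24) \<Longrightarrow> \<exists>!f. is_maass_h m' f"
    and m: "[m = 1] (mod 24)" and l: "prime l" "5 \<le> l"
begin

lemma is_maass_h_maass_h: "m' \<in> res24 \<Longrightarrow> is_maass_h m' (maass_h m')"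
  unfolding maass_h_def res24_def by (rule theI'[OF h_exists_unique]) simp

lemma hecke_maass_h:
  assumes z: "z \<in> upper_half_plane"
  shows "hecke l (maass_h m) z = of_nat l ^ 3 * maass_h ((int l)\<^sup>2 * m) z
    + of_int (Legendre (3 * m) (int l)) * of_nat l * maass_h m z
    + of_bool ((int l)\<^sup>2 dvd m) * maass_h (m div (int l)\<^sup>2) z"
proof -
  have m24: "m \<in> res24" using m by (simp add: res24_def)
  have L24: "[(int l)\<^sup>2 = 1] (mod 24)" by (rule int_prime_square_mod_24[OF l])
  have Lm: "(int l)\<^sup>2 * m \<in> res24" using image_square_res24[OF L24] m24 by blast
  have l0: "l > 0" using l by (simp add: prime_gt_0_nat)
  define f where "f = maass_h m"
  \<comment> \<open>If l^2 does not divide m, the index m is a placeholder with coefficient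
    \<open>k2\<close> = 0; thus \<open>f2\<close> is a basis element in both cases.\<close>
  define m2 where "m2 = (if (int l)\<^sup>2 dvd m then m div (int l)\<^sup>2 else m)"
  have m2: "m2 \<in> res24" using res24_div_square[OF L24 _ m24] m24 by (simp add: m2_def)
  define f2 where "f2 = maass_h m2"
  have hf: "is_maass_h m f" unfolding f_def by (rule is_maass_h_maass_h[OF m24])
  have hf2: "is_maass_h m2 f2" unfolding f2_def by (rule is_maass_h_maass_h[OF m2])
  have wf: "f \<in> weak_harmonic_maass (5/2)" and wf2: "f2 \<in> weak_harmonic_maass (5/2)"
    using hf hf2 by (simp_all add: is_maass_h_def)
  obtain a c where ac: "expands a c f" "h_shape m a c" using is_maass_h_expands[OF m24 hf] .
  obtain a2 c2 where ac2: "expands a2 c2 f2" "h_shape m2 a2 c2" using is_maass_h_expands[OF m2 hf2] .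
  define k1 where "k1 = - (complex_of_int (Legendre (3 * m) (int l)) * of_nat l)"
  define k2 where "k2 = - (of_bool ((int l)\<^sup>2 dvd m) :: complex)"
  define G where "G z = 1 / of_nat l ^ 3 * (hecke_sum l f z + k1 * f z + k2 * f2 z)" for z
  \<comment> \<open>Elements of the space are total functions that vanish outside the upper
    half-plane, and uniqueness compares total functions, so \<open>G\<close> has to be cut
    off.\<close>
  define g where "g z = (if z \<in> upper_half_plane then G z else 0)" for z
  have gG: "g z = G z" if "z \<in> upper_half_plane" for z using that by (simp add: g_def)
  define T where "T = (\<lambda>a a' n. 1 / of_nat l ^ 3 * (coeff_hecke l a n + k1 * a n + k2 * a' n))"
  have gexp: "expands (T a a2) (T c c2) g"
    unfolding T_def
    by (rule expands_cong[OF expands_cmult[OF expands_add[OF expands_add[OF expands_hecke_sum[OF l ac(1)] expands_cmult[OF ac(1)]] expands_cmult[OF ac2(1)]]]])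
       (simp add: gG G_def)
  have shape: "h_shape ((int l)\<^sup>2 * m) (T a a2) (T c c2)"
    unfolding T_def k1_def k2_def
    by (rule h_shape_coeff_hecke[OF l m24 ac(2)]) (use ac2(2) in \<open>simp add: m2_def\<close>)

  \<comment> \<open>The index -23 is negative and in the class 1 modulo 24, so its basis element is
    provably nonzero. It supplies the multiplier values for the other forms, whatever m is.\<close>
  interpret h0: half_integral_form "maass_h (-23)"
  proof (rule half_integral_formI)
    have m0: "-23 \<in> res24" by (simp add: res24_def cong_def)
    show "maass_h (-23) \<in> weak_harmonic_maass (5/2)"
      using is_maass_h_maass_h[OF m0] by (simp add: is_maass_h_def)
    show "\<exists>z\<in>upper_half_plane. maass_h (-23) z \<noteq> 0"
      by (rule is_maass_h_negative_nontrivial[OF m0 _ is_maass_h_maass_h[OF m0]]) simp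
  qed
  have S: "h (-1 / z) = ee (-1/8) * z powr (5/2) * h z" if "h \<in> weak_harmonic_maass (5/2)" "z \<in> upper_half_plane" for h z
    using weak_harmonic_maass_modular[OF that(1), of 0 0 "-1" 1 z] that(2) by (simp add: moebius_def h0.multiplier_S)
  have SH: "hecke_sum l f (-1 / z) = ee (-1/8) * z powr (5/2) * hecke_sum l f z" if z: "z \<in> upper_half_plane" for z
  \<comment> \<open>The locale requires a nonzero form, which has been shown only for negative
    indices; if f vanishes, both sides are 0.\<close>
  proof (cases "\<exists>z\<in>upper_half_plane. f z \<noteq> 0")
    case True
    then interpret half_integral_form f by (rule half_integral_formI[OF wf])
    show ?thesis by (rule hecke_sum_S[OF l z])
  next
    case False
    then have "hecke_sum l f w = hecke_sum l (\<lambda>_. 0) w" if "w \<in> upper_half_plane" for w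
      using that l0 by (intro hecke_sum_cong) auto
    moreover have "hecke_sum l (\<lambda>_. 0) w = 0" for w by (simp add: hecke_sum_def)
    moreover have "-1 / z \<in> upper_half_plane"
      using moebius_upper_half_plane[of 0 0 "-1" 1 z] z by (simp add: moebius_def)
    ultimately show ?thesis using z by simp
  qed
  have modular: "g (moebius a b c d z) = eta_multiplier a b c d * jfac c d z powr (5/2) * g z"
    if "a * d - b * c = 1" "z \<in> upper_half_plane" for a b c d z
  proof -
    have "h0.transforms (5/2) g a b c d"
    proof (rule h0.transforms_of_generators[OF _ _ _ that(1)])
      show "g (z + of_int n) = ee (of_int n / 24) * g z" if "z \<in> upper_half_plane" for z n
        by (rule translate_of_expansion[OF expands_has_sum[OF gexp] that])
      show "g (-1 / z) = ee (-1/8) * z powr (5/2) * g z" if z: "z \<in> upper_half_plane" for z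
      proof -
        have "-1 / z \<in> upper_half_plane"
          using moebius_upper_half_plane[of 0 0 "-1" 1 z] z by (simp add: moebius_def)
        then have "g (-1 / z) = G (-1 / z)" by (rule gG)
        also have "\<dots> = ee (-1/8) * z powr (5/2) * G z"
          unfolding G_def S[OF wf z] S[OF wf2 z] SH[OF z] by (simp add: algebra_simps)
        finally show ?thesis by (simp only: gG[OF z])
      qed
    qed simp
    then show ?thesis using that(2) unfolding h0.transforms_def by blast
  qed
  have "real_harmonic (5/2) G"
    unfolding G_def
    by (intro real_harmonic_cmult real_harmonic_add real_harmonic_hecke_sum l
        weak_harmonic_maass_real_harmonic wf wf2)
  then have rh: "real_harmonic (5/2) g" by (rule real_harmonic_cong) (rule gG)
  have fin1: "finite {n. [n = 1] (mod 24) \<and> n \<le> 0 \<and> T a a2 n \<noteq> 0}"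
  proof (rule finite_subset)
    show "{n. [n = 1] (mod 24) \<and> n \<le> 0 \<and> T a a2 n \<noteq> 0} \<subseteq> {(int l)\<^sup>2 * m}"
    proof safe
      fix n assume n: "[n = 1] (mod 24)" "n \<le> 0" "T a a2 n \<noteq> 0"
      then have "n \<in> {n\<in>res24. n < 0}" using zero_notin_res24 by (cases "n = 0") (auto simp: res24_def)
      with shape n(3) show "n = (int l)\<^sup>2 * m" unfolding h_shape_def by (auto split: if_splits)
    qed
  qed simp
  have fin2: "finite {n. [n = -1] (mod 24) \<and> n \<le> 0 \<and> T c c2 (- n) \<noteq> 0}"
  proof (rule finite_subset)
    show "{n. [n = -1] (mod 24) \<and> n \<le> 0 \<and> T c c2 (- n) \<noteq> 0} \<subseteq> {- ((int l)\<^sup>2 * m)}"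
    proof safe
      fix n assume n: "[n = -1] (mod 24)" "n \<le> 0" "T c c2 (- n) \<noteq> 0"
      then have "- n \<in> {n\<in>res24. n > 0}"
        using zero_notin_res24 by (cases "n = 0") (auto simp: uminus_mem_res24)
      with shape n(3) have "- n = (int l)\<^sup>2 * m" unfolding h_shape_def by fastforce
      then show "n = - ((int l)\<^sup>2 * m)" by simp
    qed
  qed simp
  have "maass_expansion (5/2) (T a a2) (\<lambda>n. T c c2 (- n)) g"
    unfolding maass_expansion_iff using gexp by simp
  with fin1 fin2 have "\<exists>ap am. maass_expansion (5/2) ap am g \<and>
      finite {n. [n = 1] (mod 24) \<and> n \<le> 0 \<and> ap n \<noteq> 0} \<and> finite {n. [n = -1] (mod 24) \<and> n \<le> 0 \<and> am n \<noteq> 0}"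
    by blast
  then have "g \<in> weak_harmonic_maass (5/2)"
    unfolding weak_harmonic_maass_def using rh modular by (simp add: real_harmonic_def g_def)
  then have "is_maass_h ((int l)\<^sup>2 * m) g"
    by (rule is_maass_hI[OF Lm _ gexp shape])
  then have g: "maass_h ((int l)\<^sup>2 * m) = g"
    using is_maass_h_maass_h[OF Lm] h_exists_unique[of "(int l)\<^sup>2 * m"] Lm by (auto simp: res24_def)
  have "hecke l f z = hecke_sum l f z"
    by (rule hecke_eq_hecke_sum[OF l expands_has_sum[OF ac(1)]]) (use z in \<open>auto simp: upper_half_plane_iff\<close>)
  also have "\<dots> = of_nat l ^ 3 * g z - k1 * f z - k2 * f2 z"
    using l0 by (simp add: gG[OF z] G_def)
  also have "k2 * f2 z = - of_bool ((int l)\<^sup>2 dvd m) * maass_h (m div (int l)\<^sup>2) z"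
    by (simp add: k2_def f2_def m2_def)
  finally show ?thesis unfolding g k1_def f_def by simp
qed

end

theorem theorem5:
  fixes m :: int and l :: nat
  assumes h_exists_unique: "\<And>m'. [m' = 1] (mod 24) \<Longrightarrow> \<exists>!f. is_maass_h m' f"
    and m: "[m = 1] (mod 24)"
    and l: "prime l" "l \<ge> 5"
  shows "(\<not> (int l)\<^sup>2 dvd m \<longrightarrow> (\<forall>z\<in>upper_half_plane.
            hecke l (maass_h m) z =
              of_nat l ^ 3 * maass_h ((int l)\<^sup>2 * m) z
              + of_int (Legendre (3 * m) (int l)) * of_nat l * maass_h m z))
       \<and> ((int l)\<^sup>2 dvd m \<longrightarrow> (\<forall>z\<in>upper_half_plane.
            hecke l (maass_h m) z =
              of_nat l ^ 3 * maass_h ((int l)\<^sup>2 * m) z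
              + of_int (Legendre (3 * m) (int l)) * of_nat l * maass_h m z
              + maass_h (m div (int l)\<^sup>2) z))"
  using hecke_maass_h[OF h_exists_unique m l] by simp

end
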